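(* Let $d\ge 1$, $\beta\in(0,1]$, $F,L>0$, $\gamma,\rho>0$, let $P\in\mathcal P$ with density $p$ and $Q\in\mathcal Q(P,\gamma,\rho)$ with density $q$, and let $f\in\mathcal H_\beta(F,L)$. Consider the regression model under covariate shift described in the context, with source sample $(X_1,Y_1),\dots,(X_n,Y_n)$ and target sample $(X_1',Y_1'),\dots,(X_m',Y_m')$. Put $$r_T:=\frac{2\beta}{2\beta+d}\wedge\gamma,\qquad r_M:=\frac{\rho}{\rho+d}\wedge\frac{2\beta}{2\beta+d},$$ and let $\kappa_P,\kappa_Q>0$ be arbitrary constants. (i) Let $0<c_1\le c_2$ and let $\widehat p$ be the $\ell$-nearest-neighbour density estimator built from $X_1,\dots,X_n$, with $\ell=\ell_n\in\{1,\dots,n\}$ such that $c_1\log n\le\ell\le c_2\log n$ for all sufficiently large $n$. Let $\widehat f$ be the one-sample local $k_P$-nearest-neighbour estimator with $$k_P(x):=n\wedge\Big(\big\lceil\kappa_P\log(n)^{d/(2\beta+d)}(n\widehat p(x))^{2\beta/(2\beta+d)}\big\rceil\vee\lceil\log n\rceil\Big).$$ Then for every $\tau>1$ there exist $N>0$ and a constant $C_3>0$ (not depending on $n$) such that for all $n\ge N$, with probability at least $1-3n^{1-\tau}$, $$\mathcal E_Q(\widehat f,f)\le C_3\Big(\frac{\log n}{n}\Big)^{r_T}.$$ (ii) Let $c_0>0$ and $0<c_1\le c_2$. Let $\widehat p$ be the $\ell_P$-nearest-neighbour density estimator built from $X_1,\dots,X_n$ and $\widehat q$ the $\ell_Q$-nearest-neighbour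 density estimator built from $X_1',\dots,X_m'$, where $\ell_P=\ell_Q\in\{1,\dots,n\wedge m\}$ satisfies $c_1\log(n+m)\le\ell_P\le c_2\log(n+m)$. Let $\widehat f$ be the two-sample local $(k_P,k_Q)$-nearest-neighbour estimator with $$k_P(x):=n\wedge\Big(\big\lceil\kappa_P\log(n+m)^{d/(2\beta+d)}(n\widehat p(x))^{2\beta/(2\beta+d)}\big\rceil\vee\lceil\log n\rceil\Big),$$ $$k_Q(x):=m\wedge\Big(\big\lceil\kappa_Q\log(n+m)^{d/(2\beta+d)}(m\widehat q(x))^{2\beta/(2\beta+d)}\big\rceil\vee\lceil\log m\rceil\Big).$$ Then for every $\tau>1$ there exist $N\ge 2d$, $M\ge 2d$ and a constant $C_4>0$ (not depending on $n,m$) such that for all $n\ge N$ and $m\ge M$ with $n\wedge m\ge c_0\log(n+m)$, with probability at least $1-3n^{1-\tau}-3m^{1-\tau}$, $$\mathcal E_Q(\widehat f,f)\le C_4\Bigg(\Big(\frac{n}{\log n}\Big)^{r_T}+\Big(\frac{m}{\log m}\Big)^{r_M}\Bigg)^{-1}.$$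
   Context: $\|\cdot\|$ is the Euclidean norm on $\mathbb R^d$, $B(x,r)$ the closed ball, $a\wedge b=\min$, $a\vee b=\max$. Class $\mathcal P=\mathcal P(\overline p,a_-,r_-,a_+,r_+)$ (fixed positive parameters): the probability distributions $P$ on $\mathbb R^d$ with a Lebesgue density $p$ satisfying $\|p\|_\infty\le\overline p<\infty$, the minimal mass property $P\{B(x,r)\}\ge a_-p(x)r^d$ for all $x\in\mathbb R^d$ and $r\in(0,r_-]$, and the maximal mass property $P\{B(x,r)\}\le a_+p(x)r^d$ for all $x$ with $p(x)>0$ and all $r\in(0,r_+]$. Class $\mathcal Q(P,\gamma,\rho)$ for $P\in\mathcal P$ with density $p$: the distributions $Q\in\mathcal P$ with density $q$ such that $\int q(x)/p(x)^\gamma\,dx<\infty$ (density ratio exponent $\gamma$) and $\int q(x)^{d/(\rho+d)}\,dx<\infty$. The integrand $q/p^\gamma$ is read as $0$ where $q=0$ and as $+\infty$ where $p=0<q$. $\mathcal H_\beta(F,L)$: functions $f:\mathbb R^d\to\mathbb R$ with $\|f\|_\infty\le F$ and $|f(x)-f(y)|\le L\|x-y\|^\beta$ for all $x,y$. Model: the source pairs $(X_i,Y_i)$, $1\le i\le n$, are i.i.d. with $X_i\sim P$, $Y_i=f(X_i)+\varepsilon_i$; the target pairs $(X_j',Y_j')$, $1\le j\le m$, are i.i.d. with $X'_j\sim Q$, $Y'_j=f(X'_j)+\varepsilon'_j$; the two samples are independent of each other. All noise variables are identically distributed, centered, independent of the covariates, and satisfy $\mathbb E[\exp(\lambda_0|\varepsilon|)]\le\sigma_0$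 for some constants $\lambda_0,\sigma_0>0$. The same $f$ governs both samples (covariate shift). Nearest neighbours: for $x\in\mathbb R^d$, $X_1(x),\dots,X_n(x)$ is a reordering of $X_1,\dots,X_n$ with $\|x-X_1(x)\|\le\dots\le\|x-X_n(x)\|$, $Y_i(x)$ is the label of $X_i(x)$, and $R_i(x)=\|x-X_i(x)\|$; $X_j'(x),Y_j'(x)$ are defined likewise from the target sample. $\ell$-nearest-neighbour density estimator built from $X_1,\dots,X_n$: $\widehat p(x)=\dfrac{\ell}{nR_\ell(x)^d}$ (equal to $+\infty$ if $R_\ell(x)=0$); built from a sample of size $m$, replace $n$ by $m$ and use the distances to that sample. One-sample estimator with neighbour function $k$: $\widehat f(x)=\frac1{k(x)}\sum_{i=1}^nY_i(x)\mathbf 1(i\le k(x))$. Two-sample estimator with neighbour functions $k_P,k_Q$: $\widehat f(x)=\frac{1}{k_P(x)+k_Q(x)}\Big[\sum_{i=1}^nY_i(x)\mathbf 1(i\le k_P(x))+\sum_{j=1}^mY'_j(x)\mathbf 1(j\le k_Q(x))\Big]$. Risk: $\mathcal E_Q(\widehat f,f)=\int(\widehat f(x)-f(x))^2\,dQ(x)$, which is random through the samples. The constants $N,M,C_3,C_4$ may depend on $\tau$ and on all the fixed objects ($P$, $Q$, $d$, $\beta$, $F$, $L$, $\gamma$, $\rho$, $\lambda_0$, $\sigma_0$, $\kappa_P$, $\kappa_Q$, $c_0,c_1,c_2$, class parameters), but not on the sample sizes. *)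

theory Defs
  imports "HOL-Probability.Probability"
begin

text \<open>
  Distributions with a bounded density and with the minimal and maximal mass properties.
  The mass properties are pointwise in the density, so the predicates carry the version
  \<open>p\<close> of the density along with the measure \<open>P\<close>. The bound on \<open>p\<close> is the \<open>L\<^sup>\<infinity>\<close> bound.
\<close>

definition mass_class ::
  "real \<Rightarrow> real \<Rightarrow> real \<Rightarrow> real \<Rightarrow> real \<Rightarrow> (real ^ 'd) measure \<Rightarrow> (real ^ 'd \<Rightarrow> real) \<Rightarrow> bool" where
  "mass_class pmax a_min r_min a_max r_max P p \<longleftrightarrow>
     prob_space P \<and>
     p \<in> borel_measurable borel \<and> (\<forall>x. 0 \<le> p x) \<and>
     P = density lborel (\<lambda>x. ennreal (p x)) \<and>
     (AE x in lborel. p x \<le> pmax) \<and>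
     (\<forall>x r. 0 < r \<and> r \<le> r_min \<longrightarrow> a_min * p x * r ^ CARD('d) \<le> measure P (cball x r)) \<and>
     (\<forall>x r. 0 < p x \<and> 0 < r \<and> r \<le> r_max \<longrightarrow> measure P (cball x r) \<le> a_max * p x * r ^ CARD('d))"

definition density_ratio_integrand :: "real \<Rightarrow> real \<Rightarrow> real \<Rightarrow> ennreal" where
  "density_ratio_integrand \<gamma> p q =
     (if q = 0 then 0 else if p = 0 then \<infinity> else ennreal (q / p powr \<gamma>))"

definition target_class ::
  "real \<Rightarrow> real \<Rightarrow> real \<Rightarrow> real \<Rightarrow> real \<Rightarrow> (real ^ 'd \<Rightarrow> real) \<Rightarrow> real \<Rightarrow> real \<Rightarrow>
   (real ^ 'd) measure \<Rightarrow> (real ^ 'd \<Rightarrow> real) \<Rightarrow> bool" where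
  "target_class pmax a_min r_min a_max r_max p \<gamma> \<rho> Q q \<longleftrightarrow>
     mass_class pmax a_min r_min a_max r_max Q q \<and>
     (\<integral>\<^sup>+ x. density_ratio_integrand \<gamma> (p x) (q x) \<partial>lborel) < \<infinity> \<and>
     (\<integral>\<^sup>+ x. ennreal (q x powr (real CARD('d) / (\<rho> + real CARD('d)))) \<partial>lborel) < \<infinity>"

definition holder_class :: "real \<Rightarrow> real \<Rightarrow> real \<Rightarrow> ('a::real_normed_vector \<Rightarrow> real) set" where
  "holder_class \<beta> F L =
     {f. (\<forall>x. \<bar>f x\<bar> \<le> F) \<and> (\<forall>x y. \<bar>f x - f y\<bar> \<le> L * norm (x - y) powr \<beta>)}"

definition noise_law :: "real \<Rightarrow> real \<Rightarrow> real measure \<Rightarrow> bool" where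
  "noise_law lambda0 sigma0 \<nu> \<longleftrightarrow>
     prob_space \<nu> \<and> sets \<nu> = sets borel \<and>
     integrable \<nu> (\<lambda>e. e) \<and> (\<integral>e. e \<partial>\<nu>) = 0 \<and>
     (\<integral>\<^sup>+ e. ennreal (exp (lambda0 * \<bar>e\<bar>)) \<partial>\<nu>) \<le> ennreal sigma0"

text \<open>Independence of two random variables; the library's \<open>indep_var\<close> needs equal value types.\<close>

definition indep_rvs ::
  "'w measure \<Rightarrow> ('w \<Rightarrow> 'a::topological_space) \<Rightarrow> ('w \<Rightarrow> 'b::topological_space) \<Rightarrow> bool" where
  "indep_rvs M U V \<longleftrightarrow>
     U \<in> borel_measurable M \<and> V \<in> borel_measurable M \<and>
     prob_space.indep_set M {U -` A \<inter> space M |A. A \<in> sets borel} {V -` B \<inter> space M |B. B \<in> sets borel}"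

text \<open>
  Covariates \<open>X i\<close> and noise \<open>eps i\<close> for the source (\<open>1 \<le> i \<le> n\<close>), \<open>X' j\<close> and \<open>eps' j\<close> for the
  target (\<open>1 \<le> j \<le> m\<close>). Joint independence of all \<open>n + m\<close> pairs says that the pairs are
  independent within each sample and that the two samples are independent of each other.
  The labels are given by \<open>label\<close> below, with the same \<open>f\<close> for both samples.
\<close>

definition covariate_shift_model ::
  "(real ^ 'd) measure \<Rightarrow> (real ^ 'd) measure \<Rightarrow> real \<Rightarrow> real \<Rightarrow> 'w measure \<Rightarrow> nat \<Rightarrow> nat \<Rightarrow>
   (nat \<Rightarrow> 'w \<Rightarrow> real ^ 'd) \<Rightarrow> (nat \<Rightarrow> 'w \<Rightarrow> real) \<Rightarrow>
   (nat \<Rightarrow> 'w \<Rightarrow> real ^ 'd) \<Rightarrow> (nat \<Rightarrow> 'w \<Rightarrow> real) \<Rightarrow> bool" where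
  "covariate_shift_model P Q lambda0 sigma0 M n m X eps X' eps' \<longleftrightarrow>
     prob_space M \<and>
     prob_space.indep_vars M (\<lambda>_. borel)
       (case_sum (\<lambda>i \<omega>. (X i \<omega>, eps i \<omega>)) (\<lambda>j \<omega>. (X' j \<omega>, eps' j \<omega>))) ({1..n} <+> {1..m}) \<and>
     (\<forall>i\<in>{1..n}. distr M borel (X i) = P \<and> indep_rvs M (X i) (eps i)) \<and>
     (\<forall>j\<in>{1..m}. distr M borel (X' j) = Q \<and> indep_rvs M (X' j) (eps' j)) \<and>
     (\<exists>\<nu>. noise_law lambda0 sigma0 \<nu> \<and>
        (\<forall>i\<in>{1..n}. distr M borel (eps i) = \<nu>) \<and> (\<forall>j\<in>{1..m}. distr M borel (eps' j) = \<nu>))"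

definition label :: "('a \<Rightarrow> real) \<Rightarrow> (nat \<Rightarrow> 'a) \<Rightarrow> (nat \<Rightarrow> real) \<Rightarrow> nat \<Rightarrow> real" where
  "label f X eps i = f (X i) + eps i"

text \<open>
  \<open>S x\<close> lists the indices of a sample \<open>X 1, \<dots>, X n\<close> by increasing distance to \<open>x\<close>, that is,
  the \<open>i\<close>-th nearest neighbour of \<open>x\<close> is \<open>X (S x i)\<close>. Ties may be broken in any way.
\<close>

definition nn_ordering ::
  "nat \<Rightarrow> (nat \<Rightarrow> 'a::real_normed_vector) \<Rightarrow> ('a \<Rightarrow> nat \<Rightarrow> nat) \<Rightarrow> bool" where
  "nn_ordering n X S \<longleftrightarrow>
     (\<forall>x. bij_betw (S x) {1..n} {1..n} \<and>
        (\<forall>i\<in>{1..n}. \<forall>j\<in>{1..n}. i \<le> j \<longrightarrow> norm (x - X (S x i)) \<le> norm (x - X (S x j))))"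

definition nn_radius ::
  "(nat \<Rightarrow> 'a::real_normed_vector) \<Rightarrow> ('a \<Rightarrow> nat \<Rightarrow> nat) \<Rightarrow> nat \<Rightarrow> 'a \<Rightarrow> real" where
  "nn_radius X S i x = norm (x - X (S x i))"

definition nn_density ::
  "nat \<Rightarrow> nat \<Rightarrow> (nat \<Rightarrow> real ^ 'd) \<Rightarrow> (real ^ 'd \<Rightarrow> nat \<Rightarrow> nat) \<Rightarrow> real ^ 'd \<Rightarrow> ennreal" where
  "nn_density l n X S x =
     (if nn_radius X S l x = 0 then \<infinity>
      else ennreal (real l / (real n * nn_radius X S l x ^ CARD('d))))"

text \<open>
  The neighbour function at a point with density estimate \<open>t\<close>, for a sample of size \<open>n\<close> in
  dimension \<open>d\<close>; \<open>N\<close> is the number inside the first logarithm (\<open>n\<close> for one sample, \<open>n + m\<close>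
  for two). For \<open>t = \<infinity>\<close> the maximum is infinite and truncation at \<open>n\<close> gives \<open>n\<close>.
\<close>

definition local_k :: "nat \<Rightarrow> real \<Rightarrow> real \<Rightarrow> nat \<Rightarrow> nat \<Rightarrow> ennreal \<Rightarrow> nat" where
  "local_k d \<beta> \<kappa> N n t =
     (if t = \<infinity> then n
      else min n (nat (max
        \<lceil>\<kappa> * ln (real N) powr (real d / (2 * \<beta> + real d))
           * (real n * enn2real t) powr (2 * \<beta> / (2 * \<beta> + real d))\<rceil>
        \<lceil>ln (real n)\<rceil>)))"

definition one_sample_estimator ::
  "nat \<Rightarrow> (nat \<Rightarrow> real) \<Rightarrow> ('a \<Rightarrow> nat \<Rightarrow> nat) \<Rightarrow> ('a \<Rightarrow> nat) \<Rightarrow> 'a \<Rightarrow> real" where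
  "one_sample_estimator n Y S k x =
     1 / real (k x) * (\<Sum>i=1..n. Y (S x i) * of_bool (i \<le> k x))"

definition two_sample_estimator ::
  "nat \<Rightarrow> (nat \<Rightarrow> real) \<Rightarrow> ('a \<Rightarrow> nat \<Rightarrow> nat) \<Rightarrow> ('a \<Rightarrow> nat) \<Rightarrow>
   nat \<Rightarrow> (nat \<Rightarrow> real) \<Rightarrow> ('a \<Rightarrow> nat \<Rightarrow> nat) \<Rightarrow> ('a \<Rightarrow> nat) \<Rightarrow> 'a \<Rightarrow> real" where
  "two_sample_estimator n Y S kP m Y' S' kQ x =
     1 / (real (kP x) + real (kQ x)) *
       ((\<Sum>i=1..n. Y (S x i) * of_bool (i \<le> kP x)) + (\<Sum>j=1..m. Y' (S' x j) * of_bool (j \<le> kQ x)))"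

definition one_sample_local_nn ::
  "real \<Rightarrow> real \<Rightarrow> nat \<Rightarrow> nat \<Rightarrow> (nat \<Rightarrow> real ^ 'd) \<Rightarrow> (nat \<Rightarrow> real) \<Rightarrow>
   (real ^ 'd \<Rightarrow> nat \<Rightarrow> nat) \<Rightarrow> real ^ 'd \<Rightarrow> real" where
  "one_sample_local_nn \<beta> \<kappa> l n X Y S =
     one_sample_estimator n Y S (\<lambda>x. local_k CARD('d) \<beta> \<kappa> n n (nn_density l n X S x))"

definition two_sample_local_nn ::
  "real \<Rightarrow> real \<Rightarrow> real \<Rightarrow> nat \<Rightarrow>
   nat \<Rightarrow> (nat \<Rightarrow> real ^ 'd) \<Rightarrow> (nat \<Rightarrow> real) \<Rightarrow> (real ^ 'd \<Rightarrow> nat \<Rightarrow> nat) \<Rightarrow>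
   nat \<Rightarrow> (nat \<Rightarrow> real ^ 'd) \<Rightarrow> (nat \<Rightarrow> real) \<Rightarrow> (real ^ 'd \<Rightarrow> nat \<Rightarrow> nat) \<Rightarrow>
   real ^ 'd \<Rightarrow> real" where
  "two_sample_local_nn \<beta> \<kappa>P \<kappa>Q l n X Y S m X' Y' S' =
     two_sample_estimator
       n Y S (\<lambda>x. local_k CARD('d) \<beta> \<kappa>P (n + m) n (nn_density l n X S x))
       m Y' S' (\<lambda>x. local_k CARD('d) \<beta> \<kappa>Q (n + m) m (nn_density l m X' S' x))"

definition excess_risk :: "'a measure \<Rightarrow> ('a \<Rightarrow> real) \<Rightarrow> ('a \<Rightarrow> real) \<Rightarrow> ennreal" where
  "excess_risk Q g f = (\<integral>\<^sup>+ x. ennreal ((g x - f x)\<^sup>2) \<partial>Q)"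

text \<open>
  A property holding with probability at least \<open>a\<close>. Since arbitrary tie-breaking can spoil
  measurability on a null set, the property is required on a measurable event of that probability.
\<close>

definition with_prob_at_least :: "'w measure \<Rightarrow> real \<Rightarrow> ('w \<Rightarrow> bool) \<Rightarrow> bool" where
  "with_prob_at_least M a \<phi> \<longleftrightarrow> (\<exists>A\<in>sets M. a \<le> measure M A \<and> (\<forall>\<omega>\<in>A. \<phi> \<omega>))"

end

(*
  Fix x and let t = n p(x) / L with L = log n (or log (n + m)) and a = 2 beta / (2 beta + d). Chernoff
  bounds for the number of sample points in balls around x, together with the mass properties, show
  that, up to an event of probability n^(-c), the neighbour number k is of order L t^a when t is large
  and O(L) otherwise, and that k times the squared bias is O(L). Given the covariates, the noise sum is
  subexponential, so its square is O(L (k + L)). Hence the squared error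
  at x is O(L / k), that is O(min(1, t^(-a))).

  No uniformity in x is needed. All exceptional events at x are dominated by an envelope G(x, omega)
  with E G(x, .) = O(n^(-c)); by Fubini and Markov the integral of G with respect to Q is at most 1 / n
  with high probability. The integral of min(1, t^(-a)) with respect to Q is bounded by the density
  ratio exponent for the source sample and by the integrability of q^(d / (rho + d)) for the target
  sample.
*)
theory Submission
  imports Defs
begin

text \<open>Everything at \<open>x\<close> is computed from the same data: the neighbour number
  depends on the covariates that it selects, and the ordering \<open>S\<close> may break ties in a
  way that is not measurable. So no probability is computed for \<open>S\<close> or for the
  estimator. Ball counts and the rank-based sets \<open>nn_set\<close> replace the ordering, and the
  noise is controlled for every fixed number of neighbours in \<open>{1..n}\<close> at once, at the
  price of a factor n \<le> exp L; only then is the random \<open>k\<close> inserted.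

  The noise is unbounded, so a bad event cannot be dismissed by a trivial bound on the error.
  Wherever the envelope \<open>G\<close> is finite, the squared noise is bounded with an extra
  factor 1 + G, so that integrating \<open>G\<close> settles good and bad points together.

  The exponent a balances bias and noise: the L t^a nearest points lie within distance of order
  t^((a - 1) / d), where the squared Hoelder bias is of order t^(-a), the order of L / k. The
  deviation exponent is c = \<tau> + 1: Markov with threshold 1 / n loses one factor n, and another
  one absorbs the constant.\<close>

section \<open>Neighbour sets and neighbour distances expressed by counts\<close>

definition ball_count :: "nat \<Rightarrow> (nat \<Rightarrow> 'a::real_normed_vector) \<Rightarrow> 'a \<Rightarrow> real \<Rightarrow> nat" where
  "ball_count n u x r = card {i\<in>{1..n}. norm (x - u i) \<le> r}"

text \<open>The rank is the number of strictly closer points, so the set depends on the covariates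
  alone and is measurable in them, however ties are broken. Under ties its size may differ from
  \<open>k\<close>.\<close>

definition nn_set :: "nat \<Rightarrow> (nat \<Rightarrow> 'a::real_normed_vector) \<Rightarrow> 'a \<Rightarrow> nat \<Rightarrow> nat set" where
  "nn_set n u x k = {i\<in>{1..n}. card {j\<in>{1..n}. norm (x - u j) < norm (x - u i)} < k}"

definition tied :: "nat \<Rightarrow> (nat \<Rightarrow> 'a::real_normed_vector) \<Rightarrow> 'a \<Rightarrow> bool" where
  "tied n u x \<longleftrightarrow> (\<exists>i\<in>{1..n}. \<exists>j\<in>{1..n}. i \<noteq> j \<and> norm (x - u i) = norm (x - u j))"

lemma nn_orderingD:
  assumes "nn_ordering n u S"
  shows "bij_betw (S x) {1..n} {1..n}"
    and "\<lbrakk>i \<in> {1..n}; j \<in> {1..n}; i \<le> j\<rbrakk> \<Longrightarrow> norm (x - u (S x i)) \<le> norm (x - u (S x j))"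
  using assms unfolding nn_ordering_def by blast+

text \<open>Without ties \<open>S x\<close> lists the points by strictly increasing distance, so
  exactly the \<open>i - 1\<close> points listed earlier are closer than the \<open>i\<close>-th,
  and rank below \<open>k\<close> means \<open>i \<le> k\<close>. This is the bridge from the given
  ordering to a measurable index set.\<close>

lemma nn_set_eq_image:
  assumes S: "nn_ordering n u S" and nt: "\<not> tied n u x" and "k \<le> n"
  shows "nn_set n u x k = S x ` {1..k}"
proof -
  note bij = nn_orderingD(1)[OF S, of x] and mono = nn_orderingD(2)[OF S]
  have inj: "inj_on (S x) {1..n}" and im: "S x ` {1..n} = {1..n}"
    using bij by (auto simp: bij_betw_def)
  have strict: "norm (x - u (S x i)) < norm (x - u (S x j)) \<longleftrightarrow> i < j"
    if "i \<in> {1..n}" "j \<in> {1..n}" for i j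
  proof (cases i j rule: linorder_cases)
    case less
    have "S x i \<noteq> S x j" using inj that less by (auto dest: inj_onD)
    moreover have "S x i \<in> {1..n}" "S x j \<in> {1..n}" using im that by blast+
    ultimately have "norm (x - u (S x i)) \<noteq> norm (x - u (S x j))"
      using nt unfolding tied_def by blast
    with mono[of i j x] that less show ?thesis by auto
  next
    case greater
    with mono[of j i x] that show ?thesis by auto
  qed simp
  have rank: "card {j\<in>{1..n}. norm (x - u j) < norm (x - u (S x i))} = i - 1" if i: "i \<in> {1..n}" for i
  proof -
    have "{j\<in>{1..n}. norm (x - u j) < norm (x - u (S x i))} = S x ` {1..<i}"
    proof (intro set_eqI iffI)
      fix j assume j: "j \<in> {j\<in>{1..n}. norm (x - u j) < norm (x - u (S x i))}"
      then obtain j' where j': "j' \<in> {1..n}" "j = S x j'" using im by blast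
      with j strict[of j' i] i have "j' < i" by auto
      with j' show "j \<in> S x ` {1..<i}" by auto
    next
      fix j assume "j \<in> S x ` {1..<i}"
      then obtain j' where j': "j' \<in> {1..<i}" "j = S x j'" by blast
      then have "j' \<in> {1..n}" using i by auto
      with strict[of j' i] i j' im show "j \<in> {j\<in>{1..n}. norm (x - u j) < norm (x - u (S x i))}"
        by auto
    qed
    moreover have "inj_on (S x) {1..<i}" using inj by (rule inj_on_subset) (use i in auto)
    ultimately show ?thesis by (simp add: card_image)
  qed
  show ?thesis
  proof (intro set_eqI iffI)
    fix j assume j: "j \<in> nn_set n u x k"
    then have "j \<in> {1..n}" by (simp add: nn_set_def)
    then obtain i where i: "i \<in> {1..n}" "j = S x i" using im by blast
    with j rank[OF i(1)] have "i \<le> k" by (auto simp: nn_set_def)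
    with i show "j \<in> S x ` {1..k}" by auto
  next
    fix j assume "j \<in> S x ` {1..k}"
    then obtain i where i: "i \<in> {1..k}" "j = S x i" by blast
    then have "i \<in> {1..n}" using \<open>k \<le> n\<close> by auto
    with i rank[of i] im show "j \<in> nn_set n u x k" by (auto simp: nn_set_def)
  qed
qed

lemma sum_nn_set:
  assumes S: "nn_ordering n u S" and "\<not> tied n u x" and "k \<le> n"
  shows "(\<Sum>i\<in>nn_set n u x k. g i) = (\<Sum>i=1..k. g (S x i))"
    and "card (nn_set n u x k) = k"
proof -
  have "inj_on (S x) {1..k}"
    using nn_orderingD(1)[OF S, of x] \<open>k \<le> n\<close> by (auto simp: bij_betw_def intro: inj_on_subset)
  with nn_set_eq_image[OF assms] show "(\<Sum>i\<in>nn_set n u x k. g i) = (\<Sum>i=1..k. g (S x i))"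
    and "card (nn_set n u x k) = k"
    by (simp_all add: sum.reindex card_image)
qed

text \<open>A radius at most \<open>r\<close> would put the first \<open>l\<close> neighbours into
  the closed ball. With the converse \<open>nn_radius_le\<close>, events about the random radius
  become events about ball counts, also in the presence of ties, and only counts have to be
  estimated.\<close>

lemma nn_radius_gt:
  assumes S: "nn_ordering n u S" and l: "l \<in> {1..n}" and "ball_count n u x r < l"
  shows "r < nn_radius u S l x"
proof (rule ccontr)
  assume "\<not> ?thesis"
  then have le: "norm (x - u (S x l)) \<le> r" by (simp add: nn_radius_def)
  note bij = nn_orderingD(1)[OF S, of x]
  have "S x ` {1..l} \<subseteq> {i\<in>{1..n}. norm (x - u i) \<le> r}"
  proof
    fix j assume "j \<in> S x ` {1..l}"
    then obtain i where i: "i \<in> {1..l}" "j = S x i" by blast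
    then have "i \<in> {1..n}" using l by auto
    have "norm (x - u (S x i)) \<le> r"
      using nn_orderingD(2)[OF S \<open>i \<in> {1..n}\<close> l, of x] i(1) le by simp
    moreover have "S x i \<in> {1..n}" using bij \<open>i \<in> {1..n}\<close> by (rule bij_betwE[THEN bspec])
    ultimately show "j \<in> {i\<in>{1..n}. norm (x - u i) \<le> r}" using i(2) by simp
  qed
  then have "card (S x ` {1..l}) \<le> ball_count n u x r"
    unfolding ball_count_def by (intro card_mono) auto
  moreover have "inj_on (S x) {1..l}"
    using bij l by (auto simp: bij_betw_def intro: inj_on_subset)
  ultimately show False using assms(3) by (simp add: card_image)
qed

lemma nn_radius_le:
  assumes S: "nn_ordering n u S" and l: "l \<in> {1..n}" and "l \<le> ball_count n u x r"
  shows "nn_radius u S l x \<le> r"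
proof (rule ccontr)
  assume "\<not> ?thesis"
  then have gt: "r < norm (x - u (S x l))" by (simp add: nn_radius_def)
  note bij = nn_orderingD(1)[OF S, of x]
  have "{i\<in>{1..n}. norm (x - u i) \<le> r} \<subseteq> S x ` {1..<l}"
  proof
    fix j assume j: "j \<in> {i\<in>{1..n}. norm (x - u i) \<le> r}"
    then obtain i where i: "i \<in> {1..n}" "j = S x i"
      using bij unfolding bij_betw_def by blast
    have "\<not> l \<le> i"
    proof
      assume "l \<le> i"
      from nn_orderingD(2)[OF S l i(1) this, of x] gt j i(2) show False by simp
    qed
    with i show "j \<in> S x ` {1..<l}" by auto
  qed
  then have "ball_count n u x r \<le> card (S x ` {1..<l})"
    unfolding ball_count_def by (intro card_mono) auto
  also have "\<dots> \<le> card {1..<l}" by (rule card_image_le) simp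
  finally have "ball_count n u x r \<le> l - 1" by simp
  with assms(3) l show False unfolding atLeastAtMost_iff by linarith
qed

section \<open>Exponential moments of centred noise\<close>

text \<open>Second-order Taylor expansion with Lagrange remainder. Put w = a |y| / 2, so that |lam
  y| \<le> w: one factor \<open>exp w\<close> bounds the exponential in the remainder, another
  bounds w^2 / 2, and together they give exactly \<open>exp (a * \<bar>y\<bar>)\<close>. This is why
  \<open>lam\<close> is limited to half of \<open>a\<close>.\<close>

lemma exp_le_quadratic:
  fixes a y lam :: real
  assumes "0 < a" and "\<bar>lam\<bar> \<le> a / 2"
  shows "exp (lam * y) \<le> 1 + lam * y + 4 * lam\<^sup>2 / a\<^sup>2 * exp (a * \<bar>y\<bar>)"
proof -
  define z where "z = lam * y"
  define w where "w = a * \<bar>y\<bar> / 2"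
  have zw: "\<bar>z\<bar> \<le> w"
    using assms mult_right_mono[OF assms(2), of "\<bar>y\<bar>"] by (simp add: z_def w_def abs_mult)
  obtain t where t: "\<bar>t\<bar> \<le> \<bar>z\<bar>" and ez: "exp z = (\<Sum>m<2. z ^ m / fact m) + exp t / fact 2 * z\<^sup>2"
    using Maclaurin_exp_le[of z 2] by blast
  have "0 \<le> w" using zw by linarith
  then have w2: "w\<^sup>2 / 2 \<le> exp w"
    using exp_lower_Taylor_quadratic[of w] by linarith
  have z2: "z\<^sup>2 = 4 * lam\<^sup>2 / a\<^sup>2 * w\<^sup>2"
    using assms(1) by (simp add: z_def w_def power_mult_distrib power_divide)
  have "exp t \<le> exp w" using t zw by simp
  then have "exp t / 2 * z\<^sup>2 \<le> exp w / 2 * z\<^sup>2"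
    by (intro mult_right_mono) auto
  also have "exp w / 2 * z\<^sup>2 = 4 * lam\<^sup>2 / a\<^sup>2 * (exp w * (w\<^sup>2 / 2))" by (simp add: z2)
  also have "\<dots> \<le> 4 * lam\<^sup>2 / a\<^sup>2 * (exp w * exp w)"
    using w2 by (intro mult_left_mono) auto
  also have "exp w * exp w = exp (a * \<bar>y\<bar>)"
    by (simp add: w_def flip: exp_add)
  finally show ?thesis
    unfolding z_def[symmetric] using ez by (simp add: numeral_2_eq_2 del: times_divide_eq_right times_divide_eq_left)
qed

text \<open>The linear term integrates to zero because the noise is centred, and the quadratic
  remainder has finite mean by the moment assumption; then 1 + u \<le> exp u. So the noise is
  sub-Gaussian for small parameters.\<close>

lemma noise_law_mgf:
  assumes "noise_law a s \<nu>" and a: "0 < a" and lam: "\<bar>lam\<bar> \<le> a / 2"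
  shows "(\<integral>\<^sup>+ e. ennreal (exp (lam * e)) \<partial>\<nu>) \<le> ennreal (exp (4 * s * lam\<^sup>2 / a\<^sup>2))"
proof -
  interpret prob_space \<nu> using assms(1) by (simp add: noise_law_def)
  have [measurable_cong]: "sets \<nu> = sets borel" and int: "integrable \<nu> (\<lambda>e. e)" and mean: "(\<integral>e. e \<partial>\<nu>) = 0"
    and mom: "(\<integral>\<^sup>+ e. ennreal (exp (a * \<bar>e\<bar>)) \<partial>\<nu>) \<le> ennreal s"
    using assms(1) by (auto simp: noise_law_def)
  have inte: "integrable \<nu> (\<lambda>e. exp (a * \<bar>e\<bar>))"
    using mom by (intro integrableI_nonneg) (auto intro: le_less_trans simp: less_top)
  have s: "(\<integral>e. exp (a * \<bar>e\<bar>) \<partial>\<nu>) \<le> s"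
  proof -
    \<comment> \<open>\<open>ennreal\<close> sends a negative \<open>s\<close> to 0, so the moment
      bound transfers to the reals only for nonnegative \<open>s\<close>; this holds since the
      integrand is at least 1.\<close>
    have pos: "0 \<le> s"
    proof (rule ccontr)
      assume "\<not> 0 \<le> s"
      with mom have "(\<integral>\<^sup>+ e. ennreal (exp (a * \<bar>e\<bar>)) \<partial>\<nu>) = 0" by (simp add: ennreal_neg)
      moreover have "(\<integral>\<^sup>+ e. 1 \<partial>\<nu>) \<le> (\<integral>\<^sup>+ e. ennreal (exp (a * \<bar>e\<bar>)) \<partial>\<nu>)"
        using a by (intro nn_integral_mono) (simp flip: ennreal_1)
      ultimately show False by (simp add: emeasure_space_1)
    qed
    show ?thesis
      using mom nn_integral_eq_integral[OF inte] pos by simp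
  qed
  have "(\<integral>\<^sup>+ e. ennreal (exp (lam * e)) \<partial>\<nu>)
      \<le> (\<integral>\<^sup>+ e. ennreal (1 + lam * e + 4 * lam\<^sup>2 / a\<^sup>2 * exp (a * \<bar>e\<bar>)) \<partial>\<nu>)"
    by (intro nn_integral_mono ennreal_leI exp_le_quadratic[OF a lam])
  also have "\<dots> = ennreal (\<integral>e. 1 + lam * e + 4 * lam\<^sup>2 / a\<^sup>2 * exp (a * \<bar>e\<bar>) \<partial>\<nu>)"
  proof (rule nn_integral_eq_integral)
    show "integrable \<nu> (\<lambda>e. 1 + lam * e + 4 * lam\<^sup>2 / a\<^sup>2 * exp (a * \<bar>e\<bar>))"
      using int inte by simp
    show "AE e in \<nu>. 0 \<le> 1 + lam * e + 4 * lam\<^sup>2 / a\<^sup>2 * exp (a * \<bar>e\<bar>)"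
      using exp_le_quadratic[OF a lam] by (intro AE_I2) (meson exp_ge_zero order_trans)
  qed
  also have "(\<integral>e. 1 + lam * e + 4 * lam\<^sup>2 / a\<^sup>2 * exp (a * \<bar>e\<bar>) \<partial>\<nu>)
      = 1 + 4 * lam\<^sup>2 / a\<^sup>2 * (\<integral>e. exp (a * \<bar>e\<bar>) \<partial>\<nu>)"
    using int inte mean by (simp add: prob_space)
  also have "\<dots> \<le> 1 + 4 * lam\<^sup>2 / a\<^sup>2 * s"
    using s by (intro add_left_mono mult_left_mono) auto
  also have "\<dots> \<le> exp (4 * s * lam\<^sup>2 / a\<^sup>2)"
    using exp_ge_add_one_self[of "4 * lam\<^sup>2 / a\<^sup>2 * s"] by (simp add: mult_ac)
  finally show ?thesis by (auto simp: ennreal_leI)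
qed

section \<open>Independence of variables of different types\<close>

lemma Int_stable_vimage: "Int_stable {f -` A \<inter> \<Omega> |A. A \<in> sets N}"
proof (rule Int_stableI)
  fix a b assume "a \<in> {f -` A \<inter> \<Omega> |A. A \<in> sets N}" "b \<in> {f -` A \<inter> \<Omega> |A. A \<in> sets N}"
  then obtain A B where "a = f -` A \<inter> \<Omega>" "b = f -` B \<inter> \<Omega>" "A \<in> sets N" "B \<in> sets N"
    by blast
  then have "a \<inter> b = f -` (A \<inter> B) \<inter> \<Omega>" "A \<inter> B \<in> sets N" by auto
  then show "a \<inter> b \<in> {f -` A \<inter> \<Omega> |A. A \<in> sets N}" by blast
qed

text \<open>Composition with \<open>h\<close> and \<open>g\<close> brings both variables to the type
  \<open>ennreal\<close>, where the product rule for independent variables applies. Independence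
  survives because every preimage under \<open>h\<close> after \<open>U\<close> is a preimage under
  \<open>U\<close>.\<close>

lemma (in prob_space) indep_rvs_nn_integral:
  fixes h :: "_ \<Rightarrow> ennreal" and g :: "_ \<Rightarrow> ennreal"
  assumes "indep_rvs M U V" and [measurable]: "h \<in> borel_measurable borel" "g \<in> borel_measurable borel"
  shows "(\<integral>\<^sup>+ \<omega>. h (U \<omega>) * g (V \<omega>) \<partial>M) = (\<integral>\<^sup>+ \<omega>. h (U \<omega>) \<partial>M) * (\<integral>\<^sup>+ \<omega>. g (V \<omega>) \<partial>M)"
proof -
  have [measurable]: "U \<in> borel_measurable M" "V \<in> borel_measurable M"
    and ind: "indep_set {U -` A \<inter> space M |A. A \<in> sets borel} {V -` B \<inter> space M |B. B \<in> sets borel}"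
    using assms(1) by (auto simp: indep_rvs_def)
  have "indep_var borel (\<lambda>\<omega>. h (U \<omega>)) borel (\<lambda>\<omega>. g (V \<omega>))"
    unfolding indep_var_eq
  proof (intro conjI indep_set_sigma_sets)
    show "Int_stable {(\<lambda>\<omega>. h (U \<omega>)) -` A \<inter> space M |A. A \<in> sets borel}"
      by (rule Int_stable_vimage)
    show "Int_stable {(\<lambda>\<omega>. g (V \<omega>)) -` A \<inter> space M |A. A \<in> sets borel}"
      by (rule Int_stable_vimage)
    have 1: "{(\<lambda>\<omega>. h (U \<omega>)) -` A \<inter> space M |A. A \<in> sets borel} \<subseteq> {U -` A \<inter> space M |A. A \<in> sets borel}"
    proof safe
      fix A :: "ennreal set" assume [measurable]: "A \<in> sets borel"
      have "h -` A \<inter> space borel \<in> sets borel" by measurable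
      then show "\<exists>B. (\<lambda>\<omega>. h (U \<omega>)) -` A \<inter> space M = U -` B \<inter> space M \<and> B \<in> sets borel"
        by (intro exI[of _ "h -` A"]) auto
    qed
    have 2: "{(\<lambda>\<omega>. g (V \<omega>)) -` A \<inter> space M |A. A \<in> sets borel} \<subseteq> {V -` A \<inter> space M |A. A \<in> sets borel}"
    proof safe
      fix A :: "ennreal set" assume [measurable]: "A \<in> sets borel"
      have "g -` A \<inter> space borel \<in> sets borel" by measurable
      then show "\<exists>B. (\<lambda>\<omega>. g (V \<omega>)) -` A \<inter> space M = V -` B \<inter> space M \<and> B \<in> sets borel"
        by (intro exI[of _ "g -` A"]) auto
    qed
    show "indep_set {(\<lambda>\<omega>. h (U \<omega>)) -` A \<inter> space M |A. A \<in> sets borel}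
       {(\<lambda>\<omega>. g (V \<omega>)) -` A \<inter> space M |A. A \<in> sets borel}"
      using ind unfolding indep_set_def
      by (rule indep_sets_mono_sets) (use 1 2 in \<open>auto split: bool.split\<close>)
  qed measurable
  then have "indep_vars (\<lambda>_. borel) (case_bool (\<lambda>\<omega>. h (U \<omega>)) (\<lambda>\<omega>. g (V \<omega>))) UNIV"
    unfolding indep_var_def by (rule indep_vars_cong[THEN iffD1, rotated -1]) (auto split: bool.split)
  from indep_vars_nn_integral[OF _ this] show ?thesis
    by (simp add: UNIV_bool mult.commute)
qed

section \<open>One noisy sample: product structure, counts and ties\<close>

text \<open>The source and the target sample are both instances, so every estimate for a single
  sample is proved once.\<close>

locale noisy_sample = prob_space M for M :: "'w measure" +
  fixes n :: nat and X :: "nat \<Rightarrow> 'w \<Rightarrow> real ^ 'd" and eps :: "nat \<Rightarrow> 'w \<Rightarrow> real"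
    and P :: "(real ^ 'd) measure" and lambda0 sigma0 :: real and \<nu> :: "real measure"
  assumes indep: "indep_vars (\<lambda>_. borel) (\<lambda>i \<omega>. (X i \<omega>, eps i \<omega>)) {1..n}"
    and distr_X: "i \<in> {1..n} \<Longrightarrow> distr M borel (X i) = P"
    and indep_X_eps: "i \<in> {1..n} \<Longrightarrow> indep_rvs M (X i) (eps i)"
    and distr_eps: "i \<in> {1..n} \<Longrightarrow> distr M borel (eps i) = \<nu>"
    and noise: "noise_law lambda0 sigma0 \<nu>"
    and lambda0: "0 < lambda0" and sigma0: "0 < sigma0"
begin

lemma X_meas: "i \<in> {1..n} \<Longrightarrow> X i \<in> borel_measurable M"
  using indep_X_eps by (auto simp: indep_rvs_def)

lemma eps_meas: "i \<in> {1..n} \<Longrightarrow> eps i \<in> borel_measurable M"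
  using indep_X_eps by (auto simp: indep_rvs_def)

lemma nn_integral_X:
  "\<lbrakk>i \<in> {1..n}; h \<in> borel_measurable borel\<rbrakk> \<Longrightarrow> (\<integral>\<^sup>+ \<omega>. h (X i \<omega>) \<partial>M) = (\<integral>\<^sup>+ x. h x \<partial>P)"
  by (subst distr_X[symmetric], assumption, subst nn_integral_distr) (auto simp: X_meas)

lemma nn_integral_eps:
  "\<lbrakk>i \<in> {1..n}; h \<in> borel_measurable borel\<rbrakk> \<Longrightarrow> (\<integral>\<^sup>+ \<omega>. h (eps i \<omega>) \<partial>M) = (\<integral>\<^sup>+ x. h x \<partial>\<nu>)"
  by (subst distr_eps[symmetric], assumption, subst nn_integral_distr) (auto simp: eps_meas)

text \<open>Independence enters twice: the pairs are independent of each other, and inside each pair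
  the covariate is independent of the noise.\<close>

lemma nn_integral_prod:
  fixes h :: "nat \<Rightarrow> real ^ 'd \<Rightarrow> ennreal" and g :: "nat \<Rightarrow> real \<Rightarrow> ennreal"
  assumes [measurable]: "\<And>i. h i \<in> borel_measurable borel" "\<And>i. g i \<in> borel_measurable borel"
  shows "(\<integral>\<^sup>+ \<omega>. (\<Prod>i=1..n. h i (X i \<omega>) * g i (eps i \<omega>)) \<partial>M)
       = (\<Prod>i=1..n. (\<integral>\<^sup>+ \<omega>. h i (X i \<omega>) \<partial>M) * (\<integral>\<^sup>+ x. g i x \<partial>\<nu>))"
proof -
  have [measurable]: "(\<lambda>z. h i (fst z) * g i (snd z)) \<in> borel_measurable borel" for i
    unfolding borel_prod[symmetric] by measurable
  have "(\<integral>\<^sup>+ \<omega>. (\<Prod>i=1..n. h i (X i \<omega>) * g i (eps i \<omega>)) \<partial>M)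
      = (\<Prod>i=1..n. \<integral>\<^sup>+ \<omega>. h i (X i \<omega>) * g i (eps i \<omega>) \<partial>M)"
    using indep_vars_compose2[OF indep, of "\<lambda>i z. h i (fst z) * g i (snd z)" "\<lambda>_. borel"]
    by (intro indep_vars_nn_integral) auto
  also have "\<dots> = (\<Prod>i=1..n. (\<integral>\<^sup>+ \<omega>. h i (X i \<omega>) \<partial>M) * (\<integral>\<^sup>+ x. g i x \<partial>\<nu>))"
    by (intro prod.cong refl) (simp add: indep_rvs_nn_integral[OF indep_X_eps] nn_integral_eps)
  finally show ?thesis .
qed

definition Xvec :: "'w \<Rightarrow> nat \<Rightarrow> real ^ 'd" where
  "Xvec \<omega> = (\<lambda>i\<in>{1..n}. X i \<omega>)"

lemma Xvec_meas [measurable]: "Xvec \<in> M \<rightarrow>\<^sub>M PiM {1..n} (\<lambda>_. borel)"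
  unfolding Xvec_def by (intro measurable_restrict X_meas)

text \<open>Independence of the covariate vector and the noise vector, in the form needed to
  condition on the covariates. As functions of \<open>B\<close> both sides are measures on the
  product space; they agree on boxes by \<open>nn_integral_prod\<close>, and boxes determine a
  finite measure.\<close>

lemma nn_integral_Xvec_eps:
  fixes g :: "nat \<Rightarrow> real \<Rightarrow> ennreal"
  assumes g: "\<And>i. g i \<in> borel_measurable borel" and B: "B \<in> sets (PiM {1..n} (\<lambda>_. borel))"
    and fin: "(\<Prod>i=1..n. \<integral>\<^sup>+ x. g i x \<partial>\<nu>) < \<infinity>"
  shows "(\<integral>\<^sup>+ \<omega>. indicator B (Xvec \<omega>) * (\<Prod>i=1..n. g i (eps i \<omega>)) \<partial>M)
       = (\<Prod>i=1..n. \<integral>\<^sup>+ x. g i x \<partial>\<nu>) * emeasure M (Xvec -` B \<inter> space M)"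
proof -
  note g[measurable] B[measurable]
  define c where "c = (\<Prod>i=1..n. \<integral>\<^sup>+ x. g i x \<partial>\<nu>)"
  define N :: "(nat \<Rightarrow> real ^ 'd) measure" where "N = PiM {1..n} (\<lambda>_. borel)"
  define W where "W \<omega> = (\<Prod>i=1..n. g i (eps i \<omega>))" for \<omega>
  have W[measurable]: "W \<in> borel_measurable M"
    unfolding W_def by (intro borel_measurable_prod_ennreal measurable_compose[OF eps_meas g]) auto
  have XN[measurable]: "Xvec \<in> M \<rightarrow>\<^sub>M N" unfolding N_def by (rule Xvec_meas)
  \<comment> \<open>\<open>M1\<close> is the law of the covariates weighted by the noise product,
    \<open>M2\<close> the plain law scaled by the mean \<open>c\<close> of that product.\<close>
  define M1 where "M1 = distr (density M W) N Xvec"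
  define M2 where "M2 = scale_measure c (distr M N Xvec)"
  have e1: "emeasure M1 E = (\<integral>\<^sup>+ \<omega>. indicator E (Xvec \<omega>) * W \<omega> \<partial>M)" if [measurable]: "E \<in> sets N" for E
    unfolding M1_def
    by (subst emeasure_distr, simp, simp, subst emeasure_density, simp, measurable)
       (auto intro!: nn_integral_cong simp: indicator_def)
  have e2: "emeasure M2 E = c * emeasure M (Xvec -` E \<inter> space M)" if "E \<in> sets N" for E
    unfolding M2_def using that by (simp add: emeasure_distr)
  have box: "emeasure M1 (Pi\<^sub>E {1..n} A) = emeasure M2 (Pi\<^sub>E {1..n} A)"
    if A: "\<And>i. i \<in> {1..n} \<Longrightarrow> A i \<in> sets borel" for A
  proof -
    have AN: "Pi\<^sub>E {1..n} A \<in> sets N"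
      unfolding N_def by (intro sets_PiM_I_finite) (auto simp: A)
    \<comment> \<open>\<open>A\<close> is unconstrained outside \<open>{1..n}\<close>; the value 0
      there makes every \<open>h i\<close> measurable without changing the product.\<close>
    define h where "h i = (if i \<in> {1..n} then indicator (A i) else (\<lambda>_. 0::ennreal))" for i
    have h[measurable]: "h i \<in> borel_measurable borel" for i
      using A[of i] by (auto simp: h_def)
    have ind: "indicator (Pi\<^sub>E {1..n} A) (Xvec \<omega>) = (\<Prod>i=1..n. h i (X i \<omega>))" for \<omega>
    proof (cases "\<forall>i\<in>{1..n}. X i \<omega> \<in> A i")
      case True
      then have "(\<Prod>i=1..n. h i (X i \<omega>)) = 1" by (intro prod.neutral) (auto simp: h_def)
      with True show ?thesis by (auto simp: Xvec_def indicator_def PiE_def)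
    next
      case False
      then obtain i where i: "i \<in> {1..n}" "X i \<omega> \<notin> A i" by blast
      then have "(\<Prod>i=1..n. h i (X i \<omega>)) = 0"
        by (intro prod_zero bexI[of _ i]) (auto simp: h_def)
      moreover have "Xvec \<omega> \<notin> Pi\<^sub>E {1..n} A"
      proof
        assume "Xvec \<omega> \<in> Pi\<^sub>E {1..n} A"
        then have "Xvec \<omega> i \<in> A i" using i(1) by (rule PiE_mem)
        then show False using i by (simp add: Xvec_def)
      qed
      ultimately show ?thesis by simp
    qed
    have "emeasure M1 (Pi\<^sub>E {1..n} A) = (\<integral>\<^sup>+ \<omega>. (\<Prod>i=1..n. h i (X i \<omega>) * g i (eps i \<omega>)) \<partial>M)"
      unfolding e1[OF AN] ind W_def prod.distrib ..
    also have "\<dots> = c * (\<Prod>i=1..n. \<integral>\<^sup>+ \<omega>. h i (X i \<omega>) \<partial>M)"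
      by (subst nn_integral_prod[OF h g]) (simp add: prod.distrib c_def mult.commute)
    also have "(\<Prod>i=1..n. \<integral>\<^sup>+ \<omega>. h i (X i \<omega>) \<partial>M) = emeasure M (Xvec -` Pi\<^sub>E {1..n} A \<inter> space M)"
    proof -
      have "(\<Prod>i=1..n. \<integral>\<^sup>+ \<omega>. h i (X i \<omega>) \<partial>M) = (\<integral>\<^sup>+ \<omega>. (\<Prod>i=1..n. h i (X i \<omega>) * 1) \<partial>M)"
        using noise by (subst nn_integral_prod[OF h, of "\<lambda>_ _. 1"])
          (auto simp: noise_law_def prob_space.emeasure_space_1)
      also have "\<dots> = (\<integral>\<^sup>+ \<omega>. indicator (Pi\<^sub>E {1..n} A) (Xvec \<omega>) \<partial>M)"
        unfolding ind by simp
      also have "\<dots> = (\<integral>\<^sup>+ \<omega>. indicator (Xvec -` Pi\<^sub>E {1..n} A \<inter> space M) \<omega> \<partial>M)"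
        by (auto intro!: nn_integral_cong simp: indicator_def)
      also have "\<dots> = emeasure M (Xvec -` Pi\<^sub>E {1..n} A \<inter> space M)"
        using AN by (intro nn_integral_indicator) measurable
      finally show ?thesis .
    qed
    finally show ?thesis unfolding e2[OF AN] .
  qed
  have "M1 = M2"
  proof (rule measure_eqI_PiM_finite[where I="{1..n}" and M="\<lambda>_. borel" and A="\<lambda>_. Pi\<^sub>E {1..n} (\<lambda>_. UNIV)"])
    show "sets M1 = sets (PiM {1..n} (\<lambda>_. borel))" "sets M2 = sets (PiM {1..n} (\<lambda>_. borel))"
      by (simp_all add: M1_def M2_def N_def)
    show "range (\<lambda>_. Pi\<^sub>E {1..n} (\<lambda>_. UNIV)) \<subseteq> prod_algebra {1..n} (\<lambda>_. borel)"
      by (auto intro!: prod_algebraI_finite)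
    show "(\<Union>i::nat. Pi\<^sub>E {1..n} (\<lambda>_. UNIV)) = space (PiM {1..n} (\<lambda>_. borel))"
      by (auto simp: space_PiM)
    have "Pi\<^sub>E {1..n} (\<lambda>_. UNIV) \<in> sets N"
      unfolding N_def by (intro sets_PiM_I_finite) auto
    from e2[OF this] box[of "\<lambda>_. UNIV"]
    have "emeasure M1 (Pi\<^sub>E {1..n} (\<lambda>_. UNIV)) = c * emeasure M (Xvec -` Pi\<^sub>E {1..n} (\<lambda>_. UNIV) \<inter> space M)"
      by simp
    also have "\<dots> \<le> c * 1" by (intro mult_left_mono emeasure_le_1) simp
    finally have "emeasure M1 (Pi\<^sub>E {1..n} (\<lambda>_. UNIV)) \<le> c" by simp
    then show "emeasure M1 (Pi\<^sub>E {1..n} (\<lambda>_. UNIV)) \<noteq> \<infinity>"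
      using fin by (auto simp: c_def less_top top_unique)
  qed (use box in auto)
  with e1[of B] e2[of B] B show ?thesis by (simp add: N_def W_def c_def)
qed

text \<open>The exponential of the count is a product of independent factors, each equal to 1 plus
  exp s - 1 times the indicator of the ball; the mean of a factor is estimated by 1 + u \<le> exp u.
  Both signs of \<open>s\<close> are allowed: positive ones serve the upper tail, negative ones the
  lower tail.\<close>

lemma count_mgf:
  assumes P: "prob_space P"
  shows "(\<integral>\<^sup>+ \<omega>. ennreal (exp (s * real (ball_count n (\<lambda>i. X i \<omega>) x r))) \<partial>M)
       \<le> ennreal (exp (real n * measure P (cball x r) * (exp s - 1)))"
proof (cases "n = 0")
  case True
  then show ?thesis by (simp add: ball_count_def emeasure_space_1)
next
  case False
  \<comment> \<open>The Borel structure of \<open>P\<close> is read off the law of the first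
    covariate, so the empty sample is treated separately above.\<close>
  have sP: "sets P = sets borel" using distr_X[of 1, symmetric] False by simp
  interpret P: prob_space P by fact
  define \<mu> where "\<mu> = measure P (cball x r)"
  define h where "h y = 1 + (exp s - 1) * indicator (cball x r) y" for y
  have hpos: "0 \<le> h y" for y by (simp add: h_def indicator_def)
  have [measurable]: "h \<in> borel_measurable borel" unfolding h_def by (intro measurable_const borel_measurable_add borel_measurable_times borel_measurable_indicator) auto
  have prod: "exp (s * real (ball_count n (\<lambda>i. X i \<omega>) x r)) = (\<Prod>i=1..n. h (X i \<omega>))" for \<omega>
  proof -
    have "(\<Prod>i=1..n. h (X i \<omega>)) = (\<Prod>i=1..n. if norm (x - X i \<omega>) \<le> r then exp s else 1)"
      by (intro prod.cong) (auto simp: h_def indicator_def dist_norm)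
    also have "\<dots> = exp s ^ ball_count n (\<lambda>i. X i \<omega>) x r"
      by (simp add: prod.If_cases ball_count_def Int_def)
    finally show ?thesis by (metis exp_of_nat_mult mult.commute)
  qed
  have intP: "(\<integral>\<^sup>+ y. ennreal (h y) \<partial>P) = ennreal (1 + (exp s - 1) * \<mu>)"
  proof (subst nn_integral_eq_integral)
    have cb: "cball x r \<in> sets P" by (simp add: sP)
    have ii: "integrable P (\<lambda>y. (exp s - 1) * indicator (cball x r) y)"
      using cb by (intro integrable_mult_right integrable_real_indicator) (auto simp: less_top[symmetric])
    then show "integrable P h" unfolding h_def by simp
    show "AE y in P. 0 \<le> h y" using hpos by simp
    show "ennreal (\<integral>y. h y \<partial>P) = ennreal (1 + (exp s - 1) * \<mu>)"
      unfolding h_def \<mu>_def using cb ii by (simp add: P.prob_space)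
  qed
  have "(\<integral>\<^sup>+ \<omega>. ennreal (exp (s * real (ball_count n (\<lambda>i. X i \<omega>) x r))) \<partial>M)
     = (\<integral>\<^sup>+ \<omega>. (\<Prod>i=1..n. ennreal (h (X i \<omega>)) * 1) \<partial>M)"
    by (simp add: prod prod_ennreal hpos)
  also have "\<dots> = (\<Prod>i=1..n. ennreal (1 + (exp s - 1) * \<mu>))"
    using noise by (subst nn_integral_prod[of "\<lambda>_ y. ennreal (h y)" "\<lambda>_ _. 1"])
      (auto intro!: prod.cong simp: noise_law_def prob_space.emeasure_space_1
         nn_integral_X[where h="\<lambda>y. ennreal (h y)"] intP)
  also have "\<dots> \<le> (\<Prod>i=1..n. ennreal (exp ((exp s - 1) * \<mu>)))"
    by (intro prod_mono_ennreal ennreal_leI) (auto intro: exp_ge_add_one_self)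
  also have "\<dots> = ennreal (exp (real n * \<mu> * (exp s - 1)))"
    by (simp add: ennreal_power exp_of_nat_mult[symmetric] mult_ac)
  finally show ?thesis by (simp add: \<mu>_def)
qed

text \<open>Two distinct covariates have joint law \<open>P \<Otimes>\<^sub>M P\<close>. Given the
  first, a tie places the second on a sphere around \<open>x\<close>, a Lebesgue null set, and
  \<open>P\<close> has a density. There are finitely many pairs.\<close>

lemma AE_not_tied:
  assumes P: "P = density lborel p" and p: "p \<in> borel_measurable borel"
  shows "AE \<omega> in M. \<not> tied n (\<lambda>i. X i \<omega>) x"
proof -
  have "AE \<omega> in M. norm (x - X i \<omega>) \<noteq> norm (x - X j \<omega>)" if ij: "i \<in> {1..n}" "j \<in> {1..n}" "i \<noteq> j" for i j
  proof -
    note [measurable] = X_meas[OF ij(1)] X_meas[OF ij(2)]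
    interpret P: prob_space P using distr_X[OF ij(1)] X_meas[OF ij(1)] by (metis prob_space_distr)
    interpret P2: pair_sigma_finite P P ..
    have sP[measurable_cong]: "sets P = sets borel" by (simp add: P)
    have "indep_vars (\<lambda>_. borel) X {1..n}"
      using indep_vars_compose2[OF indep, of "\<lambda>_. fst" "\<lambda>_. borel"]
      by (simp add: borel_measurable_continuous_onI continuous_on_fst)
    from indep_var_compose[OF indep_var_restrict[OF this, of "{i}" "{j}"],
        of "\<lambda>v. v i" borel "\<lambda>v. v j" borel]
    have "indep_var borel (X i) borel (X j)" using ij by (simp add: comp_def)
    then have eq: "distr M (borel \<Otimes>\<^sub>M borel) (\<lambda>\<omega>. (X i \<omega>, X j \<omega>)) = P \<Otimes>\<^sub>M P"
      using ij by (auto simp: indep_var_distribution_eq distr_X)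
    have "AE z in P \<Otimes>\<^sub>M P. norm (x - fst z) \<noteq> norm (x - snd z)"
    proof (rule P2.AE_pair_measure)
      show "{z \<in> space (P \<Otimes>\<^sub>M P). norm (x - fst z) \<noteq> norm (x - snd z)} \<in> sets (P \<Otimes>\<^sub>M P)"
        by measurable
      show "AE y in P. AE z in P. norm (x - fst (y, z)) \<noteq> norm (x - snd (y, z))"
      proof (rule AE_I2)
        fix y
        have "sphere x (norm (x - y)) \<in> null_sets lborel"
          using negligible_sphere[of x "norm (x - y)"]
          by (simp add: negligible_iff_null_sets null_sets_completion_iff)
        then have "AE z in lborel. z \<notin> sphere x (norm (x - y))" by (rule AE_not_in)
        then have "AE z in lborel. 0 < p z \<longrightarrow> norm (x - fst (y, z)) \<noteq> norm (x - snd (y, z))"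
          by eventually_elim (auto simp: dist_norm)
        then show "AE z in P. norm (x - fst (y, z)) \<noteq> norm (x - snd (y, z))"
          unfolding P using p by (subst AE_density) auto
      qed
    qed
    then show ?thesis
      unfolding eq[symmetric] by (subst (asm) AE_distr_iff) auto
  qed
  then have "AE \<omega> in M. \<forall>i\<in>{1..n}. \<forall>j\<in>{1..n}. i \<noteq> j \<longrightarrow> norm (x - X i \<omega>) \<noteq> norm (x - X j \<omega>)"
    by (intro AE_finite_allI) (auto intro!: AE_impI)
  then show ?thesis by eventually_elim (auto simp: tied_def)
qed

end

section \<open>Deterministic bounds for the neighbour number and the bias\<close>

definition rate_exp :: "nat \<Rightarrow> real \<Rightarrow> real" where
  "rate_exp d \<beta> = 2 * \<beta> / (2 * \<beta> + real d)"

text \<open>The last identity is the balance that selects the exponent: it turns a distance of order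
  t^((a - 1) / d) into a squared bias of order t^(-a).\<close>

lemma rate_exp_bounds:
  assumes "0 < \<beta>" "0 < d"
  shows "0 < rate_exp d \<beta>" "rate_exp d \<beta> < 1" "real d / (2 * \<beta> + real d) = 1 - rate_exp d \<beta>"
    "(rate_exp d \<beta> - 1) * (2 * \<beta> / real d) = - rate_exp d \<beta>"
  using assms by (auto simp: rate_exp_def field_simps)

text \<open>The sample size cancels in \<open>n\<close> times the density estimate, which leaves l /
  R^d; a positive radius excludes the infinite estimate.\<close>

lemma local_k_density:
  fixes u :: "nat \<Rightarrow> real ^ 'd"
  assumes R: "0 < nn_radius u S l x" and n: "1 \<le> n"
  defines "v \<equiv> real l / nn_radius u S l x ^ CARD('d)"
  shows "local_k CARD('d) \<beta> \<kappa> N n (nn_density l n u S x) =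
    min n (nat (max \<lceil>\<kappa> * ln (real N) powr (real CARD('d) / (2 * \<beta> + real CARD('d))) * v powr rate_exp CARD('d) \<beta>\<rceil>
                    \<lceil>ln (real n)\<rceil>))"
proof -
  have "real n * enn2real (nn_density l n u S x) = v"
    using R n by (simp add: nn_density_def v_def)
  moreover have "nn_density l n u S x \<noteq> \<infinity>" using R by (simp add: nn_density_def)
  ultimately show ?thesis by (simp add: local_k_def rate_exp_def)
qed

lemma local_k_le: "local_k d \<beta> \<kappa> N n t \<le> n"
  by (simp add: local_k_def)

text \<open>The logarithmic floor survives the truncation because ln n \<le> n. It is what makes L
  divided by the total neighbour number at most 1 in the risk bounds.\<close>

lemma local_k_ge_ln:
  assumes "1 \<le> n"
  shows "ln (real n) \<le> real (local_k d \<beta> \<kappa> N n t)"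
proof -
  have "ln (real n) \<le> real n" using ln_bound[of "real n"] assms by simp
  then show ?thesis by (auto simp: local_k_def min_def) linarith
qed

text \<open>The powers 1 - a and a of L recombine to L. This explains the logarithmic factor in the
  neighbour function: \<open>n\<close> times a density estimate, if of order L w, turns into a
  neighbour number of order L w^a.\<close>

lemma powr_scaling:
  fixes L c w K a :: real
  assumes "0 < L" "0 < c" "0 < w" "0 < K"
  shows "L powr (1 - a) * (c * L * (w / K)) powr a = c powr a * K powr (- a) * L * w powr a"
proof -
  have "L powr (1 - a) * L powr a = L" using assms(1) by (simp flip: powr_add)
  moreover have "(c * L * (w / K)) powr a = c powr a * L powr a * (w powr a * K powr (- a))"
    using assms by (simp add: powr_mult powr_divide powr_minus_divide)
  ultimately show ?thesis by (simp add: algebra_simps)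
qed

text \<open>Fewer than \<open>l\<close> points within \<open>r\<close> means that the
  \<open>l\<close>-nearest-neighbour radius exceeds \<open>r\<close>, which caps \<open>n\<close>
  times the density estimate at c L w / K.\<close>

lemma local_k_upper:
  fixes u :: "nat \<Rightarrow> real ^ 'd"
  assumes S: "nn_ordering n u S" and l: "l \<in> {1..n}" and few: "ball_count n u x r < l"
    and r: "0 < r" "r ^ CARD('d) = K / w" and K: "0 < K" and w: "1 \<le> w"
    and "0 < \<beta>" "0 < \<kappa>" "0 < c" and lc: "real l \<le> c * ln (real N)"
    and N: "n \<le> N" "1 \<le> ln (real N)"
  defines "a \<equiv> rate_exp CARD('d) \<beta>"
  shows "real (local_k CARD('d) \<beta> \<kappa> N n (nn_density l n u S x))
    \<le> (\<kappa> * c powr a * K powr (- a) + 3) * ln (real N) * w powr a"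
proof -
  define L where "L = ln (real N)"
  define R where "R = nn_radius u S l x"
  define v where "v = real l / R ^ CARD('d)"
  have L: "1 \<le> L" using N by (simp add: L_def)
  have a: "0 < a" "a < 1" "real CARD('d) / (2 * \<beta> + real CARD('d)) = 1 - a"
    using rate_exp_bounds[OF \<open>0 < \<beta>\<close>, of "CARD('d)"] by (simp_all add: a_def)
  have n1: "1 \<le> n" using l by simp
  have rR: "r < R" using nn_radius_gt[OF S l few] by (simp add: R_def)
  with r have R0: "0 < R" by simp
  have "v \<le> c * L / R ^ CARD('d)" unfolding v_def using lc R0 by (simp add: divide_right_mono L_def)
  also have "\<dots> \<le> c * L / r ^ CARD('d)"
    using rR r(1) L \<open>0 < c\<close> by (intro divide_left_mono power_mono mult_pos_pos zero_less_power) auto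
  also have "\<dots> = c * L * (w / K)" using r(2) K w by simp
  finally have v: "v \<le> c * L * (w / K)" .
  have v0: "0 \<le> v" using R0 by (simp add: v_def)
  define A where "A = \<kappa> * L powr (1 - a) * v powr a"
  have "A \<le> \<kappa> * L powr (1 - a) * (c * L * (w / K)) powr a"
    unfolding A_def using v v0 a \<open>0 < \<kappa>\<close> by (intro mult_left_mono powr_mono2) auto
  also have "\<dots> = \<kappa> * c powr a * K powr (- a) * L * w powr a"
    using powr_scaling[of L c w K a] L \<open>0 < c\<close> w K by (simp add: mult.assoc)
  finally have A: "A \<le> \<kappa> * c powr a * K powr (- a) * L * w powr a" .
  have A0: "0 \<le> A" using \<open>0 < \<kappa>\<close> by (simp add: A_def)
  have wa: "1 \<le> w powr a" using w a by (simp add: ge_one_powr_ge_zero)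
  have Lw: "L \<le> L * w powr a" using L wa by simp
  have ln: "0 \<le> ln (real n)" "ln (real n) \<le> L" using n1 N by (auto simp: L_def)
  have "local_k CARD('d) \<beta> \<kappa> N n (nn_density l n u S x) \<le> nat (max \<lceil>A\<rceil> \<lceil>ln (real n)\<rceil>)"
    using local_k_density[of u S l x n \<beta> \<kappa> N] R0 n1 a(3)
    by (simp add: A_def v_def R_def L_def a_def)
  \<comment> \<open>Two roundings cost 2; together with \<open>ln n\<close> this is at most 3 L, and
    w \<ge> 1 turns L into L w^a. This is the constant 3 in the bound.\<close>
  then have "real (local_k CARD('d) \<beta> \<kappa> N n (nn_density l n u S x)) \<le> A + ln (real n) + 2"
    using A0 ln(1) by linarith
  also have "\<dots> \<le> \<kappa> * c powr a * K powr (- a) * L * w powr a + 3 * (L * w powr a)"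
    using A ln L Lw by linarith
  finally show ?thesis by (simp add: L_def algebra_simps)
qed

text \<open>Mirror image of \<open>local_k_upper\<close>. Truncation at \<open>n\<close> cannot be
  excluded, so the bound is a minimum with \<open>n\<close>.\<close>

lemma local_k_lower:
  fixes u :: "nat \<Rightarrow> real ^ 'd"
  assumes S: "nn_ordering n u S" and l: "l \<in> {1..n}" and many: "l \<le> ball_count n u x r"
    and r: "0 < r" "r ^ CARD('d) = K / w" and K: "0 < K" and w: "0 < w"
    and "0 < \<beta>" "0 < \<kappa>" "0 < c" and lc: "c * ln (real N) \<le> real l"
    and N: "n \<le> N" "1 \<le> ln (real N)"
  defines "a \<equiv> rate_exp CARD('d) \<beta>"
  shows "min (real n) (\<kappa> * c powr a * K powr (- a) * ln (real N) * w powr a)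
    \<le> real (local_k CARD('d) \<beta> \<kappa> N n (nn_density l n u S x))"
proof (cases "nn_radius u S l x = 0")
  \<comment> \<open>Zero radius: the density estimate is infinite and the neighbour number is
    \<open>n\<close>.\<close>
  case True
  then show ?thesis by (simp add: nn_density_def local_k_def)
next
  case False
  define L where "L = ln (real N)"
  define R where "R = nn_radius u S l x"
  define v where "v = real l / R ^ CARD('d)"
  have L: "1 \<le> L" using N by (simp add: L_def)
  have a: "0 < a" "a < 1" "real CARD('d) / (2 * \<beta> + real CARD('d)) = 1 - a"
    using rate_exp_bounds[OF \<open>0 < \<beta>\<close>, of "CARD('d)"] by (simp_all add: a_def)
  have n1: "1 \<le> n" using l by simp
  have rR: "R \<le> r" using nn_radius_le[OF S l many] by (simp add: R_def)
  have R0: "0 < R" using False by (simp add: R_def nn_radius_def)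
  have "c * L * (w / K) = c * L / r ^ CARD('d)" using r(2) K w by simp
  also have "\<dots> \<le> c * L / R ^ CARD('d)"
    using rR R0 L \<open>0 < c\<close> r(1) by (intro divide_left_mono power_mono mult_pos_pos zero_less_power) auto
  also have "\<dots> \<le> v" unfolding v_def using lc R0 by (simp add: divide_right_mono L_def)
  finally have v: "c * L * (w / K) \<le> v" .
  define A where "A = \<kappa> * L powr (1 - a) * v powr a"
  have "\<kappa> * c powr a * K powr (- a) * L * w powr a = \<kappa> * L powr (1 - a) * (c * L * (w / K)) powr a"
    using powr_scaling[of L c w K a] L \<open>0 < c\<close> w K by (simp add: mult.assoc)
  also have "\<dots> \<le> A"
    unfolding A_def using v a \<open>0 < \<kappa>\<close> \<open>0 < c\<close> L w K by (intro mult_left_mono powr_mono2) auto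
  finally have A: "\<kappa> * c powr a * K powr (- a) * L * w powr a \<le> A" .
  have "local_k CARD('d) \<beta> \<kappa> N n (nn_density l n u S x) = min n (nat (max \<lceil>A\<rceil> \<lceil>ln (real n)\<rceil>))"
    using local_k_density[of u S l x n \<beta> \<kappa> N] R0 n1 a(3)
    by (simp add: A_def v_def R_def L_def a_def)
  moreover have "A \<le> real (nat (max \<lceil>A\<rceil> \<lceil>ln (real n)\<rceil>))" by linarith
  ultimately show ?thesis using A by (auto simp: L_def min_def)
qed

text \<open>If the ball of radius \<open>r\<close> contains \<open>k\<close> points, the
  \<open>k\<close> nearest ones lie in it, and there the Hoelder condition applies.\<close>

lemma neighbour_bias:
  fixes u :: "nat \<Rightarrow> real ^ 'd"
  assumes S: "nn_ordering n u S" and "k \<le> n" and many: "k \<le> ball_count n u x r"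
    and f: "f \<in> holder_class \<beta> F H" and "0 < \<beta>" "0 < H"
    and "0 < r"
  shows "(\<Sum>i=1..k. (f (u (S x i)) - f x)\<^sup>2) \<le> real k * (H\<^sup>2 * r powr (2 * \<beta>))"
proof -
  have "(f (u (S x i)) - f x)\<^sup>2 \<le> H\<^sup>2 * r powr (2 * \<beta>)" if i: "i \<in> {1..k}" for i
  proof -
    have k: "k \<in> {1..n}" using i \<open>k \<le> n\<close> by simp
    have "norm (x - u (S x i)) \<le> norm (x - u (S x k))"
      using nn_orderingD(2)[OF S, of i k x] i k by simp
    also have "\<dots> \<le> r" using nn_radius_le[OF S k many] by (simp add: nn_radius_def)
    finally have le: "norm (u (S x i) - x) \<le> r" by (simp add: norm_minus_commute)
    have "\<bar>f (u (S x i)) - f x\<bar> \<le> H * norm (u (S x i) - x) powr \<beta>"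
      using f by (simp add: holder_class_def)
    also have "\<dots> \<le> H * r powr \<beta>"
      using le \<open>0 < \<beta>\<close> \<open>0 < H\<close> by (intro mult_left_mono powr_mono2) auto
    finally have "\<bar>f (u (S x i)) - f x\<bar>\<^sup>2 \<le> (H * r powr \<beta>)\<^sup>2" by (intro power_mono) auto
    also have "\<dots> = H\<^sup>2 * r powr (2 * \<beta>)"
      using \<open>0 < r\<close> by (simp add: power_mult_distrib powr_realpow[symmetric] powr_powr mult.commute)
    finally show ?thesis by simp
  qed
  then have "(\<Sum>i=1..k. (f (u (S x i)) - f x)\<^sup>2) \<le> (\<Sum>i=1..k. H\<^sup>2 * r powr (2 * \<beta>))"
    by (rule sum_mono)
  then show ?thesis by simp
qed

lemma bounded_bias:
  assumes f: "f \<in> holder_class \<beta> F H"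
  shows "(\<Sum>i=1..k. (f (g i) - f x)\<^sup>2) \<le> real k * (4 * F\<^sup>2)"
proof -
  have "(f (g i) - f x)\<^sup>2 \<le> 4 * F\<^sup>2" for i
  proof -
    have "\<bar>f (g i)\<bar> \<le> F" "\<bar>f x\<bar> \<le> F" using f by (simp_all add: holder_class_def)
    then have "\<bar>f (g i) - f x\<bar> \<le> 2 * F" by linarith
    then have "\<bar>f (g i) - f x\<bar>\<^sup>2 \<le> (2 * F)\<^sup>2" by (intro power_mono) auto
    then show ?thesis by (simp add: power_mult_distrib)
  qed
  then have "(\<Sum>i=1..k. (f (g i) - f x)\<^sup>2) \<le> (\<Sum>i=1..k. 4 * F\<^sup>2)"
    by (intro sum_mono) auto
  then show ?thesis by simp
qed

text \<open>The whole analysis on the good event, free of probability. Few points within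
  \<open>r1\<close> bound \<open>k\<close> from above, \<open>l\<close> points within
  \<open>r2\<close> bound it from below, and \<open>r3\<close> contains all \<open>k\<close>
  neighbours, which bounds the bias. Below the threshold \<open>T\<close> the neighbour number is
  O(L), the sup bound on \<open>f\<close> suffices, and t^(-a) is bounded below, so that the second
  claim is trivial.\<close>

lemma local_nn_good:
  fixes u :: "nat \<Rightarrow> real ^ 'd"
  assumes S: "nn_ordering n u S" and l: "l \<in> {1..n}"
    and pos: "0 < \<beta>" "0 < H" "0 < \<kappa>" "0 < c0" "0 < c1" "0 < c2" "0 < pmax" "0 < K1" "0 < K2" "0 < K3" "1 \<le> T"
    and N: "n \<le> N" "1 \<le> ln (real N)" "c0 * ln (real N) \<le> real n"
    and lc: "c1 * ln (real N) \<le> real l" "real l \<le> c2 * ln (real N)"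
    and f: "f \<in> holder_class \<beta> F H"
    and px: "0 < px" "px \<le> pmax" and t: "t = real n * px / ln (real N)"
    and r: "0 < r1" "r1 ^ CARD('d) = K1 / max 1 t" "0 < r2" "r2 ^ CARD('d) = K2 / t"
      "0 < r3" "r3 ^ CARD('d) = K3 * t powr (a - 1)"
    and a: "a = rate_exp CARD('d) \<beta>"
    and C2: "C2 = \<kappa> * c2 powr a * K1 powr (- a) + 3"
    and few: "ball_count n u x r1 < l"
    and many: "T \<le> t \<Longrightarrow> l \<le> ball_count n u x r2"
      "T \<le> t \<Longrightarrow> C2 * ln (real N) * t powr a \<le> real (ball_count n u x r3)"
    and k: "k = local_k CARD('d) \<beta> \<kappa> N n (nn_density l n u S x)"
  shows "(\<Sum>i=1..k. (f (u (S x i)) - f x)\<^sup>2)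
      \<le> (C2 * T powr a * (4 * F\<^sup>2) + C2 * H\<^sup>2 * K3 powr (2 * \<beta> / real CARD('d))) * ln (real N)"
    and "min 1 (ln (real N) / real k)
      \<le> (T powr a + pmax powr a * c0 powr (a - 1) + 1 / (\<kappa> * c1 powr a * K2 powr (- a))) * t powr (- a)"
proof -
  define L where "L = ln (real N)"
  have L: "1 \<le> L" using N by (simp add: L_def)
  have a01: "0 < a" "a < 1" and aexp: "(a - 1) * (2 * \<beta> / real CARD('d)) = - a"
    using rate_exp_bounds[OF pos(1), of "CARD('d)"] by (simp_all add: a)
  have n1: "1 \<le> n" using l by simp
  have t0: "0 < t" using t px n1 L by (simp add: L_def)
  have C2p: "0 < C2" unfolding C2 using pos by (intro add_nonneg_pos mult_nonneg_nonneg) auto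
  have kn: "k \<le> n" unfolding k by (rule local_k_le)
  \<comment> \<open>The upper bound is applied with a scale that is at least 1; hence
    \<open>max 1 t\<close> and not \<open>t\<close> in the radius \<open>r1\<close>.\<close>
  have kup: "real k \<le> C2 * L * max 1 t powr a"
    unfolding k C2 L_def a
    by (rule local_k_upper[OF S l few r(1,2)]) (use pos N lc in auto)
  have bias0: "0 \<le> C2 * T powr a * (4 * F\<^sup>2)" "0 \<le> C2 * H\<^sup>2 * K3 powr (2 * \<beta> / real CARD('d))"
    using C2p by auto
  show "(\<Sum>i=1..k. (f (u (S x i)) - f x)\<^sup>2)
      \<le> (C2 * T powr a * (4 * F\<^sup>2) + C2 * H\<^sup>2 * K3 powr (2 * \<beta> / real CARD('d))) * ln (real N)"
  proof (cases "T \<le> t")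
    case True
    then have mt: "max 1 t = t" using pos by simp
    have "real k \<le> real (ball_count n u x r3)" using kup many(2)[OF True] by (simp add: mt L_def)
    then have "k \<le> ball_count n u x r3" by simp
    from neighbour_bias[OF S kn this f pos(1,2) r(5)]
    have "(\<Sum>i=1..k. (f (u (S x i)) - f x)\<^sup>2) \<le> real k * (H\<^sup>2 * r3 powr (2 * \<beta>))" .
    also have "r3 powr (2 * \<beta>) = (r3 ^ CARD('d)) powr (2 * \<beta> / real CARD('d))"
      using r(5) by (simp add: powr_realpow[symmetric] powr_powr)
    also have "\<dots> = K3 powr (2 * \<beta> / real CARD('d)) * (t powr (a - 1)) powr (2 * \<beta> / real CARD('d))"
      unfolding r(6) using t0 pos by (simp add: powr_mult)
    \<comment> \<open>By the choice of the radius, the bias contributes t^(-a), which cancels the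
      t^a of the neighbour number.\<close>
    also have "(t powr (a - 1)) powr (2 * \<beta> / real CARD('d)) = t powr (- a)"
      by (simp only: powr_powr aexp)
    also have "real k * (H\<^sup>2 * (K3 powr (2 * \<beta> / real CARD('d)) * t powr (- a)))
        \<le> (C2 * L * t powr a) * (H\<^sup>2 * (K3 powr (2 * \<beta> / real CARD('d)) * t powr (- a)))"
      using kup by (intro mult_right_mono) (auto simp: mt)
    also have "\<dots> = C2 * H\<^sup>2 * K3 powr (2 * \<beta> / real CARD('d)) * L * (t powr a * t powr (- a))" by simp
    also have "t powr a * t powr (- a) = 1" using t0 by (simp flip: powr_add)
    finally have "(\<Sum>i=1..k. (f (u (S x i)) - f x)\<^sup>2)
        \<le> C2 * H\<^sup>2 * K3 powr (2 * \<beta> / real CARD('d)) * L" by simp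
    moreover have "0 \<le> C2 * T powr a * (4 * F\<^sup>2) * L" using C2p L by simp
    ultimately show ?thesis unfolding L_def[symmetric] distrib_right by linarith
  next
    case False
    have "max 1 t powr a \<le> T powr a" using False a01 pos by (intro powr_mono2) auto
    then have "C2 * L * max 1 t powr a \<le> C2 * L * T powr a"
      using C2p L by (intro mult_left_mono) auto
    with kup have kT: "real k \<le> C2 * L * T powr a" by linarith
    have "(\<Sum>i=1..k. (f (u (S x i)) - f x)\<^sup>2) \<le> real k * (4 * F\<^sup>2)"
      by (rule bounded_bias[OF f])
    also have "\<dots> \<le> (C2 * L * T powr a) * (4 * F\<^sup>2)" using kT by (intro mult_right_mono) auto
    also have "\<dots> = C2 * T powr a * (4 * F\<^sup>2) * L" by simp
    finally have "(\<Sum>i=1..k. (f (u (S x i)) - f x)\<^sup>2) \<le> C2 * T powr a * (4 * F\<^sup>2) * L" .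
    moreover have "0 \<le> C2 * H\<^sup>2 * K3 powr (2 * \<beta> / real CARD('d)) * L"
      using C2p L by simp
    ultimately show ?thesis unfolding L_def[symmetric] distrib_right by linarith
  qed
  define D where "D = \<kappa> * c1 powr a * K2 powr (- a)"
  have D: "0 < D" unfolding D_def using pos by auto
  have pc: "0 \<le> pmax powr a * c0 powr (a - 1)" by simp
  have ta: "t powr a * t powr (- a) = 1" using t0 by (simp flip: powr_add)
  show "min 1 (ln (real N) / real k)
      \<le> (T powr a + pmax powr a * c0 powr (a - 1) + 1 / (\<kappa> * c1 powr a * K2 powr (- a))) * t powr (- a)"
    (is "_ \<le> (?A + ?B + ?E) * _")
  proof (cases "T \<le> t")
    case False
    have "t powr a \<le> T powr a" using False a01 t0 by (intro powr_mono2) auto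
    then have "t powr a * t powr (- a) \<le> T powr a * t powr (- a)" by (intro mult_right_mono) auto
    with ta have "1 \<le> ?A * t powr (- a)" by simp
    also have "\<dots> \<le> (?A + ?B + ?E) * t powr (- a)"
      using D pc by (intro mult_right_mono) (auto simp: D_def)
    finally show ?thesis by simp
  next
    case True
    have "min (real n) (D * L * t powr a) \<le> real k"
      unfolding k D_def L_def a
      by (rule local_k_lower[OF S l many(1)[OF True] r(3,4)]) (use pos N lc t0 in auto)
    then consider "real n \<le> real k" | "D * L * t powr a \<le> real k" by linarith
    then show ?thesis
    proof cases
      case 1
      \<comment> \<open>All \<open>n\<close> points are used. Then t \<le> pmax n / L and n / L
        \<ge> c0, and since a - 1 < 0 this gives t^a \<le> pmax^a c0^(a - 1) n / L, so L / n is
        still of order t^(-a).\<close>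
      have nL: "c0 \<le> real n / L" using N(3) L by (simp add: L_def field_simps)
      have "t \<le> pmax * (real n / L)" unfolding t L_def[symmetric] using px L
        by (simp add: field_simps mult_right_mono)
      then have "t powr a \<le> (pmax * (real n / L)) powr a" using t0 a01 by (intro powr_mono2) auto
      also have "\<dots> = pmax powr a * (real n / L) powr a"
        using powr_mult[of pmax "real n / L" a] pos L by simp
      also have "(real n / L) powr a = (real n / L) powr (a - 1) * (real n / L)"
        using n1 L by (simp add: powr_diff)
      also have "(real n / L) powr (a - 1) \<le> c0 powr (a - 1)"
        using nL a01 pos by (intro powr_mono2') auto
      finally have "t powr a \<le> ?B * (real n / L)"
        using L pos by (simp add: mult_left_mono mult_right_mono divide_right_mono mult.assoc)
      then have "(L / real n) * t powr a \<le> (L / real n) * (?B * (real n / L))"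
        using L by (intro mult_left_mono) auto
      also have "\<dots> = ?B" using L n1 by simp
      finally have "(L / real n) * t powr a * t powr (- a) \<le> ?B * t powr (- a)"
        by (intro mult_right_mono) auto
      then have "L / real n \<le> ?B * t powr (- a)" using ta by (simp add: mult.assoc)
      moreover have "L / real k \<le> L / real n" using 1 L n1 by (intro divide_left_mono) auto
      moreover have "?B * t powr (- a) \<le> (?A + ?B + ?E) * t powr (- a)"
        using D by (intro mult_right_mono) (auto simp: D_def)
      ultimately show ?thesis by (simp add: L_def)
    next
      case 2
      have pos2: "0 < D * L * t powr a" using D L t0 by simp
      then have "L / real k \<le> L / (D * L * t powr a)" using 2 L by (intro divide_left_mono) auto
      also have "\<dots> = ?E * t powr (- a)" using L t0 by (simp add: D_def powr_minus_divide)
      also have "\<dots> \<le> (?A + ?B + ?E) * t powr (- a)"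
        using pc by (intro mult_right_mono) auto
      finally show ?thesis by (simp add: L_def)
    qed
  qed
qed

section \<open>Joint measurability in the point and the outcome\<close>

text \<open>Reduces the measurability of a random cardinality to that of a finite sum of indicators.
  The centre \<open>v\<close> is variable in the lemmas that follow, so that they give joint
  measurability in point and outcome, as Fubini requires.\<close>

lemma real_card_filter: "finite A \<Longrightarrow> real (card {i\<in>A. R i}) = (\<Sum>i\<in>A. of_bool (R i))"
  by (simp add: Int_def)

lemma ball_count_measurable:
  fixes U :: "nat \<Rightarrow> 'z \<Rightarrow> real ^ 'd"
  assumes "\<And>i. i \<in> {1..n} \<Longrightarrow> U i \<in> borel_measurable N"
    and [measurable]: "v \<in> borel_measurable N" "r \<in> borel_measurable N"
  shows "(\<lambda>z. real (ball_count n (\<lambda>i. U i z) (v z) (r z))) \<in> borel_measurable N"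
proof -
  have "(\<lambda>z. \<Sum>i=1..n. of_bool (norm (v z - U i z) \<le> r z) :: real) \<in> borel_measurable N"
  proof (rule borel_measurable_sum)
    fix i assume "i \<in> {1..n}"
    note [measurable] = assms(1)[OF this]
    show "(\<lambda>z. of_bool (norm (v z - U i z) \<le> r z) :: real) \<in> borel_measurable N" by measurable
  qed
  then show ?thesis by (simp only: ball_count_def real_card_filter finite_atLeastAtMost)
qed

lemma nn_set_measurable:
  fixes U :: "nat \<Rightarrow> 'z \<Rightarrow> real ^ 'd"
  assumes U: "\<And>i. i \<in> {1..n} \<Longrightarrow> U i \<in> borel_measurable N"
    and [measurable]: "v \<in> borel_measurable N"
  shows "Measurable.pred N (\<lambda>z. i \<in> nn_set n (\<lambda>i. U i z) (v z) k)"
proof (cases "i \<in> {1..n}")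
  case True
  note [measurable] = U[OF True]
  have [measurable]: "(\<lambda>z. \<Sum>j=1..n. of_bool (norm (v z - U j z) < norm (v z - U i z)) :: real) \<in> borel_measurable N"
  proof (rule borel_measurable_sum)
    fix j assume "j \<in> {1..n}"
    note [measurable] = U[OF this]
    show "(\<lambda>z. of_bool (norm (v z - U j z) < norm (v z - U i z)) :: real) \<in> borel_measurable N" by measurable
  qed
  have "i \<in> nn_set n (\<lambda>i. U i z) (v z) k \<longleftrightarrow>
      (\<Sum>j=1..n. of_bool (norm (v z - U j z) < norm (v z - U i z)) :: real) < real k" for z
    using True unfolding nn_set_def
    by (simp only: real_card_filter[symmetric] finite_atLeastAtMost) simp
  then show ?thesis by (simp only:) measurable
next
  case False
  then have "i \<notin> nn_set n (\<lambda>i. U i z) (v z) k" for z unfolding nn_set_def by blast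
  then show ?thesis by simp
qed

lemma nn_set_subset: "nn_set n u x k \<subseteq> {1..n}"
  by (auto simp: nn_set_def)

lemma sum_nn_set_measurable:
  fixes U :: "nat \<Rightarrow> 'z \<Rightarrow> real ^ 'd" and g :: "nat \<Rightarrow> 'z \<Rightarrow> real"
  assumes U: "\<And>i. i \<in> {1..n} \<Longrightarrow> U i \<in> borel_measurable N"
    and v: "v \<in> borel_measurable N" and g: "\<And>i. i \<in> {1..n} \<Longrightarrow> g i \<in> borel_measurable N"
  shows "(\<lambda>z. \<Sum>i\<in>nn_set n (\<lambda>i. U i z) (v z) k. g i z) \<in> borel_measurable N"
proof -
  have "(\<lambda>z. \<Sum>i=1..n. if i \<in> nn_set n (\<lambda>i. U i z) (v z) k then g i z else 0) \<in> borel_measurable N"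
  proof (rule borel_measurable_sum)
    fix i assume "i \<in> {1..n}"
    note [measurable] = g[OF this]
    have [measurable]: "Measurable.pred N (\<lambda>z. i \<in> nn_set n (\<lambda>i. U i z) (v z) k)"
      by (rule nn_set_measurable[OF U v])
    show "(\<lambda>z. if i \<in> nn_set n (\<lambda>i. U i z) (v z) k then g i z else 0) \<in> borel_measurable N" by measurable
  qed
  moreover have "(\<Sum>i=1..n. if i \<in> nn_set n (\<lambda>i. U i z) (v z) k then g i z else 0)
      = (\<Sum>i\<in>nn_set n (\<lambda>i. U i z) (v z) k. g i z)" for z
    using nn_set_subset[of n "\<lambda>i. U i z" "v z" k]
    by (simp add: sum.If_cases Int_absorb1)
  ultimately show ?thesis by simp
qed

lemma tied_measurable:
  fixes U :: "nat \<Rightarrow> 'z \<Rightarrow> real ^ 'd"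
  assumes U: "\<And>i. i \<in> {1..n} \<Longrightarrow> U i \<in> borel_measurable N"
    and [measurable]: "v \<in> borel_measurable N"
  shows "Measurable.pred N (\<lambda>z. tied n (\<lambda>i. U i z) (v z))"
proof -
  have eq: "Measurable.pred N (\<lambda>z. i \<noteq> j \<and> norm (v z - U i z) = norm (v z - U j z))"
    if "i \<in> {1..n}" "j \<in> {1..n}" for i j
  proof -
    note [measurable] = that[THEN U]
    show ?thesis by measurable
  qed
  show ?thesis unfolding tied_def
    by (intro pred_intros_finite(4) finite_atLeastAtMost eq)
qed

section \<open>Noise sums over the nearest neighbours\<close>

text \<open>Up to \<open>b\<close> the bound is trivial; beyond it write y = b + z and use z^2 \<le>
  2 exp z and b \<ge> 1. The excess over \<open>b\<close> enters only through an exponential, so a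
  square can be controlled on every outcome by a variable of small mean.\<close>

lemma square_le_exp:
  fixes y b :: real
  assumes "0 \<le> y" "1 \<le> b"
  shows "y\<^sup>2 \<le> 4 * b\<^sup>2 * (1 + exp (y - b))"
proof (cases "y \<le> b")
  case True
  then have "y\<^sup>2 \<le> b\<^sup>2" using assms by (intro power_mono) auto
  also have "\<dots> \<le> 4 * b\<^sup>2 * (1 + exp (y - b))"
    using mult_left_mono[of 1 "4 * (1 + exp (y - b))" "b\<^sup>2"] by (simp add: add_increasing2 algebra_simps)
  finally show ?thesis .
next
  case False
  define z where "z = y - b"
  have z: "0 \<le> z" "y = b + z" using False by (auto simp: z_def)
  have "y\<^sup>2 \<le> 2 * b\<^sup>2 + 2 * z\<^sup>2" unfolding z(2)
    using zero_le_power2[of "b - z"] by (simp add: power2_sum power2_diff)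
  also have "z\<^sup>2 \<le> 2 * exp z" using exp_lower_Taylor_quadratic[OF z(1)] z(1) by linarith
  also have "2 * b\<^sup>2 + 2 * (2 * exp z) \<le> 4 * b\<^sup>2 + 4 * b\<^sup>2 * exp z"
  proof -
    have "1 \<le> b\<^sup>2" using assms(2) by (simp add: one_le_power)
    then have "1 * (4 * exp z) \<le> b\<^sup>2 * (4 * exp z)" by (intro mult_right_mono) auto
    moreover have "0 \<le> b\<^sup>2" by simp
    ultimately show ?thesis by linarith
  qed
  finally show ?thesis by (simp add: z_def algebra_simps)
qed

context noisy_sample
begin

text \<open>The parameter is tuned to the number of summands: it never exceeds lambda0 / 2 in
  absolute value, and card J times its square is at most lambda0^2 L / 4. The total exponent is
  sigma0 L card J / (card J + L), hence at most sigma0 L for every \<open>J\<close>.\<close>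

lemma noise_prod_bound:
  assumes J: "J \<subseteq> {1..n}" and L: "0 < L" and s: "s = 1 \<or> s = -1"
  shows "(\<Prod>i=1..n. \<integral>\<^sup>+ e. ennreal (if i \<in> J then exp (s * (lambda0 / 2) * sqrt (L / (real (card J) + L)) * e) else 1) \<partial>\<nu>)
     \<le> ennreal (exp (sigma0 * L))"
proof -
  interpret N: prob_space \<nu> using noise by (simp add: noise_law_def)
  define lam where "lam = s * (lambda0 / 2) * sqrt (L / (real (card J) + L))"
  have q: "0 \<le> L / (real (card J) + L)" "L / (real (card J) + L) \<le> 1" using L by auto
  have "\<bar>lam\<bar> = lambda0 / 2 * sqrt (L / (real (card J) + L))"
    using s lambda0 q by (auto simp: lam_def abs_mult)
  also have "\<dots> \<le> lambda0 / 2 * 1" using q lambda0 by (intro mult_left_mono) auto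
  finally have "\<bar>lam\<bar> \<le> lambda0 / 2" by simp
  from noise_law_mgf[OF noise lambda0 this]
  have mgf: "(\<integral>\<^sup>+ e. ennreal (exp (lam * e)) \<partial>\<nu>) \<le> ennreal (exp (4 * sigma0 * lam\<^sup>2 / lambda0\<^sup>2))" .
  have "4 * sigma0 * lam\<^sup>2 / lambda0\<^sup>2 = sigma0 * (L / (real (card J) + L))"
  proof -
    have "lam\<^sup>2 = lambda0\<^sup>2 / 4 * (L / (real (card J) + L))"
      using s q(1) by (auto simp: lam_def power_mult_distrib power_divide)
    moreover have "4 * sigma0 * (lambda0\<^sup>2 / 4 * q) / lambda0\<^sup>2 = sigma0 * q" for q
      using lambda0 by simp
    ultimately show ?thesis by (simp only:)
  qed
  note mgf = mgf[unfolded this]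
  have "(\<Prod>i=1..n. \<integral>\<^sup>+ e. ennreal (if i \<in> J then exp (lam * e) else 1) \<partial>\<nu>)
      \<le> (\<Prod>i=1..n. if i \<in> J then ennreal (exp (sigma0 * (L / (real (card J) + L)))) else 1)"
    using mgf by (intro prod_mono_ennreal) (auto simp: N.emeasure_space_1)
  also have "\<dots> = ennreal (exp (sigma0 * (L / (real (card J) + L)))) ^ card J"
    using J by (simp add: prod.If_cases Int_absorb1)
  also have "\<dots> = ennreal (exp (sigma0 * (L * (real (card J) / (real (card J) + L)))))"
    by (simp add: ennreal_power exp_of_nat_mult[symmetric] mult_ac)
  also have "\<dots> \<le> ennreal (exp (sigma0 * (L * 1)))"
    using sigma0 L by (intro ennreal_leI iffD2[OF exp_le_cancel_iff] mult_left_mono) auto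
  finally show ?thesis unfolding lam_def by simp
qed

text \<open>This is conditioning on the covariates: \<open>T\<close> is a function of them with
  finitely many values. On each event \<open>T = J\<close> the noise factor splits off by
  \<open>nn_integral_Xvec_eps\<close> with a bound uniform in \<open>J\<close>, and the
  probabilities of these disjoint events add up to at most 1. A choice of summands by the covariates
  therefore costs nothing.\<close>

lemma noise_exp_bound_signed:
  fixes T :: "(nat \<Rightarrow> real ^ 'd) \<Rightarrow> nat set"
  assumes T: "\<And>u. T u \<subseteq> {1..n}"
    and Tm: "\<And>J. {u \<in> space (PiM {1..n} (\<lambda>_. borel)). T u = J} \<in> sets (PiM {1..n} (\<lambda>_. borel))"
    and L: "0 < L" and s: "s = 1 \<or> s = -1"
  shows "(\<integral>\<^sup>+ \<omega>. ennreal (exp (s * (lambda0 / 2) * sqrt (L / (real (card (T (Xvec \<omega>))) + L))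
      * (\<Sum>i\<in>T (Xvec \<omega>). eps i \<omega>))) \<partial>M) \<le> ennreal (exp (sigma0 * L))"
proof -
  define lam where "lam J = s * (lambda0 / 2) * sqrt (L / (real (card J) + L))" for J :: "nat set"
  define B where "B J = {u \<in> space (PiM {1..n} (\<lambda>_. borel)). T u = J}" for J
  define g where "g J i e = ennreal (if i \<in> J then exp (lam J * e) else 1)" for J and i :: nat and e :: real
  have g[measurable]: "g J i \<in> borel_measurable borel" for J i
    unfolding g_def by measurable
  have B[measurable]: "B J \<in> sets (PiM {1..n} (\<lambda>_. borel))" for J unfolding B_def by (rule Tm)
  have Xsp: "Xvec \<omega> \<in> space (PiM {1..n} (\<lambda>_. borel))" for \<omega>
    by (auto simp: space_PiM Xvec_def)
  have pb: "(\<Prod>i=1..n. \<integral>\<^sup>+ e. g J i e \<partial>\<nu>) \<le> ennreal (exp (sigma0 * L))" if "J \<subseteq> {1..n}" for J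
    unfolding g_def lam_def by (rule noise_prod_bound[OF that L s])
  have gprod: "ennreal (exp (lam J * (\<Sum>i\<in>J. eps i \<omega>))) = (\<Prod>i=1..n. g J i (eps i \<omega>))"
    if J: "J \<subseteq> {1..n}" for J \<omega>
  proof -
    have "(\<Prod>i=1..n. g J i (eps i \<omega>)) = ennreal (\<Prod>i=1..n. if i \<in> J then exp (lam J * eps i \<omega>) else 1)"
      unfolding g_def by (subst prod_ennreal) auto
    also have "(\<Prod>i=1..n. if i \<in> J then exp (lam J * eps i \<omega>) else 1) = (\<Prod>i\<in>J. exp (lam J * eps i \<omega>))"
      using J by (simp add: prod.If_cases Int_absorb1)
    also have "\<dots> = exp (\<Sum>i\<in>J. lam J * eps i \<omega>)"
      using J by (simp add: exp_sum finite_subset)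
    finally show ?thesis by (simp add: sum_distrib_left)
  qed
  \<comment> \<open>Exactly one set \<open>J\<close> contributes for each outcome.\<close>
  have eq: "ennreal (exp (lam (T (Xvec \<omega>)) * (\<Sum>i\<in>T (Xvec \<omega>). eps i \<omega>)))
      = (\<Sum>J\<in>Pow {1..n}. indicator (B J) (Xvec \<omega>) * (\<Prod>i=1..n. g J i (eps i \<omega>)))" for \<omega>
  proof -
    have "indicator (B J) (Xvec \<omega>) * (\<Prod>i=1..n. g J i (eps i \<omega>))
        = (if J = T (Xvec \<omega>) then (\<Prod>i=1..n. g J i (eps i \<omega>)) else 0)" for J
      using Xsp[of \<omega>] by (auto simp: B_def)
    then have "(\<Sum>J\<in>Pow {1..n}. indicator (B J) (Xvec \<omega>) * (\<Prod>i=1..n. g J i (eps i \<omega>)))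
        = (\<Prod>i=1..n. g (T (Xvec \<omega>)) i (eps i \<omega>))"
      using T[of "Xvec \<omega>"] by (simp add: sum.delta)
    then show ?thesis using gprod[OF T] by simp
  qed
  have m: "(\<lambda>\<omega>. indicator (B J) (Xvec \<omega>) * (\<Prod>i=1..n. g J i (eps i \<omega>))) \<in> borel_measurable M" for J
  proof -
    have "(\<lambda>\<omega>. \<Prod>i=1..n. g J i (eps i \<omega>)) \<in> borel_measurable M"
      by (rule borel_measurable_prod_ennreal) (rule measurable_compose[OF eps_meas], auto)
    then show ?thesis by measurable
  qed
  have "(\<integral>\<^sup>+ \<omega>. ennreal (exp (lam (T (Xvec \<omega>)) * (\<Sum>i\<in>T (Xvec \<omega>). eps i \<omega>))) \<partial>M)
     = (\<Sum>J\<in>Pow {1..n}. \<integral>\<^sup>+ \<omega>. indicator (B J) (Xvec \<omega>) * (\<Prod>i=1..n. g J i (eps i \<omega>)) \<partial>M)"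
    unfolding eq by (rule nn_integral_sum) (rule m)
  also have "\<dots> \<le> (\<Sum>J\<in>Pow {1..n}. ennreal (exp (sigma0 * L)) * emeasure M (Xvec -` B J \<inter> space M))"
  proof (rule sum_mono)
    fix J assume "J \<in> Pow {1..n}"
    then have pbJ: "(\<Prod>i=1..n. \<integral>\<^sup>+ e. g J i e \<partial>\<nu>) \<le> ennreal (exp (sigma0 * L))" using pb by blast
    then have "(\<Prod>i=1..n. \<integral>\<^sup>+ e. g J i e \<partial>\<nu>) < \<infinity>" by (rule le_less_trans) simp
    then show "(\<integral>\<^sup>+ \<omega>. indicator (B J) (Xvec \<omega>) * (\<Prod>i=1..n. g J i (eps i \<omega>)) \<partial>M)
        \<le> ennreal (exp (sigma0 * L)) * emeasure M (Xvec -` B J \<inter> space M)"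
      using nn_integral_Xvec_eps[of "g J" "B J", OF g B] pbJ by (simp add: mult_right_mono)
  qed
  also have "\<dots> = ennreal (exp (sigma0 * L)) * (\<Sum>J\<in>Pow {1..n}. emeasure M (Xvec -` B J \<inter> space M))"
    by (simp add: sum_distrib_left)
  also have "(\<Sum>J\<in>Pow {1..n}. emeasure M (Xvec -` B J \<inter> space M))
      = emeasure M (\<Union>J\<in>Pow {1..n}. Xvec -` B J \<inter> space M)"
  proof (rule sum_emeasure)
    show "(\<lambda>J. Xvec -` B J \<inter> space M) ` Pow {1..n} \<subseteq> events"
      using measurable_sets[OF Xvec_meas B] by blast
    show "disjoint_family_on (\<lambda>J. Xvec -` B J \<inter> space M) (Pow {1..n})"
      by (auto simp: disjoint_family_on_def B_def)
  qed simp
  also have "ennreal (exp (sigma0 * L)) * \<dots> \<le> ennreal (exp (sigma0 * L)) * 1"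
    by (intro mult_left_mono emeasure_le_1) simp
  finally show ?thesis by (simp add: lam_def)
qed

lemma noise_exp_bound:
  fixes T :: "(nat \<Rightarrow> real ^ 'd) \<Rightarrow> nat set"
  assumes T: "\<And>u. T u \<subseteq> {1..n}"
    and Tm: "\<And>J. {u \<in> space (PiM {1..n} (\<lambda>_. borel)). T u = J} \<in> sets (PiM {1..n} (\<lambda>_. borel))"
    and L: "0 < L"
    and meas: "(\<lambda>\<omega>. sqrt (L / (real (card (T (Xvec \<omega>))) + L)) * (\<Sum>i\<in>T (Xvec \<omega>). eps i \<omega>)) \<in> borel_measurable M"
  shows "(\<integral>\<^sup>+ \<omega>. ennreal (exp (lambda0 / 2 * \<bar>sqrt (L / (real (card (T (Xvec \<omega>))) + L))
      * (\<Sum>i\<in>T (Xvec \<omega>). eps i \<omega>)\<bar>)) \<partial>M) \<le> ennreal (2 * exp (sigma0 * L))"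
proof -
  define Y where "Y \<omega> = sqrt (L / (real (card (T (Xvec \<omega>))) + L)) * (\<Sum>i\<in>T (Xvec \<omega>). eps i \<omega>)" for \<omega>
  have Y[measurable]: "Y \<in> borel_measurable M" unfolding Y_def by (rule meas)
  have pm: "(\<integral>\<^sup>+ \<omega>. ennreal (exp (s * (lambda0 / 2) * Y \<omega>)) \<partial>M) \<le> ennreal (exp (sigma0 * L))"
    if "s = 1 \<or> s = -1" for s
    using noise_exp_bound_signed[OF T Tm L that] by (simp add: Y_def mult.assoc)
  have "(\<integral>\<^sup>+ \<omega>. ennreal (exp (lambda0 / 2 * \<bar>Y \<omega>\<bar>)) \<partial>M)
     \<le> (\<integral>\<^sup>+ \<omega>. ennreal (exp (1 * (lambda0 / 2) * Y \<omega>)) + ennreal (exp ((-1) * (lambda0 / 2) * Y \<omega>)) \<partial>M)"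
    by (intro nn_integral_mono) (auto simp: abs_if ennreal_plus[symmetric] simp del: ennreal_plus intro!: ennreal_leI)
  also have "\<dots> = (\<integral>\<^sup>+ \<omega>. ennreal (exp (1 * (lambda0 / 2) * Y \<omega>)) \<partial>M)
      + (\<integral>\<^sup>+ \<omega>. ennreal (exp ((-1) * (lambda0 / 2) * Y \<omega>)) \<partial>M)"
    by (rule nn_integral_add) measurable
  also have "\<dots> \<le> ennreal (exp (sigma0 * L)) + ennreal (exp (sigma0 * L))"
    by (intro add_mono pm) auto
  finally show ?thesis by (simp add: Y_def ennreal_plus[symmetric] del: ennreal_plus)
qed

text \<open>The exponent is shifted by K L, which brings the mean down to at most 2 exp ((sigma0 -
  K) L). Normalisation uses the size of the index set, not \<open>k\<close>, since these can differ
  when distances tie.\<close>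

definition fluct :: "real \<Rightarrow> real \<Rightarrow> nat \<Rightarrow> real ^ 'd \<Rightarrow> 'w \<Rightarrow> real" where
  "fluct L K k x \<omega> = (let J = nn_set n (\<lambda>i. X i \<omega>) x k in
     exp (lambda0 / 2 * \<bar>sqrt (L / (real (card J) + L)) * (\<Sum>i\<in>J. eps i \<omega>)\<bar> - K * L))"

lemma fluct_measurable [measurable]: "(\<lambda>z. fluct L K k (fst z) (snd z)) \<in> borel_measurable (borel \<Otimes>\<^sub>M M)"
proof -
  have [measurable]: "(\<lambda>z. \<Sum>i\<in>nn_set n (\<lambda>i. X i (snd z)) (fst z) k. eps i (snd z)) \<in> borel_measurable (borel \<Otimes>\<^sub>M M)"
    by (rule sum_nn_set_measurable) (auto intro!: measurable_compose[OF measurable_snd X_meas] measurable_compose[OF measurable_snd eps_meas])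
  have "(\<lambda>z. \<Sum>i\<in>nn_set n (\<lambda>i. X i (snd z)) (fst z) k. 1 :: real) \<in> borel_measurable (borel \<Otimes>\<^sub>M M)"
    by (rule sum_nn_set_measurable) (auto intro!: measurable_compose[OF measurable_snd X_meas] measurable_compose[OF measurable_snd eps_meas])
  then have [measurable]: "(\<lambda>z. real (card (nn_set n (\<lambda>i. X i (snd z)) (fst z) k))) \<in> borel_measurable (borel \<Otimes>\<^sub>M M)"
    by simp
  show ?thesis unfolding fluct_def Let_def by measurable
qed

lemma fluct_bound:
  assumes L: "0 < L"
  shows "(\<integral>\<^sup>+ \<omega>. ennreal (fluct L K k x \<omega>) \<partial>M) \<le> ennreal (2 * exp (sigma0 * L - K * L))"
proof -
  define T where "T u = nn_set n u x k" for u :: "nat \<Rightarrow> real ^ 'd"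
  \<comment> \<open>Only the indices in \<open>{1..n}\<close> are inspected, so the restricted
    vector \<open>Xvec\<close> determines the set.\<close>
  have TX: "T (Xvec \<omega>) = nn_set n (\<lambda>i. X i \<omega>) x k" for \<omega>
    unfolding T_def nn_set_def Xvec_def
    by (rule Collect_cong, rule conj_cong, simp, rule arg_cong[where f="\<lambda>A. card A < k"]) auto
  have Tsub: "T u \<subseteq> {1..n}" for u unfolding T_def by (rule nn_set_subset)
  have Tm: "{u \<in> space (PiM {1..n} (\<lambda>_. borel)). T u = J} \<in> sets (PiM {1..n} (\<lambda>_. borel))" for J
  proof (cases "J \<subseteq> {1..n}")
    case True
    have [measurable]: "Measurable.pred (PiM {1..n} (\<lambda>_. borel)) (\<lambda>u. i \<in> T u)" for i
      unfolding T_def by (rule nn_set_measurable[where U="\<lambda>i u. u i"]) auto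
    have "T u = J \<longleftrightarrow> (\<forall>i\<in>{1..n}. i \<in> T u \<longleftrightarrow> i \<in> J)" for u
      using Tsub[of u] True by blast
    moreover have "Measurable.pred (PiM {1..n} (\<lambda>_. borel)) (\<lambda>u. \<forall>i\<in>{1..n}. i \<in> T u \<longleftrightarrow> i \<in> J)"
      by measurable
    ultimately have "Measurable.pred (PiM {1..n} (\<lambda>_. borel)) (\<lambda>u. T u = J)" by (simp only:)
    then show ?thesis by (simp only: pred_def)
  next
    case False
    then have "{u \<in> space (PiM {1..n} (\<lambda>_. borel)). T u = J} = {}" using Tsub by auto
    then show ?thesis by (simp only: sets.empty_sets)
  qed
  have f: "(\<lambda>\<omega>. fluct L K k x \<omega>) \<in> borel_measurable M"
    using measurable_compose[OF measurable_Pair1' fluct_measurable, of x] by simp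
  have [measurable]: "(\<lambda>\<omega>. \<Sum>i\<in>nn_set n (\<lambda>i. X i \<omega>) x k. eps i \<omega>) \<in> borel_measurable M"
    by (rule sum_nn_set_measurable) (auto intro: X_meas eps_meas)
  have "(\<lambda>\<omega>. \<Sum>i\<in>nn_set n (\<lambda>i. X i \<omega>) x k. 1 :: real) \<in> borel_measurable M"
    by (rule sum_nn_set_measurable) (auto intro: X_meas eps_meas)
  then have [measurable]: "(\<lambda>\<omega>. real (card (nn_set n (\<lambda>i. X i \<omega>) x k))) \<in> borel_measurable M"
    by simp
  define Z where "Z \<omega> = exp (lambda0 / 2 * \<bar>sqrt (L / (real (card (T (Xvec \<omega>))) + L)) * (\<Sum>i\<in>T (Xvec \<omega>). eps i \<omega>)\<bar>)" for \<omega>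
  have [measurable]: "Z \<in> borel_measurable M" unfolding Z_def TX by measurable
  have "fluct L K k x \<omega> = exp (- (K * L)) * Z \<omega>" for \<omega>
    by (simp add: fluct_def Let_def Z_def TX flip: exp_add)
  then have "(\<integral>\<^sup>+ \<omega>. ennreal (fluct L K k x \<omega>) \<partial>M) = ennreal (exp (- (K * L))) * (\<integral>\<^sup>+ \<omega>. ennreal (Z \<omega>) \<partial>M)"
    by (simp add: ennreal_mult' nn_integral_cmult)
  also have "\<dots> \<le> ennreal (exp (- (K * L))) * ennreal (2 * exp (sigma0 * L))"
    unfolding Z_def by (intro mult_left_mono noise_exp_bound[OF Tsub Tm L]) (simp_all add: TX)
  also have "\<dots> = ennreal (2 * exp (sigma0 * L - K * L))"
    by (simp add: ennreal_mult'[symmetric] exp_diff exp_minus field_simps)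
  finally show ?thesis .
qed

text \<open>\<open>square_le_exp\<close> with level b = K L, applied to the normalised sum and then
  rescaled by 4 (k + L) / (lambda0^2 L). When the noise is atypically large the bound persists with
  the factor \<open>1 + fluct\<close>.\<close>

lemma noise_sum_le:
  assumes S: "nn_ordering n (\<lambda>i. X i \<omega>) S" and "\<not> tied n (\<lambda>i. X i \<omega>) x" and "k \<le> n"
    and L: "1 \<le> L" and K: "1 \<le> K"
  shows "(\<Sum>i=1..k. eps (S x i) \<omega>)\<^sup>2 \<le> 16 * K\<^sup>2 / lambda0\<^sup>2 * L * (real k + L) * (1 + fluct L K k x \<omega>)"
proof -
  define s where "s = (\<Sum>i=1..k. eps (S x i) \<omega>)"
  define y where "y = lambda0 / 2 * \<bar>sqrt (L / (real k + L)) * s\<bar>"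
  have fl: "fluct L K k x \<omega> = exp (y - K * L)"
    using sum_nn_set(1)[OF S assms(2,3), of "\<lambda>i. eps i \<omega>"] sum_nn_set(2)[OF S assms(2,3)]
    by (simp only: fluct_def Let_def y_def s_def)
  have "1 \<le> K * L" using L K mult_mono[of 1 K 1 L] by simp
  then have "y\<^sup>2 \<le> 4 * (K * L)\<^sup>2 * (1 + exp (y - K * L))"
    using lambda0 L by (intro square_le_exp) (auto simp: y_def)
  also have "y\<^sup>2 = lambda0\<^sup>2 / 4 * (L / (real k + L)) * s\<^sup>2"
  proof -
    have "(lambda0 / 2 * \<bar>sqrt q * s\<bar>)\<^sup>2 = lambda0\<^sup>2 / 4 * q * s\<^sup>2" if "0 \<le> q" for q
      using that by (simp add: power_mult_distrib power_divide abs_mult)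
    from this[of "L / (real k + L)"] show ?thesis using L by (simp only: y_def) simp
  qed
  finally have le: "lambda0\<^sup>2 / 4 * (L / (real k + L)) * s\<^sup>2 \<le> 4 * (K * L)\<^sup>2 * (1 + fluct L K k x \<omega>)"
    by (simp add: fl)
  have p: "0 < 4 * (real k + L) / (lambda0\<^sup>2 * L)" using L lambda0 by (simp add: add_nonneg_pos)
  have "s\<^sup>2 = (4 * (real k + L) / (lambda0\<^sup>2 * L)) * (lambda0\<^sup>2 / 4 * (L / (real k + L)) * s\<^sup>2)"
  proof -
    have "0 < real k + L" using L by simp
    then show ?thesis using L lambda0 by simp
  qed
  also have "\<dots> \<le> (4 * (real k + L) / (lambda0\<^sup>2 * L)) * (4 * (K * L)\<^sup>2 * (1 + fluct L K k x \<omega>))"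
    using le p by (intro mult_left_mono) auto
  also have "\<dots> = 16 * K\<^sup>2 / lambda0\<^sup>2 * L * (real k + L) * (1 + fluct L K k x \<omega>)"
    using L by (simp add: power_mult_distrib power2_eq_square) (simp add: algebra_simps)
  finally show ?thesis by (simp add: s_def)
qed

end

section \<open>Chernoff bounds and the envelope\<close>

lemma powr_inverse_power:
  fixes c :: real
  assumes "0 < c" "0 < d"
  shows "(c powr (1 / real d)) ^ d = c"
  using assms by (simp add: powr_realpow[symmetric] powr_powr)

lemma radius_le:
  fixes r R :: real
  assumes "r ^ d \<le> R ^ d" "0 \<le> R" "0 < d"
  shows "r \<le> R"
  using assms power_le_imp_le_base[of r "d - 1" R] by simp

lemma mass_class_lower:
  fixes P :: "(real ^ 'd) measure"
  assumes "mass_class pmax a_min r_min a_max r_max P p" "0 < r" "r \<le> r_min"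
  shows "a_min * p x * r ^ CARD('d) \<le> measure P (cball x r)"
  using assms unfolding mass_class_def by blast

lemma mass_class_upper:
  fixes P :: "(real ^ 'd) measure"
  assumes "mass_class pmax a_min r_min a_max r_max P p" "0 < p x" "0 < r" "r \<le> r_max"
  shows "measure P (cball x r) \<le> a_max * p x * r ^ CARD('d)"
  using assms unfolding mass_class_def by blast

context noisy_sample
begin

text \<open>The maximal mass property bounds the mean count by a_max K L. The small factor
  \<open>K\<close> keeps the mean times exp s - 1 below L, while s l \<ge> (c + 1) L; the difference
  is at most -c L. A large \<open>s\<close> makes up for a small constant in the lower bound on
  \<open>l\<close>.\<close>

lemma few_neighbours_bound:
  assumes mass: "mass_class pmax a_min r_min a_max r_max P p" and px: "0 < p x"
    and r: "0 < r" "r ^ CARD('d) = K / w" and K: "0 < K" "K \<le> r_max ^ CARD('d)" "a_max * K * (exp s - 1) \<le> 1"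
    and pos: "0 < L" "0 < r_max" "0 < a_max" "0 < s"
    and w: "1 \<le> w" "real n * p x / L \<le> w" and n: "1 \<le> n"
    and l: "(c + 1) / s * L \<le> real l"
  shows "(\<integral>\<^sup>+ \<omega>. ennreal (exp (s * real (ball_count n (\<lambda>i. X i \<omega>) x r) - s * real l)) \<partial>M)
      \<le> ennreal (exp (- c * L))"
proof -
  have pr: "prob_space P" using mass unfolding mass_class_def by blast
  have [measurable]: "(\<lambda>\<omega>. real (ball_count n (\<lambda>i. X i \<omega>) x r)) \<in> borel_measurable M"
    by (rule ball_count_measurable) (auto intro: X_meas)
  have "K / w \<le> K" using K w by (simp add: field_simps)
  then have "r \<le> r_max" using r K pos by (intro radius_le[of r "CARD('d)"]) auto
  then have "measure P (cball x r) \<le> a_max * p x * r ^ CARD('d)"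
    by (rule mass_class_upper[OF mass px r(1)])
  then have "real n * measure P (cball x r) \<le> real n * (a_max * p x * (K / w))"
    unfolding r(2) by (intro mult_left_mono) auto
  also have "\<dots> = a_max * K * (real n * p x / w)" by simp
  also have "\<dots> \<le> a_max * K * L"
    using w pos K by (intro mult_left_mono) (auto simp: field_simps)
  finally have "real n * measure P (cball x r) \<le> a_max * K * L" .
  then have "real n * measure P (cball x r) * (exp s - 1) \<le> a_max * K * L * (exp s - 1)"
    using pos by (intro mult_right_mono) auto
  also have "\<dots> = a_max * K * (exp s - 1) * L" by simp
  also have "\<dots> \<le> 1 * L" using K(3) pos by (intro mult_right_mono) auto
  finally have mu: "real n * measure P (cball x r) * (exp s - 1) \<le> L" by simp
  have sl: "(c + 1) * L \<le> s * real l" using l pos by (simp add: field_simps)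
  have "(\<integral>\<^sup>+ \<omega>. ennreal (exp (s * real (ball_count n (\<lambda>i. X i \<omega>) x r) - s * real l)) \<partial>M)
     = (\<integral>\<^sup>+ \<omega>. ennreal (exp (- (s * real l))) * ennreal (exp (s * real (ball_count n (\<lambda>i. X i \<omega>) x r))) \<partial>M)"
    by (intro nn_integral_cong) (simp add: ennreal_mult'[symmetric] exp_add[symmetric])
  also have "\<dots> = ennreal (exp (- (s * real l))) * (\<integral>\<^sup>+ \<omega>. ennreal (exp (s * real (ball_count n (\<lambda>i. X i \<omega>) x r))) \<partial>M)"
    by (rule nn_integral_cmult) measurable
  also have "\<dots> \<le> ennreal (exp (- (s * real l))) * ennreal (exp (real n * measure P (cball x r) * (exp s - 1)))"
    by (intro mult_left_mono count_mgf pr) simp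
  also have "\<dots> = ennreal (exp (real n * measure P (cball x r) * (exp s - 1) - s * real l))"
    by (simp add: ennreal_mult'[symmetric] exp_add[symmetric])
  also have "\<dots> \<le> ennreal (exp (- c * L))"
    using mu sl by (intro ennreal_leI) (simp add: algebra_simps)
  finally show ?thesis .
qed

text \<open>Lower tail with parameter -1. Since exp (-1) - 1 \<le> -1/2, a mean count of at least 2
  (v + c L) bounds the exponent by v - (v + c L) = -c L; this is the origin of the factor 2.\<close>

lemma many_neighbours_bound:
  assumes mass: "mass_class pmax a_min r_min a_max r_max P p"
    and r: "0 < r" "r ^ CARD('d) \<le> r_min ^ CARD('d)" and "0 < r_min"
    and b: "2 * (v + c * L) \<le> real n * (a_min * p x * r ^ CARD('d))"
  shows "(\<integral>\<^sup>+ \<omega>. ennreal (exp (v - real (ball_count n (\<lambda>i. X i \<omega>) x r))) \<partial>M) \<le> ennreal (exp (- c * L))"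
proof -
  have pr: "prob_space P" using mass unfolding mass_class_def by blast
  have [measurable]: "(\<lambda>\<omega>. real (ball_count n (\<lambda>i. X i \<omega>) x r)) \<in> borel_measurable M"
    by (rule ball_count_measurable) (auto intro: X_meas)
  have "r \<le> r_min" using assms by (intro radius_le[of r "CARD('d)"]) auto
  then have "a_min * p x * r ^ CARD('d) \<le> measure P (cball x r)"
    by (rule mass_class_lower[OF mass r(1)])
  then have "2 * (v + c * L) \<le> real n * measure P (cball x r)"
    by (intro order_trans[OF b] mult_left_mono) auto
  moreover have "exp (-1::real) \<le> 1 / 2"
    using exp_ge_add_one_self[of "1::real"] by (simp add: exp_minus field_simps)
  then have "real n * measure P (cball x r) * (exp (-1) - 1) \<le> real n * measure P (cball x r) * (- (1 / 2))"
    by (intro mult_left_mono) auto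
  ultimately have mu: "real n * measure P (cball x r) * (exp (-1) - 1) \<le> - (v + c * L)" by simp
  have "(\<integral>\<^sup>+ \<omega>. ennreal (exp (v - real (ball_count n (\<lambda>i. X i \<omega>) x r))) \<partial>M)
     = (\<integral>\<^sup>+ \<omega>. ennreal (exp v) * ennreal (exp ((-1) * real (ball_count n (\<lambda>i. X i \<omega>) x r))) \<partial>M)"
    by (intro nn_integral_cong) (simp add: ennreal_mult'[symmetric] exp_add[symmetric])
  also have "\<dots> = ennreal (exp v) * (\<integral>\<^sup>+ \<omega>. ennreal (exp ((-1) * real (ball_count n (\<lambda>i. X i \<omega>) x r))) \<partial>M)"
    by (rule nn_integral_cmult) measurable
  also have "\<dots> \<le> ennreal (exp v) * ennreal (exp (real n * measure P (cball x r) * (exp (-1) - 1)))"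
    by (intro mult_left_mono count_mgf pr) simp
  also have "\<dots> = ennreal (exp (v + real n * measure P (cball x r) * (exp (-1) - 1)))"
    by (simp add: ennreal_mult'[symmetric] exp_add[symmetric])
  also have "\<dots> \<le> ennreal (exp (- c * L))"
    using mu by (intro ennreal_leI) simp
  finally show ?thesis .
qed

text \<open>
  \<open>G\<close> is a sum of exponentials whose expectations are Chernoff bounds. Where it is less than 1,
  the exponents are negative and the neighbour counts are as expected. It is infinite where
  distances are tied, so that the tie-breaking rule does not matter.
\<close>

lemma envelope:
  fixes T a C2 K1 K2 K3 s K c :: real
  assumes mass: "mass_class pmax a_min r_min a_max r_max P p"
    and pos: "0 < a_min" "0 < r_min" "0 < a_max" "0 < r_max" "0 < \<beta>" "0 < H" "0 < \<kappa>" "0 < c0" "0 < c1"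
      "0 < c2" "0 < pmax" "0 < c"
    and a: "a = rate_exp CARD('d) \<beta>"
    and s: "s = (c + 1) / c1"
    and K1: "K1 = min (r_max ^ CARD('d)) (1 / (a_max * (exp s - 1)))"
    and C2: "C2 = \<kappa> * c2 powr a * K1 powr (- a) + 3"
    and K2: "K2 = 2 * (c2 + c) / a_min" and K3: "K3 = 2 * (C2 + c) / a_min"
    and T: "1 \<le> T" "K2 / T \<le> r_min ^ CARD('d)" "K3 * T powr (a - 1) \<le> r_min ^ CARD('d)"
    and K: "K = sigma0 + 1 + c"
    and n: "1 \<le> n" "n \<le> N" "1 \<le> ln (real N)" "c0 * ln (real N) \<le> real n"
    and l: "l \<in> {1..n}" "c1 * ln (real N) \<le> real l" "real l \<le> c2 * ln (real N)"
  shows "\<exists>G :: real ^ 'd \<Rightarrow> 'w \<Rightarrow> ennreal.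
    (\<lambda>z. G (fst z) (snd z)) \<in> borel_measurable (borel \<Otimes>\<^sub>M M) \<and>
    (\<forall>x. 0 < p x \<longrightarrow> (\<integral>\<^sup>+ \<omega>. G x \<omega> \<partial>M) \<le> ennreal (5 * exp (- c * ln (real N)))) \<and>
    (\<forall>\<omega>\<in>space M. \<forall>S f x. nn_ordering n (\<lambda>i. X i \<omega>) S \<and> f \<in> holder_class \<beta> F H \<and>
       0 < p x \<and> p x \<le> pmax \<and> G x \<omega> \<noteq> \<infinity> \<longrightarrow>
       (let k = local_k CARD('d) \<beta> \<kappa> N n (nn_density l n (\<lambda>i. X i \<omega>) S x) in
         (\<Sum>i=1..k. eps (S x i) \<omega>)\<^sup>2 \<le> 16 * K\<^sup>2 / lambda0\<^sup>2 * ln (real N) * (real k + ln (real N)) * (1 + enn2real (G x \<omega>)) \<and>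
         (enn2real (G x \<omega>) < 1 \<longrightarrow>
           (\<Sum>i=1..k. (f (X (S x i) \<omega>) - f x)\<^sup>2)
             \<le> (C2 * T powr a * (4 * F\<^sup>2) + C2 * H\<^sup>2 * K3 powr (2 * \<beta> / real CARD('d))) * ln (real N) \<and>
           min 1 (ln (real N) / real k)
             \<le> (T powr a + pmax powr a * c0 powr (a - 1) + 1 / (\<kappa> * c1 powr a * K2 powr (- a)))
               * (real n * p x / ln (real N)) powr (- a))))"
proof -
  define L where "L = ln (real N)"
  define t where "t x = real n * p x / L" for x
  define r1 where "r1 x = (K1 / max 1 (t x)) powr (1 / real CARD('d))" for x
  define r2 where "r2 x = (K2 / t x) powr (1 / real CARD('d))" for x
  define r3 where "r3 x = (K3 * t x powr (a - 1)) powr (1 / real CARD('d))" for x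
  define cnt where "cnt r x \<omega> = real (ball_count n (\<lambda>i. X i \<omega>) x (r x))" for r :: "real ^ 'd \<Rightarrow> real" and x \<omega>
  define G1 where "G1 x \<omega> = ennreal (exp (s * cnt r1 x \<omega> - s * real l))" for x \<omega>
  \<comment> \<open>Lower tails are requested only above \<open>T\<close>, where \<open>r2\<close>
    and \<open>r3\<close> stay within \<open>r_min\<close>.\<close>
  define G2 where "G2 x \<omega> = (if T \<le> t x then ennreal (exp (real l - cnt r2 x \<omega>)) else 0)" for x \<omega>
  define G3 where "G3 x \<omega> = (if T \<le> t x then ennreal (exp (C2 * L * t x powr a - cnt r3 x \<omega>)) else 0)" for x \<omega>
  \<comment> \<open>The neighbour number is random, so all values of \<open>k\<close> are covered at
    once.\<close>
  define G4 where "G4 x \<omega> = (\<Sum>k=1..n. ennreal (fluct L K k x \<omega>))" for x \<omega>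
  define G5 where "G5 x \<omega> = (if tied n (\<lambda>i. X i \<omega>) x then \<infinity> else 0 :: ennreal)" for x \<omega>
  define G where "G x \<omega> = G1 x \<omega> + G2 x \<omega> + G3 x \<omega> + G4 x \<omega> + G5 x \<omega>" for x \<omega>
  have L: "1 \<le> L" using n by (simp add: L_def)
  have a01: "0 < a" "a < 1" using rate_exp_bounds[OF pos(5), of "CARD('d)"] by (simp_all add: a)
  have s0: "0 < s" using pos by (simp add: s)
  then have es: "0 < exp s - 1" by simp
  have K1p: "0 < K1" "K1 \<le> r_max ^ CARD('d)" using pos es by (auto simp: K1)
  have K1s: "a_max * K1 * (exp s - 1) \<le> 1"
  proof -
    have "K1 \<le> 1 / (a_max * (exp s - 1))" by (simp add: K1)
    then show ?thesis using pos es by (simp add: field_simps)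
  qed
  have C2p: "0 < C2" unfolding C2 using pos by (intro add_nonneg_pos mult_nonneg_nonneg) auto
  have K2p: "0 < K2" and K3p: "0 < K3" using pos C2p by (auto simp: K2 K3)
  have [measurable]: "p \<in> borel_measurable borel" and P: "P = density lborel p"
    using mass unfolding mass_class_def by blast+
  have tm[measurable]: "t \<in> borel_measurable borel" unfolding t_def by measurable
  have rm[measurable]: "r1 \<in> borel_measurable borel" "r2 \<in> borel_measurable borel" "r3 \<in> borel_measurable borel"
    unfolding r1_def r2_def r3_def by measurable
  have cm[measurable]: "(\<lambda>z. cnt r (fst z) (snd z)) \<in> borel_measurable (borel \<Otimes>\<^sub>M M)"
    if [measurable]: "r \<in> borel_measurable borel" for r
    unfolding cnt_def
    by (rule ball_count_measurable) (auto intro!: measurable_compose[OF measurable_snd X_meas])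
  have m1: "(\<lambda>z. G1 (fst z) (snd z)) \<in> borel_measurable (borel \<Otimes>\<^sub>M M)" unfolding G1_def by measurable
  have m2: "(\<lambda>z. G2 (fst z) (snd z)) \<in> borel_measurable (borel \<Otimes>\<^sub>M M)" unfolding G2_def by measurable
  have m3: "(\<lambda>z. G3 (fst z) (snd z)) \<in> borel_measurable (borel \<Otimes>\<^sub>M M)" unfolding G3_def by measurable
  have m4: "(\<lambda>z. G4 (fst z) (snd z)) \<in> borel_measurable (borel \<Otimes>\<^sub>M M)" unfolding G4_def by measurable
  have [measurable]: "Measurable.pred (borel \<Otimes>\<^sub>M M) (\<lambda>z. tied n (\<lambda>i. X i (snd z)) (fst z))"
    by (rule tied_measurable) (auto intro!: measurable_compose[OF measurable_snd X_meas])
  have m5: "(\<lambda>z. G5 (fst z) (snd z)) \<in> borel_measurable (borel \<Otimes>\<^sub>M M)" unfolding G5_def by measurable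
  note mG = m1 m2 m3 m4 m5
  have sec: "g x \<in> borel_measurable M"
    if "(\<lambda>z. g (fst z) (snd z)) \<in> borel_measurable (borel \<Otimes>\<^sub>M M)" for g :: "real ^ 'd \<Rightarrow> 'w \<Rightarrow> ennreal" and x
    using measurable_compose[OF measurable_Pair1' that, of x] by simp
  note [measurable] = mG[THEN sec]
  have r1: "0 < r1 x" "r1 x ^ CARD('d) = K1 / max 1 (t x)" for x
    using K1p unfolding r1_def by (auto intro: powr_inverse_power)
  have r2: "0 < r2 x" "r2 x ^ CARD('d) = K2 / t x" if "0 < t x" for x
    using K2p that unfolding r2_def by (auto intro: powr_inverse_power)
  have r3: "0 < r3 x" "r3 x ^ CARD('d) = K3 * t x powr (a - 1)" if "0 < t x" for x
    using K3p that unfolding r3_def by (auto intro: powr_inverse_power)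
  define e where "e = ennreal (exp (- c * L))"
  have I: "(\<integral>\<^sup>+ \<omega>. G x \<omega> \<partial>M) \<le> ennreal (5 * exp (- c * L))" if px: "0 < p x" for x
  proof -
    have t0: "0 < t x" using px n(1) L by (simp add: t_def)
    have I1: "(\<integral>\<^sup>+ \<omega>. G1 x \<omega> \<partial>M) \<le> e"
      unfolding G1_def cnt_def e_def
      by (rule few_neighbours_bound[OF mass px r1 K1p K1s])
         (use L pos s0 n(1) l(2)[folded L_def] in \<open>auto simp: t_def s\<close>)
    have I2: "(\<integral>\<^sup>+ \<omega>. G2 x \<omega> \<partial>M) \<le> e"
    proof (cases "T \<le> t x")
      case True
      have "(\<integral>\<^sup>+ \<omega>. ennreal (exp (real l - cnt r2 x \<omega>)) \<partial>M) \<le> e"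
        unfolding cnt_def e_def
      proof (rule many_neighbours_bound[OF mass r2(1)[OF t0]])
        have "K2 / t x \<le> K2 / T" using True T K2p by (intro divide_left_mono) auto
        then show "r2 x ^ CARD('d) \<le> r_min ^ CARD('d)" using T(2) by (simp add: r2[OF t0])
        \<comment> \<open>The expected count at radius \<open>r2\<close> is at least a_min K2 L = 2
          (c2 + c) L, and \<open>l\<close> is at most c2 L: this fixes \<open>K2\<close>.\<close>
        have "real n * (a_min * p x * (K2 / t x)) = a_min * K2 * L"
          using t0 px n L by (simp add: t_def)
        also have "a_min * K2 = 2 * (c2 + c)" using pos by (simp add: K2)
        also have "2 * (c2 + c) * L = 2 * (c2 * L + c * L)" by (simp add: algebra_simps)
        finally show "2 * (real l + c * L) \<le> real n * (a_min * p x * r2 x ^ CARD('d))"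
          using l(3) by (simp add: r2[OF t0] L_def)
      qed (fact pos)
      with True show ?thesis by (simp add: G2_def)
    qed (simp add: G2_def)
    have I3: "(\<integral>\<^sup>+ \<omega>. G3 x \<omega> \<partial>M) \<le> e"
    proof (cases "T \<le> t x")
      case True
      have "(\<integral>\<^sup>+ \<omega>. ennreal (exp (C2 * L * t x powr a - cnt r3 x \<omega>)) \<partial>M) \<le> e"
        unfolding cnt_def e_def
      proof (rule many_neighbours_bound[OF mass r3(1)[OF t0]])
        have "t x powr (a - 1) \<le> T powr (a - 1)"
          using True T a01 by (intro powr_mono2') auto
        then have "K3 * t x powr (a - 1) \<le> K3 * T powr (a - 1)" using K3p by (intro mult_left_mono) auto
        then show "r3 x ^ CARD('d) \<le> r_min ^ CARD('d)" using T(3) by (simp add: r3[OF t0])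
        \<comment> \<open>Since t^a is at least 1 it absorbs the deviation term c L, which is why
          \<open>K3\<close> is built from C2 + c.\<close>
        have "1 \<le> t x powr a" using True T a01 by (intro ge_one_powr_ge_zero) auto
        then have "c * L * 1 \<le> c * L * t x powr a" using pos L by (intro mult_left_mono) auto
        then have "2 * (C2 * L * t x powr a + c * L) \<le> 2 * (C2 + c) * (L * t x powr a)"
          by (simp add: algebra_simps)
        also have "\<dots> = a_min * K3 * (L * (t x * t x powr (a - 1)))"
          using pos t0 by (simp add: K3 powr_diff)
        also have "\<dots> = real n * (a_min * p x * (K3 * t x powr (a - 1)))"
          using L by (simp add: t_def)
        finally show "2 * (C2 * L * t x powr a + c * L) \<le> real n * (a_min * p x * r3 x ^ CARD('d))"
          by (simp add: r3[OF t0])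
      qed (fact pos)
      with True show ?thesis by (simp add: G3_def)
    qed (simp add: G3_def)
    have I4: "(\<integral>\<^sup>+ \<omega>. G4 x \<omega> \<partial>M) \<le> ennreal (2 * exp (- c * L))"
    proof -
      have fm: "(\<lambda>\<omega>. ennreal (fluct L K k x \<omega>)) \<in> borel_measurable M" for k
        by (rule sec[of "\<lambda>x \<omega>. ennreal (fluct L K k x \<omega>)"]) measurable
      have "(\<integral>\<^sup>+ \<omega>. G4 x \<omega> \<partial>M) = (\<Sum>k=1..n. \<integral>\<^sup>+ \<omega>. ennreal (fluct L K k x \<omega>) \<partial>M)"
        unfolding G4_def by (rule nn_integral_sum) (rule fm)
      also have "\<dots> \<le> (\<Sum>k=1..n. ennreal (2 * exp (sigma0 * L - K * L)))"
        using L by (intro sum_mono fluct_bound) auto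
      also have "\<dots> = ennreal (real n * (2 * exp (sigma0 * L - K * L)))"
        by (simp add: ennreal_mult' ennreal_of_nat_eq_real_of_nat)
      \<comment> \<open>The number of values of \<open>k\<close> is at most N = exp L; this is paid
        by the summand 1 in K = sigma0 + 1 + c.\<close>
      also have "\<dots> \<le> ennreal (exp L * (2 * exp (sigma0 * L - K * L)))"
      proof (intro ennreal_leI mult_right_mono)
        have "real n \<le> real N" using n by simp
        also have "real N = exp L" using n by (simp add: L_def)
        finally show "real n \<le> exp L" .
      qed simp
      also have "exp L * (2 * exp (sigma0 * L - K * L)) = 2 * exp (- c * L)"
        by (simp add: K algebra_simps flip: exp_add)
      finally show ?thesis .
    qed
    have I5: "(\<integral>\<^sup>+ \<omega>. G5 x \<omega> \<partial>M) = 0"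
    proof -
      have "AE \<omega> in M. G5 x \<omega> = 0"
        using AE_not_tied[OF P, of x] by (auto simp: G5_def)
      then show ?thesis by (simp add: nn_integral_0_iff_AE)
    qed
    have "(\<integral>\<^sup>+ \<omega>. G x \<omega> \<partial>M) = (\<integral>\<^sup>+ \<omega>. G1 x \<omega> \<partial>M) + (\<integral>\<^sup>+ \<omega>. G2 x \<omega> \<partial>M)
       + (\<integral>\<^sup>+ \<omega>. G3 x \<omega> \<partial>M) + (\<integral>\<^sup>+ \<omega>. G4 x \<omega> \<partial>M) + (\<integral>\<^sup>+ \<omega>. G5 x \<omega> \<partial>M)"
      unfolding G_def by (simp add: nn_integral_add)
    also have "\<dots> \<le> e + e + e + ennreal (2 * exp (- c * L)) + 0"
      using I5 by (intro add_mono I1 I2 I3 I4) auto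
    \<comment> \<open>The three counts contribute 1 each, the noise 2 and the ties nothing.\<close>
    also have "\<dots> = ennreal (5 * exp (- c * L))"
      by (simp add: e_def ennreal_plus[symmetric] del: ennreal_plus)
    finally show ?thesis .
  qed
  have pw: "(\<Sum>i=1..k. eps (S x i) \<omega>)\<^sup>2 \<le> 16 * K\<^sup>2 / lambda0\<^sup>2 * L * (real k + L) * (1 + enn2real (G x \<omega>))"
      (is ?A)
    "enn2real (G x \<omega>) < 1 \<Longrightarrow> (\<Sum>i=1..k. (f (X (S x i) \<omega>) - f x)\<^sup>2)
             \<le> (C2 * T powr a * (4 * F\<^sup>2) + C2 * H\<^sup>2 * K3 powr (2 * \<beta> / real CARD('d))) * L"
      (is "_ \<Longrightarrow> ?B")
    "enn2real (G x \<omega>) < 1 \<Longrightarrow> min 1 (L / real k)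
             \<le> (T powr a + pmax powr a * c0 powr (a - 1) + 1 / (\<kappa> * c1 powr a * K2 powr (- a))) * t x powr (- a)"
      (is "_ \<Longrightarrow> ?D")
    if S: "nn_ordering n (\<lambda>i. X i \<omega>) S" and f: "f \<in> holder_class \<beta> F H" and px: "0 < p x" "p x \<le> pmax"
      and fin: "G x \<omega> \<noteq> \<infinity>" and k: "k = local_k CARD('d) \<beta> \<kappa> N n (nn_density l n (\<lambda>i. X i \<omega>) S x)"
    for S f x \<omega> k
  proof -
    have t0: "0 < t x" using px n(1) L by (simp add: t_def)
    have nt: "\<not> tied n (\<lambda>i. X i \<omega>) x" using fin by (auto simp: G_def G5_def)
    have kn: "k \<le> n" unfolding k by (rule local_k_le)
    have below: "v \<le> enn2real (G x \<omega>)" if "ennreal v \<le> G x \<omega>" for v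
      using that fin by (cases "G x \<omega>") auto
    have K1': "1 \<le> K" using sigma0 pos by (simp add: K)
    show ?A
    \<comment> \<open>\<open>G4\<close> starts at k = 1; for k = 0 the noise sum is empty.\<close>
    proof (cases "k = 0")
      case True
      then show ?thesis using L by simp
    next
      case False
      then have kin: "k \<in> {1..n}" using kn by simp
      have "ennreal (fluct L K k x \<omega>) \<le> G4 x \<omega>"
        unfolding G4_def by (rule member_le_sum[OF kin]) auto
      also have "\<dots> \<le> G x \<omega>" by (simp add: G_def add_increasing add_increasing2)
      finally have "fluct L K k x \<omega> \<le> enn2real (G x \<omega>)" by (rule below)
      then have "16 * K\<^sup>2 / lambda0\<^sup>2 * L * (real k + L) * (1 + fluct L K k x \<omega>)
          \<le> 16 * K\<^sup>2 / lambda0\<^sup>2 * L * (real k + L) * (1 + enn2real (G x \<omega>))"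
        using L by (intro mult_left_mono) auto
      then show ?thesis using noise_sum_le[OF S nt kn L K1'] by linarith
    qed
    assume g1: "enn2real (G x \<omega>) < 1"
    have small: "v < 0" if "ennreal (exp v) \<le> G x \<omega>" for v
      using below[OF that] g1 by (meson exp_less_one_iff order_le_less_trans)
    have few: "ball_count n (\<lambda>i. X i \<omega>) x (r1 x) < l"
    proof -
      have "s * cnt r1 x \<omega> - s * real l < 0"
        by (rule small) (simp add: G_def G1_def add_increasing2)
      then show ?thesis using s0 by (simp add: cnt_def)
    qed
    have many2: "l \<le> ball_count n (\<lambda>i. X i \<omega>) x (r2 x)" if "T \<le> t x"
    proof -
      have "real l - cnt r2 x \<omega> < 0"
        by (rule small) (use that in \<open>simp add: G_def G2_def add_increasing add_increasing2\<close>)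
      then show ?thesis by (simp add: cnt_def)
    qed
    have many3: "C2 * L * t x powr a \<le> real (ball_count n (\<lambda>i. X i \<omega>) x (r3 x))" if "T \<le> t x"
    proof -
      have "C2 * L * t x powr a - cnt r3 x \<omega> < 0"
        by (rule small) (use that in \<open>simp add: G_def G3_def add_increasing add_increasing2\<close>)
      then show ?thesis by (simp add: cnt_def)
    qed
    note good = local_nn_good[OF S l(1) pos(5-11) K1p(1) K2p K3p T(1) n(2-4) l(2,3) f px _
        r1 r2[OF t0] r3[OF t0] a C2 few many2 many3[unfolded L_def] k]
    show ?B using good(1) by (simp add: L_def t_def)
    show ?D using good(2) by (simp add: L_def t_def)
  qed
  show ?thesis
  proof (intro exI[of _ G] conjI ballI allI impI)
    show "(\<lambda>z. G (fst z) (snd z)) \<in> borel_measurable (borel \<Otimes>\<^sub>M M)"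
      unfolding G_def using mG by measurable
  qed (use I pw in \<open>auto simp: L_def t_def Let_def\<close>)
qed

end

section \<open>From the model to single samples with uniform constants\<close>

text \<open>Each sample is the part of the joint family indexed by one summand of a disjoint sum.
  Independence is pulled back along the injection by carrying a finite choice of events over with
  the inverse map.\<close>

lemma (in prob_space) indep_vars_reindex_inj:
  assumes ind: "indep_vars (\<lambda>_. N) V (h ` I)" and inj: "inj_on h I"
  shows "indep_vars (\<lambda>_. N) (\<lambda>i. V (h i)) I"
proof -
  let ?F = "\<lambda>k. {V k -` A \<inter> space M |A. A \<in> sets N}"
  have rv: "\<And>i. i \<in> I \<Longrightarrow> V (h i) \<in> M \<rightarrow>\<^sub>M N" and iS: "indep_sets ?F (h ` I)"
    using ind unfolding indep_vars_def2 by auto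
  have "indep_sets (\<lambda>i. ?F (h i)) I"
  proof (rule indep_setsI)
    show "?F (h i) \<subseteq> events" if "i \<in> I" for i
      using measurable_sets[OF rv[OF that]] by auto
    fix A J assume J: "J \<noteq> {}" "J \<subseteq> I" "finite J" and A: "\<forall>j\<in>J. A j \<in> ?F (h j)"
    have injJ: "inj_on h J" using inj J(2) by (rule inj_on_subset)
    define B where "B k = A (the_inv_into J h k)" for k
    have BA: "B (h j) = A j" if "j \<in> J" for j
      using injJ that by (simp add: B_def the_inv_into_f_f)
    have "prob (\<Inter>k\<in>h ` J. B k) = (\<Prod>k\<in>h ` J. prob (B k))"
      by (rule indep_setsD[OF iS]) (use J A BA in auto)
    moreover have "(\<Inter>k\<in>h ` J. B k) = (\<Inter>j\<in>J. A j)" using BA by auto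
    moreover have "(\<Prod>k\<in>h ` J. prob (B k)) = (\<Prod>j\<in>J. prob (A j))"
      using injJ BA by (simp add: prod.reindex)
    ultimately show "prob (\<Inter>j\<in>J. A j) = (\<Prod>j\<in>J. prob (A j))" by simp
  qed
  with rv show ?thesis unfolding indep_vars_def2 by simp
qed

lemma model_samples:
  fixes P Q :: "(real ^ 'd) measure"
  assumes model: "covariate_shift_model P Q lambda0 sigma0 M n m X eps X' eps'"
    and pos: "0 < lambda0" "0 < sigma0"
  obtains \<nu> where "noisy_sample M n X eps P lambda0 sigma0 \<nu>" "noisy_sample M m X' eps' Q lambda0 sigma0 \<nu>"
proof -
  interpret prob_space M using model by (simp add: covariate_shift_model_def)
  define V where "V = case_sum (\<lambda>i \<omega>. (X i \<omega>, eps i \<omega>)) (\<lambda>j \<omega>. (X' j \<omega>, eps' j \<omega>))"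
  have ind: "indep_vars (\<lambda>_. borel) V ({1..n} <+> {1..m})"
    and src: "\<And>i. i \<in> {1..n} \<Longrightarrow> distr M borel (X i) = P \<and> indep_rvs M (X i) (eps i)"
    and tgt: "\<And>j. j \<in> {1..m} \<Longrightarrow> distr M borel (X' j) = Q \<and> indep_rvs M (X' j) (eps' j)"
    using model unfolding covariate_shift_model_def V_def by blast+
  obtain \<nu> where \<nu>: "noise_law lambda0 sigma0 \<nu>"
    "\<And>i. i \<in> {1..n} \<Longrightarrow> distr M borel (eps i) = \<nu>" "\<And>j. j \<in> {1..m} \<Longrightarrow> distr M borel (eps' j) = \<nu>"
    using model unfolding covariate_shift_model_def by blast
  have "indep_vars (\<lambda>_. borel) V (Inl ` {1..n})"
    by (rule indep_vars_subset[OF ind]) auto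
  from indep_vars_reindex_inj[OF this] have 1: "indep_vars (\<lambda>_. borel) (\<lambda>i \<omega>. (X i \<omega>, eps i \<omega>)) {1..n}"
    by (simp add: V_def)
  have "indep_vars (\<lambda>_. borel) V (Inr ` {1..m})"
    by (rule indep_vars_subset[OF ind]) auto
  from indep_vars_reindex_inj[OF this] have 2: "indep_vars (\<lambda>_. borel) (\<lambda>j \<omega>. (X' j \<omega>, eps' j \<omega>)) {1..m}"
    by (simp add: V_def)
  show ?thesis
    by (rule that; unfold_locales) (use 1 2 src tgt \<nu> pos in auto)
qed

text \<open>
  At one point: \<open>k\<close> is the number of neighbours, \<open>B\<close> the sum of the squared biases, \<open>E\<close> the sum of
  the noise terms, \<open>h\<close> the target order of \<open>L / k\<close>, and \<open>g\<close> the value of the envelope.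
\<close>

definition controlled :: "real \<Rightarrow> real \<Rightarrow> real \<Rightarrow> nat \<Rightarrow> real \<Rightarrow> real \<Rightarrow> real \<Rightarrow> bool" where
  "controlled C L h k B E g \<longleftrightarrow>
     E\<^sup>2 \<le> C * L * (real k + L) * (1 + g) \<and>
     (g < 1 \<longrightarrow> B \<le> C * L \<and> min 1 (L / real k) \<le> C * h)"

text \<open>\<open>G\<close> is fixed before the outcome, the ordering, \<open>f\<close> and the
  point, so one envelope serves every tie-breaking rule and the whole Hoelder class. One constant
  \<open>C\<close> collects all the constants of \<open>envelope\<close>.\<close>

definition is_envelope :: "'w measure \<Rightarrow> (nat \<Rightarrow> 'w \<Rightarrow> real ^ 'd) \<Rightarrow> (nat \<Rightarrow> 'w \<Rightarrow> real) \<Rightarrow> nat \<Rightarrow>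
    (real ^ 'd \<Rightarrow> real) \<Rightarrow> real \<Rightarrow> real \<Rightarrow> real \<Rightarrow> real \<Rightarrow> real \<Rightarrow> real \<Rightarrow> real \<Rightarrow> nat \<Rightarrow> nat \<Rightarrow>
    (real ^ 'd \<Rightarrow> 'w \<Rightarrow> ennreal) \<Rightarrow> bool" where
  "is_envelope M X eps n p pmax \<beta> F H \<kappa> c C N l G \<longleftrightarrow>
      (\<lambda>z. G (fst z) (snd z)) \<in> borel_measurable (borel \<Otimes>\<^sub>M M) \<and>
      (\<forall>x. 0 < p x \<longrightarrow> (\<integral>\<^sup>+ \<omega>. G x \<omega> \<partial>M) \<le> ennreal (C * exp (- c * ln (real N)))) \<and>
      (\<forall>\<omega>\<in>space M. \<forall>S f x. nn_ordering n (\<lambda>i. X i \<omega>) S \<and> f \<in> holder_class \<beta> F H \<and>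
         0 < p x \<and> p x \<le> pmax \<and> G x \<omega> \<noteq> \<infinity> \<longrightarrow>
         (let k = local_k CARD('d) \<beta> \<kappa> N n (nn_density l n (\<lambda>i. X i \<omega>) S x) in
           controlled C (ln (real N)) ((real n * p x / ln (real N)) powr (- rate_exp CARD('d) \<beta>)) k
             (\<Sum>i=1..k. (f (X (S x i) \<omega>) - f x)\<^sup>2) (\<Sum>i=1..k. eps (S x i) \<omega>) (enn2real (G x \<omega>))))"

text \<open>The order of the quantifiers is the point: \<open>C\<close> is built from the class,
  noise and tuning parameters alone and comes before the probability space, the sample,
  \<open>n\<close>, \<open>N\<close> and \<open>l\<close>.\<close>

lemma sample_envelope:
  fixes P :: "(real ^ 'd) measure" and p :: "real ^ 'd \<Rightarrow> real"
  assumes mass: "mass_class pmax a_min r_min a_max r_max P p"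
    and pos: "0 < pmax" "0 < a_min" "0 < r_min" "0 < a_max" "0 < r_max" "0 < \<beta>" "0 < H" "0 < \<kappa>"
      "0 < c0" "0 < c1" "0 < c2" "0 < c" "0 < lambda0" "0 < sigma0"
  shows "\<exists>C\<ge>1. \<forall>(M :: 'w measure) n N l X eps \<nu>.
    noisy_sample M n X eps P lambda0 sigma0 \<nu> \<and> 1 \<le> n \<and> n \<le> N \<and> 1 \<le> ln (real N) \<and> c0 * ln (real N) \<le> real n \<and>
    l \<in> {1..n} \<and> c1 * ln (real N) \<le> real l \<and> real l \<le> c2 * ln (real N) \<longrightarrow>
    (\<exists>G. is_envelope M X eps n p pmax \<beta> F H \<kappa> c C N l G)"
proof -
  define a where "a = rate_exp CARD('d) \<beta>"
  define s where "s = (c + 1) / c1"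
  define K1 where "K1 = min (r_max ^ CARD('d)) (1 / (a_max * (exp s - 1)))"
  define C2 where "C2 = \<kappa> * c2 powr a * K1 powr (- a) + 3"
  define K2 where "K2 = 2 * (c2 + c) / a_min"
  define K3 where "K3 = 2 * (C2 + c) / a_min"
  \<comment> \<open>Large enough that \<open>r2\<close> and \<open>r3\<close> do not exceed
    \<open>r_min\<close> for t \<ge> T, so that the minimal mass property applies; the exponent 1 /
    (a - 1) inverts the decreasing power t^(a - 1).\<close>
  define T where "T = max 1 (max (K2 / r_min ^ CARD('d)) ((r_min ^ CARD('d) / K3) powr (1 / (a - 1))))"
  define K where "K = sigma0 + 1 + c"
  define Ca where "Ca = 16 * K\<^sup>2 / lambda0\<^sup>2"
  define Cb where "Cb = C2 * T powr a * (4 * F\<^sup>2) + C2 * H\<^sup>2 * K3 powr (2 * \<beta> / real CARD('d))"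
  define Cc where "Cc = T powr a + pmax powr a * c0 powr (a - 1) + 1 / (\<kappa> * c1 powr a * K2 powr (- a))"
  define C where "C = 5 + Ca + Cb + Cc"
  have a01: "0 < a" "a < 1" using rate_exp_bounds[OF pos(6), of "CARD('d)"] by (simp_all add: a_def)
  have C2p: "0 < C2" unfolding C2_def using pos by (intro add_nonneg_pos mult_nonneg_nonneg) auto
  have K2p: "0 < K2" and K3p: "0 < K3" using pos C2p by (auto simp: K2_def K3_def)
  have T: "1 \<le> T" "K2 / T \<le> r_min ^ CARD('d)" "K3 * T powr (a - 1) \<le> r_min ^ CARD('d)"
  proof -
    show T1: "1 \<le> T" by (simp add: T_def)
    have "K2 / r_min ^ CARD('d) \<le> T" by (simp add: T_def)
    then show "K2 / T \<le> r_min ^ CARD('d)" using pos T1 by (simp add: field_simps)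
    have q: "0 < r_min ^ CARD('d) / K3" using pos K3p by simp
    have "(r_min ^ CARD('d) / K3) powr (1 / (a - 1)) \<le> T" by (simp add: T_def)
    then have "T powr (a - 1) \<le> ((r_min ^ CARD('d) / K3) powr (1 / (a - 1))) powr (a - 1)"
      using q a01 pos by (intro powr_mono2') auto
    also have "\<dots> = r_min ^ CARD('d) / K3" using pos K3p a01 by (simp add: powr_powr)
    finally show "K3 * T powr (a - 1) \<le> r_min ^ CARD('d)" using K3p by (simp add: field_simps)
  qed
  have nonneg: "0 \<le> Ca" "0 \<le> Cb" "0 \<le> Cc"
    unfolding Ca_def Cb_def Cc_def using pos C2p by (auto intro!: add_nonneg_nonneg mult_nonneg_nonneg)
  then have C1: "1 \<le> C" by (simp add: C_def)
  have "\<exists>G. is_envelope M X eps n p pmax \<beta> F H \<kappa> c C N l G"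
    if sample: "noisy_sample M n X eps P lambda0 sigma0 \<nu>"
      and n: "1 \<le> n" "n \<le> N" "1 \<le> ln (real N)" "c0 * ln (real N) \<le> real n"
      and l: "l \<in> {1..n}" "c1 * ln (real N) \<le> real l" "real l \<le> c2 * ln (real N)"
    for M :: "'w measure" and n N l X eps \<nu>
  proof -
    interpret noisy_sample M n X eps P lambda0 sigma0 \<nu> by fact
    obtain G :: "real ^ 'd \<Rightarrow> 'w \<Rightarrow> ennreal" where
      G: "(\<lambda>z. G (fst z) (snd z)) \<in> borel_measurable (borel \<Otimes>\<^sub>M M)"
      "\<And>x. 0 < p x \<Longrightarrow> (\<integral>\<^sup>+ \<omega>. G x \<omega> \<partial>M) \<le> ennreal (5 * exp (- c * ln (real N)))"
      and pw: "\<And>\<omega> S f x k. \<lbrakk>\<omega> \<in> space M; nn_ordering n (\<lambda>i. X i \<omega>) S; f \<in> holder_class \<beta> F H;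
        0 < p x; p x \<le> pmax; G x \<omega> \<noteq> \<infinity>; k = local_k CARD('d) \<beta> \<kappa> N n (nn_density l n (\<lambda>i. X i \<omega>) S x)\<rbrakk> \<Longrightarrow>
        (\<Sum>i=1..k. eps (S x i) \<omega>)\<^sup>2 \<le> Ca * ln (real N) * (real k + ln (real N)) * (1 + enn2real (G x \<omega>)) \<and>
        (enn2real (G x \<omega>) < 1 \<longrightarrow> (\<Sum>i=1..k. (f (X (S x i) \<omega>) - f x)\<^sup>2) \<le> Cb * ln (real N) \<and>
           min 1 (ln (real N) / real k) \<le> Cc * (real n * p x / ln (real N)) powr (- a))"
      using envelope[where F = F, OF mass pos(2-5) pos(6-11) pos(1) pos(12) a_def s_def K1_def C2_def K2_def K3_def T K_def n l]
      unfolding Ca_def[symmetric] Cb_def[symmetric] Cc_def[symmetric] Let_def by blast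
    have "controlled C (ln (real N)) ((real n * p x / ln (real N)) powr (- a)) k
             (\<Sum>i=1..k. (f (X (S x i) \<omega>) - f x)\<^sup>2) (\<Sum>i=1..k. eps (S x i) \<omega>) (enn2real (G x \<omega>))"
      if A: "\<omega> \<in> space M" "nn_ordering n (\<lambda>i. X i \<omega>) S" "f \<in> holder_class \<beta> F H" "0 < p x" "p x \<le> pmax" "G x \<omega> \<noteq> \<infinity>"
        "k = local_k CARD('d) \<beta> \<kappa> N n (nn_density l n (\<lambda>i. X i \<omega>) S x)" for \<omega> S f x k
      unfolding controlled_def
    proof (intro conjI impI)
      have le: "Ca \<le> C" "Cb \<le> C" "Cc \<le> C" using nonneg by (auto simp: C_def)
      have "(\<Sum>i=1..k. eps (S x i) \<omega>)\<^sup>2 \<le> Ca * (ln (real N) * (real k + ln (real N)) * (1 + enn2real (G x \<omega>)))"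
        using pw[OF A] by (simp add: mult.assoc)
      also have "\<dots> \<le> C * (ln (real N) * (real k + ln (real N)) * (1 + enn2real (G x \<omega>)))"
        using le n(3) by (intro mult_right_mono) auto
      finally show "(\<Sum>i=1..k. eps (S x i) \<omega>)\<^sup>2 \<le> C * ln (real N) * (real k + ln (real N)) * (1 + enn2real (G x \<omega>))"
        by (simp add: mult.assoc)
      assume g: "enn2real (G x \<omega>) < 1"
      have "Cb * ln (real N) \<le> C * ln (real N)" using le n(3) by (intro mult_right_mono) auto
      then show "(\<Sum>i=1..k. (f (X (S x i) \<omega>) - f x)\<^sup>2) \<le> C * ln (real N)"
        using pw[OF A] g by linarith
      have "Cc * (real n * p x / ln (real N)) powr (- a) \<le> C * (real n * p x / ln (real N)) powr (- a)"
        using le by (intro mult_right_mono) auto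
      then show "min 1 (ln (real N) / real k) \<le> C * (real n * p x / ln (real N)) powr (- a)"
        using pw[OF A] g by linarith
    qed
    moreover have "ennreal (5 * exp (- c * ln (real N))) \<le> ennreal (C * exp (- c * ln (real N)))"
      using nonneg by (intro ennreal_leI mult_right_mono) (auto simp: C_def)
    ultimately show ?thesis
      using G unfolding is_envelope_def a_def[symmetric] Let_def
      by (intro exI[of _ G]) (blast intro: order_trans)
  qed
  with C1 show ?thesis by blast
qed

section \<open>The squared error at one point\<close>

text \<open>If both envelopes are below 1, the bias and noise bounds are all O(L / k) with k = kP +
  kQ. Otherwise gP + gQ \<ge> 1 pays for the bounded bias, and the noise bounds carry their own
  factors 1 + g. With an empty second sample this is the one-sample case.\<close>

lemma risk_pointwise:
  fixes L C F D h gP gQ bP eP bQ eQ :: real and kP kQ :: nat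
  assumes L: "1 \<le> L" "L \<le> real kP + real kQ" and C: "1 \<le> C" "0 \<le> F" "0 \<le> D" "0 \<le> h" "0 \<le> gP" "0 \<le> gQ"
    and P: "\<bar>bP\<bar> \<le> 2 * F * real kP" "gP < 1 \<Longrightarrow> bP\<^sup>2 \<le> real kP * (C * L)"
      "eP\<^sup>2 \<le> C * L * (real kP + L) * (1 + gP)"
    and Q: "\<bar>bQ\<bar> \<le> 2 * F * real kQ" "gQ < 1 \<Longrightarrow> bQ\<^sup>2 \<le> real kQ * (C * L)"
      "eQ\<^sup>2 \<le> C * L * (real kQ + L) * (1 + gQ)"
    and good: "gP < 1 \<Longrightarrow> gQ < 1 \<Longrightarrow> L / (real kP + real kQ) \<le> D * h"
  shows "((bP + eP + (bQ + eQ)) / (real kP + real kQ))\<^sup>2 \<le> (24 * C * D + 40 * C + 32 * F\<^sup>2) * (h + gP + gQ)"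
proof -
  define k where "k = real kP + real kQ"
  define q where "q = L / k"
  have k: "0 < k" "L \<le> k" using L by (auto simp: k_def)
  have q: "0 < q" "q \<le> 1" using k L by (auto simp: q_def)
  have sq: "(bP + eP + (bQ + eQ))\<^sup>2 \<le> 4 * (bP\<^sup>2 + eP\<^sup>2 + bQ\<^sup>2 + eQ\<^sup>2)"
  proof -
    \<comment> \<open>The squares of the six pairwise differences are the exact defect in the
      Cauchy-Schwarz inequality for four terms.\<close>
    have "4 * (bP\<^sup>2 + eP\<^sup>2 + bQ\<^sup>2 + eQ\<^sup>2) - (bP + eP + (bQ + eQ))\<^sup>2
        = (bP - eP)\<^sup>2 + (bP - bQ)\<^sup>2 + (bP - eQ)\<^sup>2 + (eP - bQ)\<^sup>2 + (eP - eQ)\<^sup>2 + (bQ - eQ)\<^sup>2"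
      by (simp add: power2_eq_square algebra_simps)
    then show ?thesis by (smt (verit) zero_le_power2)
  qed
  have noise: "e\<^sup>2 / k\<^sup>2 \<le> 2 * C * q * (1 + g)"
    if "e\<^sup>2 \<le> C * L * (real kk + L) * (1 + g)" "real kk \<le> k" "0 \<le> g" for e g kk
  proof -
    have "C * L * (real kk + L) * (1 + g) \<le> C * L * (2 * k) * (1 + g)"
      using that k C L by (intro mult_right_mono mult_left_mono) auto
    with that(1) have "e\<^sup>2 \<le> C * L * (2 * k) * (1 + g)" by linarith
    then have "e\<^sup>2 / k\<^sup>2 \<le> C * L * (2 * k) * (1 + g) / k\<^sup>2" by (intro divide_right_mono) auto
    also have "\<dots> = 2 * C * q * (1 + g)" using k by (simp add: q_def power2_eq_square)
    finally show ?thesis .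
  qed
  have nP: "eP\<^sup>2 / k\<^sup>2 \<le> 2 * C * q * (1 + gP)" by (rule noise[OF P(3)]) (use C in \<open>auto simp: k_def\<close>)
  have nQ: "eQ\<^sup>2 / k\<^sup>2 \<le> 2 * C * q * (1 + gQ)" by (rule noise[OF Q(3)]) (use C in \<open>auto simp: k_def\<close>)
  have tot: "((bP + eP + (bQ + eQ)) / k)\<^sup>2 \<le> 4 * (bP\<^sup>2 / k\<^sup>2 + eP\<^sup>2 / k\<^sup>2 + bQ\<^sup>2 / k\<^sup>2 + eQ\<^sup>2 / k\<^sup>2)"
    using divide_right_mono[OF sq, of "k\<^sup>2"] unfolding power_divide by (simp add: add_divide_distrib)
  have g0: "0 \<le> gP + gQ" using C by simp
  have nonneg: "0 \<le> 24 * C * D * (gP + gQ)" "0 \<le> (40 * C + 32 * F\<^sup>2) * h" "0 \<le> 32 * F\<^sup>2 * (gP + gQ)" "0 \<le> 24 * C * D * h"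
    "0 \<le> C * (gP + gQ)"
    using C by auto
  have Cq: "C * q * (gP + gQ) \<le> C * (gP + gQ)"
    using q C g0 mult_right_mono[of "C * q" C "gP + gQ"] mult_left_mono[of q 1 C] by simp
  have noise2: "eP\<^sup>2 / k\<^sup>2 + eQ\<^sup>2 / k\<^sup>2 \<le> 4 * (C * q) + 2 * (C * (gP + gQ))"
  proof -
    have "2 * C * q * (1 + gP) + 2 * C * q * (1 + gQ) = 4 * (C * q) + 2 * (C * q * (gP + gQ))"
      by (simp add: algebra_simps)
    then show ?thesis using nP nQ Cq by linarith
  qed
  show ?thesis
  proof (cases "gP < 1 \<and> gQ < 1")
    case True
    have b: "b\<^sup>2 / k\<^sup>2 \<le> C * q * (real kk / k)" if "b\<^sup>2 \<le> real kk * (C * L)" for b kk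
    proof -
      have "b\<^sup>2 / k\<^sup>2 \<le> real kk * (C * L) / k\<^sup>2" using that by (intro divide_right_mono) auto
      also have "\<dots> = C * q * (real kk / k)" by (simp add: q_def power2_eq_square)
      finally show ?thesis .
    qed
    have "bP\<^sup>2 / k\<^sup>2 + bQ\<^sup>2 / k\<^sup>2 \<le> C * q * (real kP / k) + C * q * (real kQ / k)"
      using b[OF P(2)] b[OF Q(2)] True by simp
    also have "\<dots> = C * q * (real kP / k + real kQ / k)" by (simp add: algebra_simps)
    \<comment> \<open>The squared biases enter weighted by the shares of the two samples, which add
      up to 1.\<close>
    also have "real kP / k + real kQ / k = 1" using k by (simp add: k_def flip: add_divide_distrib)
    finally have bias: "bP\<^sup>2 / k\<^sup>2 + bQ\<^sup>2 / k\<^sup>2 \<le> C * q" by simp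
    have "q \<le> D * h" using good True by (simp add: q_def k_def)
    then have "C * q \<le> C * (D * h)" using C by (intro mult_left_mono) auto
    \<comment> \<open>Linear arithmetic over abstract reals, so that quotients and products act as
      single variables; 20 = 4 (1 + 4) combines bias and noise.\<close>
    moreover have "4 * (v + x + w + y) \<le> 20 * t + 8 * z"
      if "u \<le> t" "v + w \<le> u" "x + y \<le> 4 * u + 2 * z" for t u v w x y z :: real
      using that unfolding distrib_left by linarith
    ultimately have "4 * (bP\<^sup>2 / k\<^sup>2 + eP\<^sup>2 / k\<^sup>2 + bQ\<^sup>2 / k\<^sup>2 + eQ\<^sup>2 / k\<^sup>2)
        \<le> 20 * (C * (D * h)) + 8 * (C * (gP + gQ))"
      using bias noise2 by blast
    also have "\<dots> \<le> (24 * C * D + 40 * C + 32 * F\<^sup>2) * (h + gP + gQ)"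
      using nonneg by (simp add: algebra_simps)
    finally show ?thesis using tot by (simp add: k_def)
  next
    case False
    then have g1: "1 \<le> gP + gQ" using C by linarith
    have b: "b\<^sup>2 / k\<^sup>2 \<le> 4 * F\<^sup>2" if "\<bar>b\<bar> \<le> 2 * F * real kk" "real kk \<le> k" for b kk
    proof -
      have "\<bar>b\<bar> \<le> 2 * F * k" using that mult_left_mono[OF that(2), of "2 * F"] C by simp
      then have "\<bar>b\<bar>\<^sup>2 \<le> (2 * F * k)\<^sup>2" by (intro power_mono) auto
      then show ?thesis using k by (simp add: power_mult_distrib field_simps)
    qed
    have "bP\<^sup>2 / k\<^sup>2 + bQ\<^sup>2 / k\<^sup>2 \<le> 8 * F\<^sup>2"
      using b[OF P(1)] b[OF Q(1)] by (simp add: k_def)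
    moreover have "C * q \<le> C * 1" using q C by (intro mult_left_mono) auto
    moreover have "4 * (v + x + w + y) \<le> (32 * u + 16 * t) * 1 + 8 * z"
      if "v + w \<le> 8 * u" "r \<le> t * 1" "x + y \<le> 4 * r + 2 * z" for r t u v w x y z :: real
      using that unfolding distrib_left distrib_right by linarith
    ultimately have "4 * (bP\<^sup>2 / k\<^sup>2 + eP\<^sup>2 / k\<^sup>2 + bQ\<^sup>2 / k\<^sup>2 + eQ\<^sup>2 / k\<^sup>2)
        \<le> (32 * F\<^sup>2 + 16 * C) * 1 + 8 * (C * (gP + gQ))"
      using noise2 by blast
    also have "(32 * F\<^sup>2 + 16 * C) * 1 \<le> (32 * F\<^sup>2 + 16 * C) * (gP + gQ)"
      using g1 C by (intro mult_left_mono) auto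
    also have "(32 * F\<^sup>2 + 16 * C) * (gP + gQ) + 8 * (C * (gP + gQ))
        \<le> (24 * C * D + 40 * C + 32 * F\<^sup>2) * (h + gP + gQ)"
      using nonneg by (simp add: algebra_simps)
    finally show ?thesis using tot by (simp add: k_def)
  qed
qed

section \<open>Integration against the target law\<close>

text \<open>Exchanging the integrals bounds the mean of the random integral of \<open>G\<close> by
  \<open>e\<close>, and Markov at level \<open>\<delta>\<close> gives the event. A bound for almost
  every fixed point becomes an integrated bound on one event, with no supremum over points.\<close>

lemma markov_section:
  fixes Q :: "(real ^ 'd) measure" and G :: "real ^ 'd \<Rightarrow> 'w \<Rightarrow> ennreal"
  assumes M: "prob_space M" and Q: "prob_space Q" "sets Q = sets borel"
    and G: "(\<lambda>z. G (fst z) (snd z)) \<in> borel_measurable (borel \<Otimes>\<^sub>M M)"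
    and e: "AE x in Q. (\<integral>\<^sup>+ \<omega>. G x \<omega> \<partial>M) \<le> ennreal e" and pos: "0 \<le> e" "0 < \<delta>"
  shows "\<exists>A\<in>sets M. 1 - e / \<delta> \<le> measure M A \<and> (\<forall>\<omega>\<in>A. (\<integral>\<^sup>+ x. G x \<omega> \<partial>Q) \<le> ennreal \<delta>)"
proof -
  interpret M: prob_space M by fact
  interpret Q: prob_space Q by fact
  interpret QM: pair_sigma_finite Q M ..
  have GQ: "(\<lambda>z. G (fst z) (snd z)) \<in> borel_measurable (Q \<Otimes>\<^sub>M M)"
    using G measurable_cong_sets[OF sets_pair_measure_cong[OF Q(2) refl] refl] by blast
  define \<Phi> where "\<Phi> \<omega> = (\<integral>\<^sup>+ x. G x \<omega> \<partial>Q)" for \<omega>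
  have \<Phi>m[measurable]: "\<Phi> \<in> borel_measurable M"
    unfolding \<Phi>_def
  proof (rule Q.borel_measurable_nn_integral)
    have "(\<lambda>z. G (fst z) (snd z)) \<circ> (\<lambda>(\<omega>, x). (x, \<omega>)) \<in> borel_measurable (M \<Otimes>\<^sub>M Q)"
      by (rule measurable_comp[OF measurable_pair_swap' GQ])
    then show "(\<lambda>(\<omega>, x). G x \<omega>) \<in> borel_measurable (M \<Otimes>\<^sub>M Q)"
      by (simp add: comp_def case_prod_unfold)
  qed
  have "(\<integral>\<^sup>+ \<omega>. \<Phi> \<omega> \<partial>M) = (\<integral>\<^sup>+ x. \<integral>\<^sup>+ \<omega>. G x \<omega> \<partial>M \<partial>Q)"
    unfolding \<Phi>_def using GQ by (intro QM.Fubini') (simp add: case_prod_unfold)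
  also have "\<dots> \<le> (\<integral>\<^sup>+ x. ennreal e \<partial>Q)" by (intro nn_integral_mono_AE e)
  also have "\<dots> = ennreal e" by (simp add: Q.emeasure_space_1)
  finally have I: "(\<integral>\<^sup>+ \<omega>. \<Phi> \<omega> \<partial>M) \<le> ennreal e" .
  define A where "A = {\<omega>\<in>space M. \<Phi> \<omega> \<le> ennreal \<delta>}"
  have A[measurable]: "A \<in> sets M" unfolding A_def by measurable
  have "space M - A \<subseteq> {\<omega>\<in>space M. 1 \<le> ennreal (1 / \<delta>) * \<Phi> \<omega>}"
  proof
    fix \<omega> assume \<omega>: "\<omega> \<in> space M - A"
    then have "ennreal \<delta> \<le> \<Phi> \<omega>" by (auto simp: A_def)
    then have "ennreal (1 / \<delta>) * ennreal \<delta> \<le> ennreal (1 / \<delta>) * \<Phi> \<omega>" by (rule mult_left_mono) simp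
    moreover have "ennreal (1 / \<delta>) * ennreal \<delta> = 1" using pos by (simp flip: ennreal_mult')
    ultimately show "\<omega> \<in> {\<omega>\<in>space M. 1 \<le> ennreal (1 / \<delta>) * \<Phi> \<omega>}" using \<omega> by simp
  qed
  then have "emeasure M (space M - A) \<le> emeasure M {\<omega>\<in>space M. 1 \<le> ennreal (1 / \<delta>) * \<Phi> \<omega>}"
    by (intro emeasure_mono) measurable
  also have "\<dots> \<le> ennreal (1 / \<delta>) * (\<integral>\<^sup>+ \<omega>. \<Phi> \<omega> * indicator (space M) \<omega> \<partial>M)"
    by (intro nn_integral_Markov_inequality) measurable
  also have "(\<integral>\<^sup>+ \<omega>. \<Phi> \<omega> * indicator (space M) \<omega> \<partial>M) = (\<integral>\<^sup>+ \<omega>. \<Phi> \<omega> \<partial>M)"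
    by (intro nn_integral_cong) simp
  also have "ennreal (1 / \<delta>) * \<dots> \<le> ennreal (1 / \<delta>) * ennreal e"
    by (intro mult_left_mono I) simp
  also have "\<dots> = ennreal (e / \<delta>)" using pos by (simp flip: ennreal_mult')
  finally have "measure M (space M - A) \<le> e / \<delta>"
    using pos by (simp add: M.emeasure_eq_measure)
  then have "1 - e / \<delta> \<le> measure M A"
    using M.prob_compl[OF A] by simp
  then show ?thesis
    using A by (intro bexI[of _ A]) (auto simp: A_def \<Phi>_def)
qed

text \<open>Lowering the exponent is harmless: for t \<ge> 1 the power only grows, and for t < 1 the
  new power is at least 1. This is how a minimum of two exponents arises in both rates.\<close>

lemma min_powr_le:
  fixes t r a :: real
  assumes "0 < t" "0 \<le> r" "r \<le> a"
  shows "min 1 (t powr (- a)) \<le> t powr (- r)"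
proof (cases "1 \<le> t")
  case True
  then have "t powr (- a) \<le> t powr (- r)" using assms by (intro powr_mono) auto
  then show ?thesis by simp
next
  case False
  then have "t powr r \<le> 1" using assms powr_mono2[of r t 1] by simp
  then have "1 \<le> t powr (- r)" using assms by (simp add: powr_minus field_simps)
  then show ?thesis by simp
qed

text \<open>The ratio integrand is infinite where p = 0 < q, so finiteness of its integral forces p
  > 0 almost everywhere under \<open>Q\<close>; this keeps the scale t positive.\<close>

lemma target_AE:
  fixes P Q :: "(real ^ 'd) measure"
  assumes P: "mass_class pmax a_min r_min a_max r_max P p"
    and Q: "target_class pmax a_min r_min a_max r_max p \<gamma> \<rho> Q q"
  shows "AE x in Q. 0 < p x \<and> p x \<le> pmax \<and> 0 < q x \<and> q x \<le> pmax"
proof -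
  have [measurable]: "p \<in> borel_measurable borel" "q \<in> borel_measurable borel"
    and Qq: "Q = density lborel q" and p0: "\<And>x. 0 \<le> p x"
    and Pp: "AE x in lborel. p x \<le> pmax" and Qp: "AE x in lborel. q x \<le> pmax"
    using P Q unfolding target_class_def mass_class_def by blast+
  have [measurable]: "(\<lambda>x. density_ratio_integrand \<gamma> (p x) (q x)) \<in> borel_measurable lborel"
    unfolding density_ratio_integrand_def by measurable
  have "(\<integral>\<^sup>+ x. density_ratio_integrand \<gamma> (p x) (q x) \<partial>lborel) \<noteq> \<infinity>"
    using Q by (auto simp: target_class_def)
  then have "AE x in lborel. density_ratio_integrand \<gamma> (p x) (q x) \<noteq> \<infinity>"
    by (intro nn_integral_PInf_AE) auto
  with Pp Qp have "AE x in lborel. 0 < ennreal (q x) \<longrightarrow> 0 < p x \<and> p x \<le> pmax \<and> 0 < q x \<and> q x \<le> pmax"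
  proof eventually_elim
    case (elim x)
    then show ?case using p0[of x] by (auto simp: density_ratio_integrand_def split: if_splits)
  qed
  then show ?thesis unfolding Qq by (subst AE_density) auto
qed

text \<open>With the exponent lowered to \<open>r\<close> the integrand is (L / n)^r q p^(-r), and
  p^(-r) = p^(\<gamma> - r) / p^\<gamma> with p^(\<gamma> - r) \<le> pmax^(\<gamma> - r). What
  remains is the integral of the density ratio.\<close>

lemma source_rate_integral:
  fixes P Q :: "(real ^ 'd) measure"
  assumes P: "mass_class pmax a_min r_min a_max r_max P p"
    and Q: "target_class pmax a_min r_min a_max r_max p \<gamma> \<rho> Q q"
    and r: "0 \<le> r" "r \<le> a" "r \<le> \<gamma>" and pmax: "0 < pmax"
  shows "\<exists>A\<ge>0. \<forall>n L :: real. 0 < n \<and> 0 < L \<longrightarrow>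
    (\<integral>\<^sup>+ x. ennreal (min 1 ((n * p x / L) powr (- a))) \<partial>Q) \<le> ennreal (A * (L / n) powr r)"
proof -
  define I where "I = (\<integral>\<^sup>+ x. density_ratio_integrand \<gamma> (p x) (q x) \<partial>lborel)"
  have I: "I < \<infinity>" using Q by (simp add: target_class_def I_def)
  have [measurable]: "p \<in> borel_measurable borel" "q \<in> borel_measurable borel"
    and Qq: "Q = density lborel q" and p0: "\<And>x. 0 \<le> p x" and q0: "\<And>x. 0 \<le> q x"
    and Pp: "AE x in lborel. p x \<le> pmax"
    using P Q unfolding target_class_def mass_class_def by blast+
  have [measurable]: "(\<lambda>x. density_ratio_integrand \<gamma> (p x) (q x)) \<in> borel_measurable lborel"
    unfolding density_ratio_integrand_def by measurable
  have "(\<integral>\<^sup>+ x. ennreal (min 1 ((n * p x / L) powr (- a))) \<partial>Q) \<le> ennreal ((pmax powr (\<gamma> - r) * enn2real I) * (L / n) powr r)"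
    if nL: "0 < n" "0 < L" for n L
  proof -
    define c where "c = (L / n) powr r * pmax powr (\<gamma> - r)"
    have c: "0 < c" using nL pmax by (simp add: c_def)
    have "(\<integral>\<^sup>+ x. ennreal (min 1 ((n * p x / L) powr (- a))) \<partial>Q)
        = (\<integral>\<^sup>+ x. ennreal (q x) * ennreal (min 1 ((n * p x / L) powr (- a))) \<partial>lborel)"
      unfolding Qq by (rule nn_integral_density) auto
    also have "\<dots> \<le> (\<integral>\<^sup>+ x. ennreal c * density_ratio_integrand \<gamma> (p x) (q x) \<partial>lborel)"
    proof (rule nn_integral_mono_AE, use Pp in eventually_elim)
      case (elim x)
      consider "q x = 0" | "q x \<noteq> 0" "p x = 0" | "0 < q x" "0 < p x"
        using p0[of x] q0[of x] by (cases "p x = 0"; cases "q x = 0") (auto simp: less_le)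
      then show ?case
      proof cases
        case 3
        have "min 1 ((n * p x / L) powr (- a)) \<le> (n * p x / L) powr (- r)"
          using nL 3 r by (intro min_powr_le) auto
        also have "(n * p x / L) powr (- r) = (L / n) powr r * p x powr (- r)"
        proof -
          have "n * p x / L = p x / (L / n)" using nL by simp
          also have "\<dots> powr (- r) = (L / n) powr r * p x powr (- r)"
            using nL 3 by (subst powr_divide) (auto simp: powr_minus field_simps)
          finally show ?thesis .
        qed
        also have "p x powr (- r) = p x powr (\<gamma> - r) / p x powr \<gamma>"
          using 3 by (simp flip: powr_diff)
        also have "p x powr (\<gamma> - r) \<le> pmax powr (\<gamma> - r)"
          using 3 elim r by (intro powr_mono2) auto
        finally have "min 1 ((n * p x / L) powr (- a)) \<le> (L / n) powr r * (pmax powr (\<gamma> - r) / p x powr \<gamma>)"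
          using nL 3 by (simp add: divide_right_mono mult_left_mono)
        then have "q x * min 1 ((n * p x / L) powr (- a)) \<le> q x * ((L / n) powr r * (pmax powr (\<gamma> - r) / p x powr \<gamma>))"
          using 3 by (intro mult_left_mono) auto
        also have "\<dots> = c * (q x / p x powr \<gamma>)" by (simp add: c_def)
        finally have "ennreal (q x * min 1 ((n * p x / L) powr (- a))) \<le> ennreal (c * (q x / p x powr \<gamma>))"
          by (rule ennreal_leI)
        then show ?thesis using 3 c by (simp add: density_ratio_integrand_def ennreal_mult' del: times_divide_eq_right)
      \<comment> \<open>Where q = 0 the left side vanishes; where p = 0 < q the right side is
        infinite.\<close>
      qed (use c in \<open>auto simp: density_ratio_integrand_def ennreal_mult_top\<close>)
    qed
    also have "\<dots> = ennreal c * I" unfolding I_def by (rule nn_integral_cmult) measurable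
    also have "\<dots> = ennreal (c * enn2real I)" using I c by (simp add: ennreal_mult' less_top)
    finally show ?thesis by (simp add: c_def mult_ac)
  qed
  then show ?thesis by (intro exI[of _ "pmax powr (\<gamma> - r) * enn2real I"]) auto
qed

text \<open>Here \<open>q\<close> is its own weight: q q^(-r) = q^(1 - r - e) q^e with e = d /
  (\<rho> + d). The condition r \<le> \<rho> / (\<rho> + d) = 1 - e makes the first exponent
  nonnegative, so that factor is bounded and the second is integrable.\<close>

lemma target_rate_integral:
  fixes Q :: "(real ^ 'd) measure"
  assumes Q: "target_class pmax a_min r_min a_max r_max p \<gamma> \<rho> Q q"
    and r: "0 \<le> r" "r \<le> a" "r \<le> \<rho> / (\<rho> + real CARD('d))" and pos: "0 < pmax" "0 < \<rho>"
  shows "\<exists>A\<ge>0. \<forall>n L :: real. 0 < n \<and> 0 < L \<longrightarrow>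
    (\<integral>\<^sup>+ x. ennreal (min 1 ((n * q x / L) powr (- a))) \<partial>Q) \<le> ennreal (A * (L / n) powr r)"
proof -
  define e where "e = real CARD('d) / (\<rho> + real CARD('d))"
  define I where "I = (\<integral>\<^sup>+ x. ennreal (q x powr e) \<partial>lborel)"
  have I: "I < \<infinity>" using Q by (simp add: target_class_def I_def e_def)
  have er: "e \<le> 1 - r"
  proof -
    have "e = 1 - \<rho> / (\<rho> + real CARD('d))" using pos by (simp add: e_def field_simps add_pos_pos)
    then show ?thesis using r by simp
  qed
  have [measurable]: "q \<in> borel_measurable borel"
    and Qq: "Q = density lborel q" and q0: "\<And>x. 0 \<le> q x"
    and Qp: "AE x in lborel. q x \<le> pmax"
    using Q unfolding target_class_def mass_class_def by blast+
  have "(\<integral>\<^sup>+ x. ennreal (min 1 ((n * q x / L) powr (- a))) \<partial>Q) \<le> ennreal ((pmax powr (1 - r - e) * enn2real I) * (L / n) powr r)"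
    if nL: "0 < n" "0 < L" for n L
  proof -
    define c where "c = (L / n) powr r * pmax powr (1 - r - e)"
    have c: "0 < c" using nL pos by (simp add: c_def)
    have "(\<integral>\<^sup>+ x. ennreal (min 1 ((n * q x / L) powr (- a))) \<partial>Q)
        = (\<integral>\<^sup>+ x. ennreal (q x) * ennreal (min 1 ((n * q x / L) powr (- a))) \<partial>lborel)"
      unfolding Qq by (rule nn_integral_density) auto
    also have "\<dots> \<le> (\<integral>\<^sup>+ x. ennreal c * ennreal (q x powr e) \<partial>lborel)"
    proof (rule nn_integral_mono_AE, use Qp in eventually_elim)
      case (elim x)
      show ?case
      proof (cases "q x = 0")
        case False
        then have qx: "0 < q x" using q0[of x] by simp
        have "min 1 ((n * q x / L) powr (- a)) \<le> (n * q x / L) powr (- r)"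
          using nL qx r by (intro min_powr_le) auto
        also have "(n * q x / L) powr (- r) = (L / n) powr r * q x powr (- r)"
        proof -
          have "n * q x / L = q x / (L / n)" using nL by simp
          also have "\<dots> powr (- r) = (L / n) powr r * q x powr (- r)"
            using nL qx by (subst powr_divide) (auto simp: powr_minus field_simps)
          finally show ?thesis .
        qed
        finally have "q x * min 1 ((n * q x / L) powr (- a)) \<le> q x * ((L / n) powr r * q x powr (- r))"
          using qx by (intro mult_left_mono) auto
        also have "\<dots> = (L / n) powr r * (q x powr 1 * q x powr (- r))" using qx by simp
        also have "q x powr 1 * q x powr (- r) = q x powr (1 - r - e) * q x powr e"
          by (simp only: powr_add[symmetric]) simp
        also have "(L / n) powr r * (q x powr (1 - r - e) * q x powr e) \<le> (L / n) powr r * (pmax powr (1 - r - e) * q x powr e)"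
          using qx elim er by (intro mult_left_mono mult_right_mono powr_mono2) auto
        also have "\<dots> = c * q x powr e" by (simp add: c_def)
        finally have "ennreal (q x * min 1 ((n * q x / L) powr (- a))) \<le> ennreal (c * q x powr e)"
          by (rule ennreal_leI)
        then show ?thesis using qx c by (simp add: ennreal_mult')
      qed simp
    qed
    also have "\<dots> = ennreal c * I" unfolding I_def by (rule nn_integral_cmult) measurable
    also have "\<dots> = ennreal (c * enn2real I)" using I c by (simp add: ennreal_mult' less_top)
    finally show ?thesis by (simp add: c_def mult_ac)
  qed
  then show ?thesis by (intro exI[of _ "pmax powr (1 - r - e) * enn2real I"]) auto
qed

section \<open>Comparison of logarithms and of rates\<close>

lemma ln_ge_one: "3 \<le> n \<Longrightarrow> 1 \<le> ln (real n)"
  using exp_le ln_ge_iff[of "real n" 1] by (simp add: order_trans[OF exp_le])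

text \<open>
  Replacing \<open>ln n\<close> and \<open>ln m\<close> by \<open>ln (n + m)\<close>. If \<open>n\<close> is so much smaller than \<open>m\<close> that \<open>ln n\<close> is
  not comparable to \<open>ln m\<close>, the first rate is dominated by the second one.
\<close>

lemma rate_sum_le_ordered:
  fixes r s :: real
  assumes r: "0 < r" "r \<le> 1" and s: "0 < s" "s \<le> 1"
    and nm: "3 \<le> n" "n \<le> m"
  defines "L \<equiv> ln (real (n + m))" and "\<theta> \<equiv> min 1 (s / (2 * r))"
  shows "(real n / ln (real n)) powr r + (real m / ln (real m)) powr s
    \<le> (6 + 2 / \<theta>) * ((real n / L) powr r + (real m / L) powr s)"
proof -
  \<comment> \<open>\<open>\<theta>\<close> separates the cases: if ln n < \<theta> ln m, the choice
    s / (2 r) gives n^r \<le> m^(s / 2), which is within a constant of the second rate.\<close>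
  have th: "0 < \<theta>" "\<theta> \<le> 1" using r s by (auto simp: \<theta>_def)
  have lnn: "1 \<le> ln (real n)" and lnm: "1 \<le> ln (real m)" using nm by (auto intro: ln_ge_one)
  \<comment> \<open>As \<open>m\<close> is the larger size, n + m \<le> 2 m \<le> m^2, which makes
    ln (n + m) and ln m comparable.\<close>
  have L2: "L \<le> 2 * ln (real m)"
  proof -
    have "n + m \<le> 2 * m" "2 * m \<le> m * m" using nm by simp_all
    then have "n + m \<le> m * m" by (rule order_trans)
    then have "real (n + m) \<le> real (m * m)" by (rule of_nat_mono)
    then have "real (n + m) \<le> real m * real m" by (simp only: of_nat_mult)
    then have "L \<le> ln (real m * real m)" unfolding L_def using nm by (intro ln_mono) auto
    also have "\<dots> = 2 * ln (real m)" using nm by (simp add: ln_mult)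
    finally show ?thesis .
  qed
  have L1: "1 \<le> L" unfolding L_def using nm by (intro ln_ge_one) auto
  have sub: "(c * y) powr z \<le> c * y powr z" if "1 \<le> c" "0 \<le> y" "0 < z" "z \<le> 1" for c y z :: real
  proof -
    have "(c * y) powr z = c powr z * y powr z" using that by (simp add: powr_mult)
    also have "c powr z \<le> c powr 1" using that by (intro powr_mono) auto
    finally show ?thesis using that by (simp add: mult_right_mono)
  qed
  have V: "(real m / ln (real m)) powr s \<le> 2 * (real m / L) powr s"
  proof -
    have "real m / ln (real m) \<le> 2 * (real m / L)" using L2 L1 lnm nm by (simp add: field_simps)
    then have "(real m / ln (real m)) powr s \<le> (2 * (real m / L)) powr s"
      using s lnm by (intro powr_mono2) auto
    also have "\<dots> \<le> 2 * (real m / L) powr s" using s L1 by (intro sub) auto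
    finally show ?thesis .
  qed
  have X0: "0 \<le> (real n / L) powr r" "0 \<le> (real m / L) powr s" by auto
  have U: "(real n / ln (real n)) powr r \<le> 4 * (real m / L) powr s + 2 / \<theta> * (real n / L) powr r"
  proof (cases "\<theta> * ln (real m) \<le> ln (real n)")
    case True
    have "\<theta> * L \<le> \<theta> * (2 * ln (real m))" using th L2 by (intro mult_left_mono) auto
    with True have "\<theta> * L \<le> 2 * ln (real n)" by linarith
    then have "real n / ln (real n) \<le> 2 / \<theta> * (real n / L)" using th L1 lnn nm by (simp add: field_simps)
    then have "(real n / ln (real n)) powr r \<le> (2 / \<theta> * (real n / L)) powr r"
      using r lnn by (intro powr_mono2) auto
    also have "\<dots> \<le> 2 / \<theta> * (real n / L) powr r" using r L1 th by (intro sub) (auto simp: field_simps)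
    finally show ?thesis using X0 by linarith
  next
    case False
    have "\<theta> * ln (real m) * r \<le> s / 2 * ln (real m)"
      using r lnm mult_right_mono[of \<theta> "s / (2 * r)" "ln (real m) * r"] by (simp add: \<theta>_def)
    moreover have "ln (real n) * r \<le> \<theta> * ln (real m) * r" using False r by (intro mult_right_mono) auto
    ultimately have e: "r * ln (real n) \<le> s * (ln (real m) / 2)" by (simp add: algebra_simps)
    have "real n / ln (real n) \<le> real n" 
      using lnn mult_left_mono[of 1 "ln (real n)" "real n"] by (simp add: divide_le_eq)
    then have "(real n / ln (real n)) powr r \<le> real n powr r" using r lnn by (intro powr_mono2) auto
    also have "real n powr r = exp (r * ln (real n))" using nm by (simp add: powr_def)
    also have "\<dots> \<le> exp (s * (ln (real m) / 2))" using e by simp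
    also have "\<dots> = sqrt (real m) powr s" using nm by (simp add: powr_def ln_sqrt)
    \<comment> \<open>From ln (sqrt m) \<le> sqrt m follows L \<le> 2 ln m \<le> 4 sqrt m.\<close>
    also have "\<dots> \<le> (4 * (real m / L)) powr s"
    proof (intro powr_mono2)
      have "ln (sqrt (real m)) \<le> sqrt (real m)" using nm by (intro ln_bound) simp
      then have "L \<le> 4 * sqrt (real m)" using L2 nm by (simp add: ln_sqrt)
      then have "sqrt (real m) * L \<le> sqrt (real m) * (4 * sqrt (real m))" by (intro mult_left_mono) auto
      also have "\<dots> = 4 * real m" by simp
      finally show "sqrt (real m) \<le> 4 * (real m / L)" using L1 by (simp add: field_simps)
    qed (use s in auto)
    also have "\<dots> \<le> 4 * (real m / L) powr s" using s L1 by (intro sub) auto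
    finally show ?thesis using X0 th by (simp add: add_increasing2)
  qed
  have "0 \<le> 6 * (real n / L) powr r" "0 \<le> 2 / \<theta> * (real m / L) powr s" using th by auto
  with U V X0 show ?thesis unfolding distrib_left distrib_right by linarith
qed

text \<open>A minimum of reciprocals is the reciprocal of the maximum, which is within a factor 2 of
  the reciprocal of the sum. The comparison of logarithms is applied with the roles of the samples
  exchanged if \<open>n\<close> exceeds \<open>m\<close>.\<close>

lemma rate_conversion:
  fixes r s :: real
  assumes r: "0 < r" "r \<le> 1" and s: "0 < s" "s \<le> 1"
  shows "\<exists>D>0. \<forall>n m :: nat. 3 \<le> n \<and> 3 \<le> m \<longrightarrow>
    min ((ln (real (n + m)) / real n) powr r) ((ln (real (n + m)) / real m) powr s)
      \<le> D * inverse ((real n / ln (real n)) powr r + (real m / ln (real m)) powr s)"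
proof -
  define D1 where "D1 = 6 + 2 / min 1 (s / (2 * r))"
  define D2 where "D2 = 6 + 2 / min 1 (r / (2 * s))"
  define D where "D = D1 + D2"
  have D12: "0 < D1" "0 < D2" using r s by (auto simp: D1_def D2_def add_pos_pos)
  have "min ((ln (real (n + m)) / real n) powr r) ((ln (real (n + m)) / real m) powr s)
      \<le> 2 * D * inverse ((real n / ln (real n)) powr r + (real m / ln (real m)) powr s)"
    if nm: "3 \<le> n" "3 \<le> m" for n m :: nat
  proof -
    define L where "L = ln (real (n + m))"
    define x y where "x = (real n / L) powr r" and "y = (real m / L) powr s"
    define W where "W = (real n / ln (real n)) powr r + (real m / ln (real m)) powr s"
    have L1: "1 \<le> L" unfolding L_def using nm by (intro ln_ge_one) auto
    have xy: "0 < x" "0 < y" using L1 nm by (auto simp: x_def y_def)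
    have W: "0 < W" unfolding W_def using nm ln_ge_one[of n] ln_ge_one[of m] by (intro add_pos_pos) auto
    have "W \<le> D * (x + y)"
    proof (cases "n \<le> m")
      case True
      have "W \<le> D1 * (x + y)"
        using rate_sum_le_ordered[OF r s nm(1) True] by (simp add: W_def D1_def x_def y_def L_def)
      also have "\<dots> \<le> D * (x + y)" using D12 xy by (intro mult_right_mono) (auto simp: D_def)
      finally show ?thesis .
    next
      case False
      have "W \<le> D2 * (x + y)"
        using rate_sum_le_ordered[OF s r nm(2), of n] False by (simp add: W_def D2_def x_def y_def L_def add.commute)
      also have "\<dots> \<le> D * (x + y)" using D12 xy by (intro mult_right_mono) (auto simp: D_def)
      finally show ?thesis .
    qed
    also have "\<dots> \<le> D * (2 * max x y)" using D12 by (intro mult_left_mono) (auto simp: D_def)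
    finally have Wm: "W \<le> 2 * D * max x y" by simp
    have "min (inverse x) (inverse y) = inverse (max x y)"
      using xy by (simp add: min_def max_def)
    also have "\<dots> \<le> 2 * D * inverse W" using Wm W xy by (simp add: field_simps less_max_iff_disj)
    finally have "min (inverse x) (inverse y) \<le> 2 * D * inverse W" .
    moreover have "inverse x = (L / real n) powr r" "inverse y = (L / real m) powr s"
      using L1 nm by (simp_all add: x_def y_def powr_divide)
    ultimately show ?thesis by (simp add: W_def L_def)
  qed
  then show ?thesis using D12 by (intro exI[of _ "2 * D"]) (auto simp: D_def)
qed

section \<open>Bias and noise of the estimators\<close>

text \<open>Used with \<open>y = f x\<close>: the labels split into bias, noise and a multiple of
  \<open>f x\<close> that cancels in the estimation error.\<close>

lemma sum_label:
  assumes "k \<le> n"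
  shows "(\<Sum>i=1..n. label f X eps (S i) * of_bool (i \<le> k)) =
    (\<Sum>i=1..k. f (X (S i)) - y) + (\<Sum>i=1..k. eps (S i)) + real k * y"
proof -
  have "(\<Sum>i=1..n. label f X eps (S i) * of_bool (i \<le> k)) = (\<Sum>i=1..k. label f X eps (S i))"
    using assms by (intro sum.mono_neutral_cong_right) auto
  then show ?thesis by (simp add: label_def sum.distrib sum_subtractf)
qed

text \<open>The crude bound serves the bad event; the second is the Cauchy-Schwarz inequality and
  serves the good one.\<close>

lemma bias_sum_bounds:
  assumes f: "f \<in> holder_class \<beta> F H"
  shows "\<bar>\<Sum>i=1..k. f (g i) - f x\<bar> \<le> 2 * F * real k"
    and "(\<Sum>i=1..k. f (g i) - f x)\<^sup>2 \<le> real k * (\<Sum>i=1..k. (f (g i) - f x)\<^sup>2)"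
proof -
  have b: "\<bar>f (g i) - f x\<bar> \<le> 2 * F" for i
  proof -
    have "\<bar>f (g i)\<bar> \<le> F" "\<bar>f x\<bar> \<le> F" using f by (simp_all add: holder_class_def)
    then show ?thesis by linarith
  qed
  have "\<bar>\<Sum>i=1..k. f (g i) - f x\<bar> \<le> (\<Sum>i=1..k. 2 * F)"
    by (rule order_trans[OF sum_abs]) (intro sum_mono b)
  then show "\<bar>\<Sum>i=1..k. f (g i) - f x\<bar> \<le> 2 * F * real k" by (simp add: mult.commute)
  show "(\<Sum>i=1..k. f (g i) - f x)\<^sup>2 \<le> real k * (\<Sum>i=1..k. (f (g i) - f x)\<^sup>2)"
    using sum_squared_le_sum_of_squares[of "\<lambda>i. f (g i) - f x" "{1..k}"] by (simp add: mult.commute)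
qed

lemma controlled_mono:
  assumes "controlled C L h k B E g" "C \<le> C'" "0 \<le> L" "0 \<le> g" "0 \<le> h"
  shows "controlled C' L h k B E g"
proof -
  have "C * (L * (real k + L) * (1 + g)) \<le> C' * (L * (real k + L) * (1 + g))"
    "C * L \<le> C' * L" "C * h \<le> C' * h"
    using assms by (intro mult_right_mono; auto)+
  then show ?thesis using assms(1) by (auto simp: controlled_def mult.assoc)
qed

lemma controlled_bias:
  assumes con: "controlled C L h k (\<Sum>i=1..k. (f (g i) - f x)\<^sup>2) E v" and "v < 1"
    and f: "f \<in> holder_class \<beta> F H"
  shows "(\<Sum>i=1..k. f (g i) - f x)\<^sup>2 \<le> real k * (C * L)"
proof -
  have "(\<Sum>i=1..k. (f (g i) - f x)\<^sup>2) \<le> C * L" using assms by (simp add: controlled_def)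
  then have "real k * (\<Sum>i=1..k. (f (g i) - f x)\<^sup>2) \<le> real k * (C * L)" by (intro mult_left_mono) auto
  with bias_sum_bounds(2)[OF f] show ?thesis by (rule order_trans)
qed

lemma controlled_ratio:
  assumes "controlled C L h k B E g" "g < 1" "q \<le> 1" "q \<le> L / real k"
  shows "q \<le> C * h"
  using assms unfolding controlled_def by (meson min.boundedI order_trans)

text \<open>Measurability is asked only of the majorant: the squared error \<open>d\<close> depends
  on an arbitrary tie-breaking rule, and monotonicity of the integral is enough.\<close>

lemma risk_integral:
  fixes G :: "'a \<Rightarrow> ennreal"
  assumes le: "AE x in Q. ennreal (d x) \<le> ennreal C * (ennreal (h x) + G x)"
    and [measurable]: "h \<in> borel_measurable Q" "G \<in> borel_measurable Q"
    and h: "(\<integral>\<^sup>+ x. ennreal (h x) \<partial>Q) \<le> ennreal H" and G: "(\<integral>\<^sup>+ x. G x \<partial>Q) \<le> ennreal \<delta>"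
    and pos: "0 \<le> C" "0 \<le> H" "0 \<le> \<delta>"
  shows "(\<integral>\<^sup>+ x. ennreal (d x) \<partial>Q) \<le> ennreal (C * (H + \<delta>))"
proof -
  have "(\<integral>\<^sup>+ x. ennreal (d x) \<partial>Q) \<le> (\<integral>\<^sup>+ x. ennreal C * (ennreal (h x) + G x) \<partial>Q)"
    by (rule nn_integral_mono_AE[OF le])
  also have "\<dots> = ennreal C * ((\<integral>\<^sup>+ x. ennreal (h x) \<partial>Q) + (\<integral>\<^sup>+ x. G x \<partial>Q))"
    by (simp add: nn_integral_cmult nn_integral_add)
  also have "\<dots> \<le> ennreal C * (ennreal H + ennreal \<delta>)"
    by (intro mult_left_mono add_mono h G) simp
  also have "\<dots> = ennreal (C * (H + \<delta>))" using pos by (simp add: ennreal_mult)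
  finally show ?thesis .
qed

section \<open>Rate of the one-sample estimator\<close>

lemma one_sample_rate:
  fixes P Q :: "(real ^ 'd) measure" and p q :: "real ^ 'd \<Rightarrow> real"
  assumes pos: "pmax > 0" "a_min > 0" "r_min > 0" "a_max > 0" "r_max > 0"
    "0 < \<beta>" "\<beta> \<le> 1" "F > 0" "H > 0" "\<gamma> > 0" "\<rho> > 0" "lambda0 > 0" "sigma0 > 0" "\<kappa> > 0"
    and P: "mass_class pmax a_min r_min a_max r_max P p"
    and Q: "target_class pmax a_min r_min a_max r_max p \<gamma> \<rho> Q q"
    and r: "r = min (rate_exp CARD('d) \<beta>) \<gamma>"
    and c: "0 < c1" "c1 \<le> c2" "1 < \<tau>"
  shows "\<exists>C3>0. \<exists>N0::nat. \<forall>n l f. \<forall>(M :: 'w measure) X eps \<nu> S.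
     N0 \<le> n \<and> l \<in> {1..n} \<and> c1 * ln (real n) \<le> real l \<and> real l \<le> c2 * ln (real n) \<and>
     f \<in> holder_class \<beta> F H \<and> noisy_sample M n X eps P lambda0 sigma0 \<nu> \<and>
     (\<forall>\<omega>\<in>space M. nn_ordering n (\<lambda>i. X i \<omega>) (S \<omega>)) \<longrightarrow>
     with_prob_at_least M (1 - 3 * real n powr (1 - \<tau>))
       (\<lambda>\<omega>. excess_risk Q
          (one_sample_local_nn \<beta> \<kappa> l n (\<lambda>i. X i \<omega>) (label f (\<lambda>i. X i \<omega>) (\<lambda>i. eps i \<omega>)) (S \<omega>)) f
        \<le> ennreal (C3 * (ln (real n) / real n) powr r))"
proof -
  define a where "a = rate_exp CARD('d) \<beta>"
  have a01: "0 < a" "a < 1" using rate_exp_bounds[OF pos(6), of "CARD('d)"] by (simp_all add: a_def)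
  have r01: "0 < r" "r \<le> a" "r \<le> \<gamma>" using a01 pos by (auto simp: r a_def)
  have \<tau>1: "0 < \<tau> + 1" and c2: "0 < c2" using c by simp_all
  \<comment> \<open>Since ln n \<le> n, the constant comparing the logarithm with the sample size is
    1 here. The deviation exponent \<tau> + 1 leaves room for Markov at level 1 / n.\<close>
  obtain C where C: "1 \<le> C" and env:
    "\<And>(M :: 'w measure) n N l X eps \<nu>. \<lbrakk>noisy_sample M n X eps P lambda0 sigma0 \<nu>; 1 \<le> n; n \<le> N; 1 \<le> ln (real N);
      1 * ln (real N) \<le> real n; l \<in> {1..n}; c1 * ln (real N) \<le> real l; real l \<le> c2 * ln (real N)\<rbrakk> \<Longrightarrow>
    \<exists>G. is_envelope M X eps n p pmax \<beta> F H \<kappa> (\<tau> + 1) C N l G"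
    using sample_envelope[where F = F and 'w = 'w, OF P pos(1-6,9,14) zero_less_one c(1) c2 \<tau>1 pos(12,13)]
    by blast
  obtain A where A: "0 \<le> A" "\<And>n L :: real. \<lbrakk>0 < n; 0 < L\<rbrakk> \<Longrightarrow>
      (\<integral>\<^sup>+ x. ennreal (min 1 ((n * p x / L) powr (- a))) \<partial>Q) \<le> ennreal (A * (L / n) powr r)"
    using source_rate_integral[OF P Q _ r01(2,3) pos(1)] r01(1) by auto
  define C' where "C' = 24 * C * C + 40 * C + 32 * F\<^sup>2"
  have C': "0 < C'" using C by (simp add: C'_def add_pos_nonneg)
  define C3 where "C3 = C' * (A + 1)"
  \<comment> \<open>n \<ge> 3 gives L \<ge> 1, and n \<ge> C bounds the failure probability C
    n^(-\<tau>) by n^(1 - \<tau>).\<close>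
  define N0 where "N0 = max 3 (nat \<lceil>C\<rceil>)"
  have [measurable]: "p \<in> borel_measurable borel" using P unfolding mass_class_def by blast
  have Qp: "prob_space Q" and Qd: "Q = density lborel q" using Q unfolding target_class_def mass_class_def by blast+
  have sQ[measurable_cong]: "sets Q = sets borel" by (simp add: Qd)
  have "with_prob_at_least M (1 - 3 * real n powr (1 - \<tau>))
       (\<lambda>\<omega>. excess_risk Q
          (one_sample_local_nn \<beta> \<kappa> l n (\<lambda>i. X i \<omega>) (label f (\<lambda>i. X i \<omega>) (\<lambda>i. eps i \<omega>)) (S \<omega>)) f
        \<le> ennreal (C3 * (ln (real n) / real n) powr r))"
    if n: "N0 \<le> n" and l: "l \<in> {1..n}" "c1 * ln (real n) \<le> real l" "real l \<le> c2 * ln (real n)"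
      and f: "f \<in> holder_class \<beta> F H" and sample: "noisy_sample M n X eps P lambda0 sigma0 \<nu>"
      and S: "\<And>\<omega>. \<omega> \<in> space M \<Longrightarrow> nn_ordering n (\<lambda>i. X i \<omega>) (S \<omega>)"
    for n l f and M :: "'w measure" and X eps \<nu> S
  proof -
    interpret noisy_sample M n X eps P lambda0 sigma0 \<nu> by fact
    define L where "L = ln (real n)"
    have n3: "3 \<le> n" "C \<le> real n" using n by (auto simp: N0_def)
    have L: "1 \<le> L" unfolding L_def by (rule ln_ge_one[OF n3(1)])
    have Ln: "1 * ln (real n) \<le> real n" using ln_bound[of "real n"] n3 by simp
    have n1: "1 \<le> n" using n3 by simp
    obtain G :: "real ^ 'd \<Rightarrow> 'w \<Rightarrow> ennreal" where
      G[measurable]: "(\<lambda>z. G (fst z) (snd z)) \<in> borel_measurable (borel \<Otimes>\<^sub>M M)"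
      and GI: "\<And>x. 0 < p x \<Longrightarrow> (\<integral>\<^sup>+ \<omega>. G x \<omega> \<partial>M) \<le> ennreal (C * exp (- (\<tau> + 1) * L))"
      and con: "\<And>\<omega> S x k. \<lbrakk>\<omega> \<in> space M; nn_ordering n (\<lambda>i. X i \<omega>) S; 0 < p x; p x \<le> pmax; G x \<omega> \<noteq> \<infinity>;
         k = local_k CARD('d) \<beta> \<kappa> n n (nn_density l n (\<lambda>i. X i \<omega>) S x)\<rbrakk> \<Longrightarrow>
           controlled C L ((real n * p x / L) powr (- a)) k
             (\<Sum>i=1..k. (f (X (S x i) \<omega>) - f x)\<^sup>2) (\<Sum>i=1..k. eps (S x i) \<omega>) (enn2real (G x \<omega>))"
      using env[OF sample n1 order_refl L[unfolded L_def] Ln l] f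
      unfolding is_envelope_def L_def a_def Let_def by blast
    have "AE x in Q. (\<integral>\<^sup>+ \<omega>. G x \<omega> \<partial>M) \<le> ennreal (C * exp (- (\<tau> + 1) * L))"
      using target_AE[OF P Q] by eventually_elim (rule GI, simp)
    from markov_section[OF prob_space_axioms Qp sQ G this, of "1 / real n"]
    obtain E where E: "E \<in> sets M" "1 - C * exp (- (\<tau> + 1) * L) * real n \<le> measure M E"
      "\<And>\<omega>. \<omega> \<in> E \<Longrightarrow> (\<integral>\<^sup>+ x. G x \<omega> \<partial>Q) \<le> ennreal (1 / real n)"
      using C n1 by auto
    have prob: "1 - 3 * real n powr (1 - \<tau>) \<le> measure M E"
    proof -
      have "exp (- (\<tau> + 1) * L) = real n powr (- (\<tau> + 1))" using n1 by (simp add: L_def powr_def)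
      then have "C * exp (- (\<tau> + 1) * L) * real n = C * real n powr (- \<tau>)"
        using n1 by (simp add: powr_diff powr_minus field_simps powr_add)
      also have "\<dots> \<le> real n * real n powr (- \<tau>)" using n3 by (intro mult_right_mono) auto
      also have "\<dots> = real n powr (1 - \<tau>)" using n1 by (simp add: powr_diff powr_minus field_simps)
      finally show ?thesis using E(2) powr_ge_zero[of "real n" "1 - \<tau>"] by linarith
    qed
    have risk: "excess_risk Q
          (one_sample_local_nn \<beta> \<kappa> l n (\<lambda>i. X i \<omega>) (label f (\<lambda>i. X i \<omega>) (\<lambda>i. eps i \<omega>)) (S \<omega>)) f
        \<le> ennreal (C3 * (ln (real n) / real n) powr r)" if \<omega>E: "\<omega> \<in> E" for \<omega>
    proof -
      have \<omega>: "\<omega> \<in> space M" using \<omega>E sets.sets_into_space[OF E(1)] by blast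
      note So = S[OF \<omega>]
      have Gm[measurable]: "(\<lambda>x. G x \<omega>) \<in> borel_measurable borel"
        using measurable_compose[OF measurable_Pair2'[OF \<omega>] G] by simp
      define est where "est = one_sample_local_nn \<beta> \<kappa> l n (\<lambda>i. X i \<omega>) (label f (\<lambda>i. X i \<omega>) (\<lambda>i. eps i \<omega>)) (S \<omega>)"
      define h where "h x = min 1 ((real n * p x / L) powr (- a))" for x
      have pw: "ennreal ((est x - f x)\<^sup>2) \<le> ennreal C' * (ennreal (h x) + G x \<omega>)" if px: "0 < p x" "p x \<le> pmax" for x
      proof (cases "G x \<omega> = \<infinity>")
        \<comment> \<open>An infinite envelope makes the right side infinite; this covers
          ties.\<close>
        case True
        then show ?thesis using C' by (simp add: ennreal_mult_top)
      next
        case False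
        define g where "g = enn2real (G x \<omega>)"
        define k where "k = local_k CARD('d) \<beta> \<kappa> n n (nn_density l n (\<lambda>i. X i \<omega>) (S \<omega>) x)"
        define b where "b = (\<Sum>i=1..k. f (X (S \<omega> x i) \<omega>) - f x)"
        define e where "e = (\<Sum>i=1..k. eps (S \<omega> x i) \<omega>)"
        have Gg: "G x \<omega> = ennreal g" "0 \<le> g" using False by (auto simp: g_def less_top)
        have kn: "k \<le> n" unfolding k_def by (rule local_k_le)
        have kL: "L \<le> real k" unfolding k_def L_def by (rule local_k_ge_ln[OF n1])
        then have k0: "0 < real k" using L by linarith
        note con = con[OF \<omega> So px False k_def, folded g_def e_def]
        have h0: "0 \<le> h x" by (simp add: h_def)
        \<comment> \<open>Written as a two-sample error with an empty second sample, to fit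
          \<open>risk_pointwise\<close>.\<close>
        have est: "est x - f x = (b + e + (0 + 0)) / (real k + real 0)"
          using k0 sum_label[OF kn, of f "\<lambda>i. X i \<omega>" "\<lambda>i. eps i \<omega>" "S \<omega> x" "f x"]
          by (simp add: est_def one_sample_local_nn_def one_sample_estimator_def k_def[symmetric] b_def e_def field_simps)
        have "((b + e + (0 + 0)) / (real k + real 0))\<^sup>2 \<le> C' * (h x + g + 0)"
          unfolding C'_def
        proof (rule risk_pointwise)
          show "\<bar>b\<bar> \<le> 2 * F * real k" unfolding b_def by (rule bias_sum_bounds(1)[OF f])
          show "b\<^sup>2 \<le> real k * (C * L)" if "g < 1" unfolding b_def by (rule controlled_bias[OF con that f])
          show "e\<^sup>2 \<le> C * L * (real k + L) * (1 + g)" using con by (simp add: controlled_def)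
          show "L / (real k + real 0) \<le> C * h x" if "g < 1"
          proof -
            have q1: "L / real k \<le> 1" using kL k0 by simp
            then have "L / real k \<le> C * (real n * p x / L) powr (- a)"
              by (rule controlled_ratio[OF con that]) simp
            with q1 C show ?thesis by (auto simp: h_def min_def)
          qed
        qed (use L kL C pos Gg h0 in auto)
        then have "(est x - f x)\<^sup>2 \<le> C' * (h x + g)" by (simp add: est)
        then have "ennreal ((est x - f x)\<^sup>2) \<le> ennreal (C' * (h x + g))" by (rule ennreal_leI)
        also have "\<dots> = ennreal C' * (ennreal (h x) + G x \<omega>)" using C' h0 Gg by (simp add: ennreal_mult)
        finally show ?thesis .
      qed
      have "(\<integral>\<^sup>+ x. ennreal ((est x - f x)\<^sup>2) \<partial>Q) \<le> ennreal (C' * (A * (L / real n) powr r + 1 / real n))"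
      proof (rule risk_integral)
        show "AE x in Q. ennreal ((est x - f x)\<^sup>2) \<le> ennreal C' * (ennreal (h x) + G x \<omega>)"
          using target_AE[OF P Q] by eventually_elim (rule pw, auto)
        show "h \<in> borel_measurable Q" unfolding h_def by measurable
        show "(\<lambda>x. G x \<omega>) \<in> borel_measurable Q" by measurable
        show "(\<integral>\<^sup>+ x. ennreal (h x) \<partial>Q) \<le> ennreal (A * (L / real n) powr r)"
          unfolding h_def using A(2)[of "real n" L] n1 L by simp
        show "(\<integral>\<^sup>+ x. G x \<omega> \<partial>Q) \<le> ennreal (1 / real n)" by (rule E(3)[OF \<omega>E])
      qed (use C' A in auto)
      also have "\<dots> \<le> ennreal (C3 * (L / real n) powr r)"
      proof (rule ennreal_leI)
        \<comment> \<open>The Markov level 1 / n is dominated by (L / n)^r because r \<le> 1 \<le>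
          L.\<close>
        have "1 / real n \<le> (1 / real n) powr r"
          using n1 r01 a01 powr_mono'[of r 1 "1 / real n"] by simp
        also have "\<dots> \<le> (L / real n) powr r"
          using L n1 r01 by (intro powr_mono2 divide_right_mono) auto
        finally have "C' * (A * (L / real n) powr r + 1 / real n) \<le> C' * (A * (L / real n) powr r + (L / real n) powr r)"
          using C' by (intro mult_left_mono) auto
        then show "C' * (A * (L / real n) powr r + 1 / real n) \<le> C3 * (L / real n) powr r"
          by (simp add: C3_def algebra_simps)
      qed
      finally show ?thesis by (simp add: excess_risk_def est_def L_def)
    qed
    show ?thesis unfolding with_prob_at_least_def using E(1) prob risk by blast
  qed
  moreover have "0 < C3" using C' A by (simp add: C3_def)
  ultimately show ?thesis by blast
qed

section \<open>Rate of the two-sample estimator\<close>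

lemma two_sample_rate:
  fixes P Q :: "(real ^ 'd) measure" and p q :: "real ^ 'd \<Rightarrow> real"
  assumes pos: "pmax > 0" "a_min > 0" "r_min > 0" "a_max > 0" "r_max > 0"
    "0 < \<beta>" "\<beta> \<le> 1" "F > 0" "H > 0" "\<gamma> > 0" "\<rho> > 0" "lambda0 > 0" "sigma0 > 0" "\<kappa>P > 0" "\<kappa>Q > 0"
    and P: "mass_class pmax a_min r_min a_max r_max P p"
    and Q: "target_class pmax a_min r_min a_max r_max p \<gamma> \<rho> Q q"
    and r: "r = min (rate_exp CARD('d) \<beta>) \<gamma>"
    and s: "s = min (\<rho> / (\<rho> + real CARD('d))) (rate_exp CARD('d) \<beta>)"
    and c: "0 < c0" "0 < c1" "c1 \<le> c2" "1 < \<tau>"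
  obtains C4 :: real and N0 :: nat where "0 < C4"
    and "\<And>n m l f (M :: 'w measure) X eps X' eps' \<nu> S S'.
     \<lbrakk>N0 \<le> n; N0 \<le> m; c0 * ln (real (n + m)) \<le> real (min n m); l \<in> {1..min n m};
     c1 * ln (real (n + m)) \<le> real l; real l \<le> c2 * ln (real (n + m));
     f \<in> holder_class \<beta> F H; noisy_sample M n X eps P lambda0 sigma0 \<nu>; noisy_sample M m X' eps' Q lambda0 sigma0 \<nu>;
     \<And>\<omega>. \<omega> \<in> space M \<Longrightarrow> nn_ordering n (\<lambda>i. X i \<omega>) (S \<omega>) \<and> nn_ordering m (\<lambda>j. X' j \<omega>) (S' \<omega>)\<rbrakk> \<Longrightarrow>
     with_prob_at_least M (1 - 3 * real n powr (1 - \<tau>) - 3 * real m powr (1 - \<tau>))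
       (\<lambda>\<omega>. excess_risk Q
          (two_sample_local_nn \<beta> \<kappa>P \<kappa>Q l
             n (\<lambda>i. X i \<omega>) (label f (\<lambda>i. X i \<omega>) (\<lambda>i. eps i \<omega>)) (S \<omega>)
             m (\<lambda>j. X' j \<omega>) (label f (\<lambda>j. X' j \<omega>) (\<lambda>j. eps' j \<omega>)) (S' \<omega>)) f
        \<le> ennreal (C4 * inverse ((real n / ln (real n)) powr r + (real m / ln (real m)) powr s)))"
proof -
  define a where "a = rate_exp CARD('d) \<beta>"
  have a01: "0 < a" "a < 1" using rate_exp_bounds[OF pos(6), of "CARD('d)"] by (simp_all add: a_def)
  have r01: "0 < r" "r \<le> a" "r \<le> \<gamma>" using a01 pos by (auto simp: r a_def)
  have s01: "0 < s" "s \<le> a" "s \<le> \<rho> / (\<rho> + real CARD('d))" using a01 pos by (auto simp: s a_def add_pos_pos)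
  have \<tau>1: "0 < \<tau> + 1" and c2: "0 < c2" using c by simp_all
  have Qm: "mass_class pmax a_min r_min a_max r_max Q q" using Q by (simp add: target_class_def)
  obtain CP where CP: "1 \<le> CP" and envP:
    "\<And>(M :: 'w measure) n N l X eps \<nu>. \<lbrakk>noisy_sample M n X eps P lambda0 sigma0 \<nu>; 1 \<le> n; n \<le> N; 1 \<le> ln (real N);
      c0 * ln (real N) \<le> real n; l \<in> {1..n}; c1 * ln (real N) \<le> real l; real l \<le> c2 * ln (real N)\<rbrakk> \<Longrightarrow>
    \<exists>G. is_envelope M X eps n p pmax \<beta> F H \<kappa>P (\<tau> + 1) CP N l G"
    using sample_envelope[where F = F and 'w = 'w, OF P pos(1-6,9,14) c(1,2) c2 \<tau>1 pos(12,13)]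
    by blast
  obtain CQ where CQ: "1 \<le> CQ" and envQ:
    "\<And>(M :: 'w measure) n N l X eps \<nu>. \<lbrakk>noisy_sample M n X eps Q lambda0 sigma0 \<nu>; 1 \<le> n; n \<le> N; 1 \<le> ln (real N);
      c0 * ln (real N) \<le> real n; l \<in> {1..n}; c1 * ln (real N) \<le> real l; real l \<le> c2 * ln (real N)\<rbrakk> \<Longrightarrow>
    \<exists>G. is_envelope M X eps n q pmax \<beta> F H \<kappa>Q (\<tau> + 1) CQ N l G"
    using sample_envelope[where F = F and 'w = 'w, OF Qm pos(1-6,9,15) c(1,2) c2 \<tau>1 pos(12,13)]
    by blast
  obtain A where A: "0 \<le> A" "\<And>n L :: real. \<lbrakk>0 < n; 0 < L\<rbrakk> \<Longrightarrow>
      (\<integral>\<^sup>+ x. ennreal (min 1 ((n * p x / L) powr (- a))) \<partial>Q) \<le> ennreal (A * (L / n) powr r)"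
    using source_rate_integral[OF P Q _ r01(2,3) pos(1)] r01(1) by auto
  obtain B where B: "0 \<le> B" "\<And>n L :: real. \<lbrakk>0 < n; 0 < L\<rbrakk> \<Longrightarrow>
      (\<integral>\<^sup>+ x. ennreal (min 1 ((n * q x / L) powr (- a))) \<partial>Q) \<le> ennreal (B * (L / n) powr s)"
    using target_rate_integral[OF Q _ s01(2,3) pos(1,11)] s01(1) by auto
  have rs1: "r \<le> 1" "s \<le> 1" using r01 s01 a01 by linarith+
  obtain D where D: "0 < D" and conv: "\<And>n m :: nat. \<lbrakk>3 \<le> n; 3 \<le> m\<rbrakk> \<Longrightarrow>
    min ((ln (real (n + m)) / real n) powr r) ((ln (real (n + m)) / real m) powr s)
      \<le> D * inverse ((real n / ln (real n)) powr r + (real m / ln (real m)) powr s)"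
    using rate_conversion[OF r01(1) rs1(1) s01(1) rs1(2)] by blast
  define C where "C = max CP CQ"
  have C: "1 \<le> C" "CP \<le> C" "CQ \<le> C" using CP by (auto simp: C_def)
  define C' where "C' = 24 * C * C + 40 * C + 32 * F\<^sup>2"
  have C': "0 < C'" using C by (simp add: C'_def add_pos_nonneg)
  define C4 where "C4 = C' * (A + B + 1) * D"
  \<comment> \<open>The factor 2 accounts for the sum of the two envelopes.\<close>
  define N0 where "N0 = max 3 (nat \<lceil>2 * C\<rceil>)"
  have [measurable]: "p \<in> borel_measurable borel" "q \<in> borel_measurable borel"
    using P Qm unfolding mass_class_def by blast+
  have Qp: "prob_space Q" and Qd: "Q = density lborel q" using Qm unfolding mass_class_def by blast+
  have sQ[measurable_cong]: "sets Q = sets borel" by (simp add: Qd)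
  have "with_prob_at_least M (1 - 3 * real n powr (1 - \<tau>) - 3 * real m powr (1 - \<tau>))
       (\<lambda>\<omega>. excess_risk Q
          (two_sample_local_nn \<beta> \<kappa>P \<kappa>Q l
             n (\<lambda>i. X i \<omega>) (label f (\<lambda>i. X i \<omega>) (\<lambda>i. eps i \<omega>)) (S \<omega>)
             m (\<lambda>j. X' j \<omega>) (label f (\<lambda>j. X' j \<omega>) (\<lambda>j. eps' j \<omega>)) (S' \<omega>)) f
        \<le> ennreal (C4 * inverse ((real n / ln (real n)) powr r + (real m / ln (real m)) powr s)))"
    if nm: "N0 \<le> n" "N0 \<le> m" "c0 * ln (real (n + m)) \<le> real (min n m)" and l0: "l \<in> {1..min n m}"
      and l: "c1 * ln (real (n + m)) \<le> real l" "real l \<le> c2 * ln (real (n + m))"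
      and f: "f \<in> holder_class \<beta> F H" and sampleP: "noisy_sample M n X eps P lambda0 sigma0 \<nu>"
      and sampleQ: "noisy_sample M m X' eps' Q lambda0 sigma0 \<nu>"
      and S: "\<And>\<omega>. \<omega> \<in> space M \<Longrightarrow> nn_ordering n (\<lambda>i. X i \<omega>) (S \<omega>) \<and> nn_ordering m (\<lambda>j. X' j \<omega>) (S' \<omega>)"
    for n m l f and M :: "'w measure" and X eps X' eps' \<nu> S S'
  proof -
    interpret noisy_sample M n X eps P lambda0 sigma0 \<nu> by fact
    define N where "N = n + m"
    define L where "L = ln (real N)"
    have n3: "3 \<le> n" "3 \<le> m" "2 * C \<le> real n" using nm by (auto simp: N0_def)
    have nN: "n \<le> N" "m \<le> N" "1 \<le> n" "1 \<le> m" "1 \<le> N" using n3 by (auto simp: N_def)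
    have L: "1 \<le> L" unfolding L_def N_def by (rule ln_ge_one) (use n3 in simp)
    have c0n: "c0 * ln (real N) \<le> real n" "c0 * ln (real N) \<le> real m" using nm(3) by (auto simp: N_def)
    have lnm: "l \<in> {1..n}" "l \<in> {1..m}" using l0 by auto
    note l = l[folded N_def]
    obtain GP where EP: "is_envelope M X eps n p pmax \<beta> F H \<kappa>P (\<tau> + 1) CP N l GP"
      using envP[OF sampleP nN(3,1) L[unfolded L_def] c0n(1) lnm(1) l] by blast
    obtain GQ where EQ: "is_envelope M X' eps' m q pmax \<beta> F H \<kappa>Q (\<tau> + 1) CQ N l GQ"
      using envQ[OF sampleQ nN(4,2) L[unfolded L_def] c0n(2) lnm(2) l] by blast
    have GPm[measurable]: "(\<lambda>z. GP (fst z) (snd z)) \<in> borel_measurable (borel \<Otimes>\<^sub>M M)"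
      and GPI: "\<And>x. 0 < p x \<Longrightarrow> (\<integral>\<^sup>+ \<omega>. GP x \<omega> \<partial>M) \<le> ennreal (CP * exp (- (\<tau> + 1) * L))"
      and conP: "\<And>\<omega> S x k. \<lbrakk>\<omega> \<in> space M; nn_ordering n (\<lambda>i. X i \<omega>) S; 0 < p x; p x \<le> pmax; GP x \<omega> \<noteq> \<infinity>;
         k = local_k CARD('d) \<beta> \<kappa>P N n (nn_density l n (\<lambda>i. X i \<omega>) S x)\<rbrakk> \<Longrightarrow>
           controlled CP L ((real n * p x / L) powr (- a)) k
             (\<Sum>i=1..k. (f (X (S x i) \<omega>) - f x)\<^sup>2) (\<Sum>i=1..k. eps (S x i) \<omega>) (enn2real (GP x \<omega>))"
      using EP f unfolding is_envelope_def L_def a_def Let_def by blast+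
    have GQm[measurable]: "(\<lambda>z. GQ (fst z) (snd z)) \<in> borel_measurable (borel \<Otimes>\<^sub>M M)"
      and GQI: "\<And>x. 0 < q x \<Longrightarrow> (\<integral>\<^sup>+ \<omega>. GQ x \<omega> \<partial>M) \<le> ennreal (CQ * exp (- (\<tau> + 1) * L))"
      and conQ: "\<And>\<omega> S x k. \<lbrakk>\<omega> \<in> space M; nn_ordering m (\<lambda>i. X' i \<omega>) S; 0 < q x; q x \<le> pmax; GQ x \<omega> \<noteq> \<infinity>;
         k = local_k CARD('d) \<beta> \<kappa>Q N m (nn_density l m (\<lambda>i. X' i \<omega>) S x)\<rbrakk> \<Longrightarrow>
           controlled CQ L ((real m * q x / L) powr (- a)) k
             (\<Sum>i=1..k. (f (X' (S x i) \<omega>) - f x)\<^sup>2) (\<Sum>i=1..k. eps' (S x i) \<omega>) (enn2real (GQ x \<omega>))"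
      using EQ f unfolding is_envelope_def L_def a_def Let_def by blast+
    define G where "G x \<omega> = GP x \<omega> + GQ x \<omega>" for x \<omega>
    have Gm: "(\<lambda>z. G (fst z) (snd z)) \<in> borel_measurable (borel \<Otimes>\<^sub>M M)" unfolding G_def by measurable
    have GI: "AE x in Q. (\<integral>\<^sup>+ \<omega>. G x \<omega> \<partial>M) \<le> ennreal (2 * C * exp (- (\<tau> + 1) * L))"
      using target_AE[OF P Q]
    proof eventually_elim
      case (elim x)
      have [measurable]: "GP x \<in> borel_measurable M" "GQ x \<in> borel_measurable M"
        using measurable_compose[OF measurable_Pair1' GPm, of x] measurable_compose[OF measurable_Pair1' GQm, of x]
        by simp_all
      have "(\<integral>\<^sup>+ \<omega>. G x \<omega> \<partial>M) = (\<integral>\<^sup>+ \<omega>. GP x \<omega> \<partial>M) + (\<integral>\<^sup>+ \<omega>. GQ x \<omega> \<partial>M)"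
        unfolding G_def by (rule nn_integral_add) measurable
      also have "\<dots> \<le> ennreal (CP * exp (- (\<tau> + 1) * L)) + ennreal (CQ * exp (- (\<tau> + 1) * L))"
        using elim by (intro add_mono GPI GQI) auto
      also have "\<dots> \<le> ennreal (C * exp (- (\<tau> + 1) * L)) + ennreal (C * exp (- (\<tau> + 1) * L))"
        using C by (intro add_mono ennreal_leI mult_right_mono) auto
      also have "\<dots> = ennreal (2 * C * exp (- (\<tau> + 1) * L))"
        using C by (simp add: ennreal_plus[symmetric] del: ennreal_plus)
      finally show ?case .
    qed
    from markov_section[OF prob_space_axioms Qp sQ Gm GI, of "1 / real N"]
    obtain E where E: "E \<in> sets M" "1 - 2 * C * exp (- (\<tau> + 1) * L) * real N \<le> measure M E"
      "\<And>\<omega>. \<omega> \<in> E \<Longrightarrow> (\<integral>\<^sup>+ x. G x \<omega> \<partial>Q) \<le> ennreal (1 / real N)"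
      using C nN by auto
    have prob: "1 - 3 * real n powr (1 - \<tau>) - 3 * real m powr (1 - \<tau>) \<le> measure M E"
    proof -
      have "exp (- (\<tau> + 1) * L) = real N powr (- (\<tau> + 1))" using nN by (simp add: L_def powr_def)
      then have "2 * C * exp (- (\<tau> + 1) * L) * real N = 2 * C * real N powr (- \<tau>)"
        using nN by (simp add: powr_diff powr_minus field_simps powr_add)
      also have "\<dots> \<le> real N * real N powr (- \<tau>)" using n3 nN by (intro mult_right_mono) auto
      also have "\<dots> = real N powr (1 - \<tau>)" using nN by (simp add: powr_diff powr_minus field_simps)
      \<comment> \<open>The negative exponent 1 - \<tau> allows passing from \<open>N\<close> to the
        smaller \<open>n\<close>; this term alone is within the allowed failure probability.\<close>
      also have "\<dots> \<le> real n powr (1 - \<tau>)" using nN c by (intro powr_mono2') auto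
      finally show ?thesis using E(2) powr_ge_zero[of "real n" "1 - \<tau>"] powr_ge_zero[of "real m" "1 - \<tau>"]
        by linarith
    qed
    define est where "est \<omega> = two_sample_local_nn \<beta> \<kappa>P \<kappa>Q l
             n (\<lambda>i. X i \<omega>) (label f (\<lambda>i. X i \<omega>) (\<lambda>i. eps i \<omega>)) (S \<omega>)
             m (\<lambda>j. X' j \<omega>) (label f (\<lambda>j. X' j \<omega>) (\<lambda>j. eps' j \<omega>)) (S' \<omega>)" for \<omega>
    have risk: "excess_risk Q (est \<omega>) f
        \<le> ennreal (C4 * inverse ((real n / ln (real n)) powr r + (real m / ln (real m)) powr s))" if \<omega>E: "\<omega> \<in> E" for \<omega>
    proof -
      have \<omega>: "\<omega> \<in> space M" using \<omega>E sets.sets_into_space[OF E(1)] by blast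
      have So: "nn_ordering n (\<lambda>i. X i \<omega>) (S \<omega>)" and So': "nn_ordering m (\<lambda>j. X' j \<omega>) (S' \<omega>)" using S[OF \<omega>] by auto
      have [measurable]: "(\<lambda>x. G x \<omega>) \<in> borel_measurable borel"
        using measurable_compose[OF measurable_Pair2'[OF \<omega>] Gm] by simp
      define hP where "hP x = (real n * p x / L) powr (- a)" for x
      define hQ where "hQ x = (real m * q x / L) powr (- a)" for x
      \<comment> \<open>L / (kP + kQ) lies below both L / kP and L / kQ, so the better of the two
        bounds is available at every point.\<close>
      define h where "h x = min 1 (min (hP x) (hQ x))" for x
      have pw: "ennreal ((est \<omega> x - f x)\<^sup>2) \<le> ennreal C' * (ennreal (h x) + G x \<omega>)"
        if px: "0 < p x" "p x \<le> pmax" and qx: "0 < q x" "q x \<le> pmax" for x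
      proof (cases "GP x \<omega> = \<infinity> \<or> GQ x \<omega> = \<infinity>")
        case True
        then have "G x \<omega> = \<infinity>" by (auto simp: G_def)
        then show ?thesis using C' by (simp add: ennreal_mult_top)
      next
        case False
        define gP where "gP = enn2real (GP x \<omega>)"
        define gQ where "gQ = enn2real (GQ x \<omega>)"
        define kP where "kP = local_k CARD('d) \<beta> \<kappa>P N n (nn_density l n (\<lambda>i. X i \<omega>) (S \<omega>) x)"
        define kQ where "kQ = local_k CARD('d) \<beta> \<kappa>Q N m (nn_density l m (\<lambda>i. X' i \<omega>) (S' \<omega>) x)"
        define bP where "bP = (\<Sum>i=1..kP. f (X (S \<omega> x i) \<omega>) - f x)"
        define bQ where "bQ = (\<Sum>i=1..kQ. f (X' (S' \<omega> x i) \<omega>) - f x)"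
        define eP where "eP = (\<Sum>i=1..kP. eps (S \<omega> x i) \<omega>)"
        define eQ where "eQ = (\<Sum>i=1..kQ. eps' (S' \<omega> x i) \<omega>)"
        have g: "GP x \<omega> = ennreal gP" "0 \<le> gP" "GQ x \<omega> = ennreal gQ" "0 \<le> gQ"
          using False by (auto simp: gP_def gQ_def less_top)
        have kn: "kP \<le> n" "kQ \<le> m" unfolding kP_def kQ_def by (rule local_k_le)+
        have kL: "L \<le> real kP + real kQ" and k0: "0 < real kP" "0 < real kQ"
        proof -
          have 1: "ln (real n) \<le> real kP" "ln (real m) \<le> real kQ"
            unfolding kP_def kQ_def by (rule local_k_ge_ln[OF nN(3)], rule local_k_ge_ln[OF nN(4)])
          with ln_ge_one[OF n3(1)] ln_ge_one[OF n3(2)] show "0 < real kP" "0 < real kQ" by linarith+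
          \<comment> \<open>Each neighbour number is only known to be at least the logarithm of its
            own sample size; n + m \<le> n m makes their sum at least L = ln (n + m).\<close>
          have "N \<le> n * m"
          proof -
            have "n + m \<le> max n m * 2" by simp
            also have "\<dots> \<le> max n m * min n m" using n3 by (intro mult_le_mono2) auto
            also have "\<dots> = n * m" by (simp add: max_def min_def)
            finally show ?thesis by (simp add: N_def)
          qed
          then have "real N \<le> real n * real m" by (metis of_nat_le_iff of_nat_mult)
          then have "L \<le> ln (real n * real m)" unfolding L_def using nN by (intro ln_mono) auto
          also have "\<dots> = ln (real n) + ln (real m)" using nN by (simp add: ln_mult)
          finally show "L \<le> real kP + real kQ" using 1 by linarith
        qed
        have h0: "0 \<le> hP x" "0 \<le> hQ x" "0 \<le> h x" by (auto simp: h_def hP_def hQ_def)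
        have cP: "controlled C L (hP x) kP (\<Sum>i=1..kP. (f (X (S \<omega> x i) \<omega>) - f x)\<^sup>2) eP gP"
        proof (rule controlled_mono[OF _ C(2)])
          show "controlled CP L (hP x) kP (\<Sum>i=1..kP. (f (X (S \<omega> x i) \<omega>) - f x)\<^sup>2) eP gP"
            unfolding hP_def eP_def gP_def by (rule conP[OF \<omega> So px _ kP_def]) (use False in auto)
        qed (use L h0 g in auto)
        have cQ: "controlled C L (hQ x) kQ (\<Sum>i=1..kQ. (f (X' (S' \<omega> x i) \<omega>) - f x)\<^sup>2) eQ gQ"
        proof (rule controlled_mono[OF _ C(3)])
          show "controlled CQ L (hQ x) kQ (\<Sum>i=1..kQ. (f (X' (S' \<omega> x i) \<omega>) - f x)\<^sup>2) eQ gQ"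
            unfolding hQ_def eQ_def gQ_def by (rule conQ[OF \<omega> So' qx _ kQ_def]) (use False in auto)
        qed (use L h0 g in auto)
        have est: "est \<omega> x - f x = (bP + eP + (bQ + eQ)) / (real kP + real kQ)"
        proof -
          have "est \<omega> x = 1 / (real kP + real kQ) * ((bP + eP + real kP * f x) + (bQ + eQ + real kQ * f x))"
            unfolding est_def two_sample_local_nn_def two_sample_estimator_def N_def[symmetric]
              kP_def[symmetric] kQ_def[symmetric] bP_def eP_def bQ_def eQ_def
            by (simp only: sum_label[OF kn(1), of f _ _ _ "f x"] sum_label[OF kn(2), of f _ _ _ "f x"])
          also have "\<dots> = (bP + eP + (bQ + eQ)) / (real kP + real kQ) + f x"
            using k0 by (simp add: field_simps add_pos_pos)
          finally show ?thesis by simp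
        qed
        have "((bP + eP + (bQ + eQ)) / (real kP + real kQ))\<^sup>2 \<le> C' * (h x + gP + gQ)"
          unfolding C'_def
        proof (rule risk_pointwise)
          show "\<bar>bP\<bar> \<le> 2 * F * real kP" unfolding bP_def by (rule bias_sum_bounds(1)[OF f])
          show "\<bar>bQ\<bar> \<le> 2 * F * real kQ" unfolding bQ_def by (rule bias_sum_bounds(1)[OF f])
          show "bP\<^sup>2 \<le> real kP * (C * L)" if "gP < 1" unfolding bP_def by (rule controlled_bias[OF cP that f])
          show "bQ\<^sup>2 \<le> real kQ * (C * L)" if "gQ < 1" unfolding bQ_def by (rule controlled_bias[OF cQ that f])
          show "eP\<^sup>2 \<le> C * L * (real kP + L) * (1 + gP)" using cP by (simp add: controlled_def)
          show "eQ\<^sup>2 \<le> C * L * (real kQ + L) * (1 + gQ)" using cQ by (simp add: controlled_def)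
          show "L / (real kP + real kQ) \<le> C * h x" if "gP < 1" "gQ < 1"
          proof -
            have q1: "L / (real kP + real kQ) \<le> 1" using kL k0 by simp
            have "L / (real kP + real kQ) \<le> C * hP x"
              by (rule controlled_ratio[OF cP that(1) q1]) (use L k0 in \<open>auto intro!: divide_left_mono\<close>)
            moreover have "L / (real kP + real kQ) \<le> C * hQ x"
              by (rule controlled_ratio[OF cQ that(2) q1]) (use L k0 in \<open>auto intro!: divide_left_mono\<close>)
            ultimately show ?thesis using q1 C by (auto simp: h_def min_def)
          qed
        qed (use L kL C pos g h0 in auto)
        then have "(est \<omega> x - f x)\<^sup>2 \<le> C' * (h x + (gP + gQ))" by (simp add: est add.assoc)
        then have "ennreal ((est \<omega> x - f x)\<^sup>2) \<le> ennreal (C' * (h x + (gP + gQ)))" by (rule ennreal_leI)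
        also have "\<dots> = ennreal C' * (ennreal (h x) + G x \<omega>)" using C' h0 g by (simp add: ennreal_mult G_def)
        finally show ?thesis .
      qed
      define u v where "u = (L / real n) powr r" and "v = (L / real m) powr s"
      have uv0: "0 \<le> u" "0 \<le> v" by (auto simp: u_def v_def)
      \<comment> \<open>\<open>h\<close> lies below each of the two integrands; the one with the
        smaller rate is used.\<close>
      have hle: "(\<integral>\<^sup>+ x. ennreal (h x) \<partial>Q) \<le> ennreal ((A + B) * min u v)"
      proof (cases "u \<le> v")
        case True
        have "(\<integral>\<^sup>+ x. ennreal (h x) \<partial>Q) \<le> (\<integral>\<^sup>+ x. ennreal (min 1 (hP x)) \<partial>Q)"
          by (intro nn_integral_mono ennreal_leI) (auto simp: h_def)
        also have "\<dots> \<le> ennreal (A * u)"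
          unfolding hP_def u_def using A(2)[of "real n" L] nN L by simp
        also have "\<dots> \<le> ennreal ((A + B) * min u v)"
          using True A B uv0 by (intro ennreal_leI) (simp add: mult_right_mono)
        finally show ?thesis .
      next
        case False
        have "(\<integral>\<^sup>+ x. ennreal (h x) \<partial>Q) \<le> (\<integral>\<^sup>+ x. ennreal (min 1 (hQ x)) \<partial>Q)"
          by (intro nn_integral_mono ennreal_leI) (auto simp: h_def)
        also have "\<dots> \<le> ennreal (B * v)"
          unfolding hQ_def v_def using B(2)[of "real m" L] nN L by simp
        also have "\<dots> \<le> ennreal ((A + B) * min u v)"
          using False A B uv0 by (intro ennreal_leI) (simp add: mult_right_mono)
        finally show ?thesis .
      qed
      have "(\<integral>\<^sup>+ x. ennreal ((est \<omega> x - f x)\<^sup>2) \<partial>Q) \<le> ennreal (C' * ((A + B) * min u v + 1 / real N))"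
      proof (rule risk_integral)
        show "AE x in Q. ennreal ((est \<omega> x - f x)\<^sup>2) \<le> ennreal C' * (ennreal (h x) + G x \<omega>)"
          using target_AE[OF P Q] by eventually_elim (rule pw, auto)
        show "h \<in> borel_measurable Q" unfolding h_def hP_def hQ_def by measurable
        show "(\<lambda>x. G x \<omega>) \<in> borel_measurable Q" by measurable
        show "(\<integral>\<^sup>+ x. ennreal (h x) \<partial>Q) \<le> ennreal ((A + B) * min u v)" by (rule hle)
        show "(\<integral>\<^sup>+ x. G x \<omega> \<partial>Q) \<le> ennreal (1 / real N)" by (rule E(3)[OF \<omega>E])
      qed (use C' A B uv0 in auto)
      also have "\<dots> \<le> ennreal (C4 * inverse ((real n / ln (real n)) powr r + (real m / ln (real m)) powr s))"
      proof (rule ennreal_leI)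
        \<comment> \<open>The Markov level, now 1 / N, is dominated by both rates.\<close>
        have small: "1 / real N \<le> (L / real k) powr z" if "1 \<le> k" "k \<le> N" "0 < z" "z \<le> 1" for k z
        proof -
          have "1 / real N \<le> 1 / real k" using that by (intro divide_left_mono) auto
          also have "\<dots> \<le> (1 / real k) powr z"
            using that powr_mono'[of z 1 "1 / real k"] by simp
          also have "\<dots> \<le> (L / real k) powr z"
            using L that by (intro powr_mono2 divide_right_mono) auto
          finally show ?thesis .
        qed
        have "1 / real N \<le> min u v"
          unfolding u_def v_def using small[of n r] small[of m s] nN r01 s01 rs1 by auto
        then have "C' * ((A + B) * min u v + 1 / real N) \<le> C' * ((A + B) * min u v + min u v)"
          using C' by (intro mult_left_mono) auto
        also have "\<dots> = C' * (A + B + 1) * min u v" by (simp add: algebra_simps)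
        \<comment> \<open>Only here does the minimum turn into the inverse of the sum, with ln n and
          ln m in place of L.\<close>
        also have "\<dots> \<le> C' * (A + B + 1) * (D * inverse ((real n / ln (real n)) powr r + (real m / ln (real m)) powr s))"
          using conv[OF n3(1,2)] C' A B by (intro mult_left_mono) (auto simp: u_def v_def L_def N_def)
        finally show "C' * ((A + B) * min u v + 1 / real N)
            \<le> C4 * inverse ((real n / ln (real n)) powr r + (real m / ln (real m)) powr s)"
          by (simp add: C4_def mult.assoc)
      qed
      finally show ?thesis by (simp add: excess_risk_def)
    qed
    show ?thesis unfolding with_prob_at_least_def est_def[symmetric] using E(1) prob risk by blast
  qed
  moreover have "0 < C4" using C' A B D by (simp add: C4_def)
  ultimately show ?thesis by (rule that[rotated])
qed

section \<open>Both claims for the covariate shift model\<close>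

theorem theorem2:
  fixes P Q :: "(real ^ 'd) measure" and p q :: "real ^ 'd \<Rightarrow> real"
    and pmax a_min r_min a_max r_max \<beta> F L \<gamma> \<rho> lambda0 sigma0 \<kappa>P \<kappa>Q rT rM :: real
  assumes "pmax > 0" "a_min > 0" "r_min > 0" "a_max > 0" "r_max > 0"
    and "0 < \<beta>" "\<beta> \<le> 1" "F > 0" "L > 0" "\<gamma> > 0" "\<rho> > 0"
    and "lambda0 > 0" "sigma0 > 0" "\<kappa>P > 0" "\<kappa>Q > 0"
    and "mass_class pmax a_min r_min a_max r_max P p"
    and "target_class pmax a_min r_min a_max r_max p \<gamma> \<rho> Q q"
    and "rT = min (2 * \<beta> / (2 * \<beta> + real CARD('d))) \<gamma>"
    and "rM = min (\<rho> / (\<rho> + real CARD('d))) (2 * \<beta> / (2 * \<beta> + real CARD('d)))"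
  shows
    "(\<forall>c1 c2 \<tau>. 0 < c1 \<and> c1 \<le> c2 \<and> 1 < \<tau> \<longrightarrow>
       (\<exists>C3>0. \<forall>l :: nat \<Rightarrow> nat.
          (\<forall>n\<ge>1. l n \<in> {1..n}) \<and>
          (\<forall>\<^sub>F n in sequentially. c1 * ln (real n) \<le> real (l n) \<and> real (l n) \<le> c2 * ln (real n)) \<longrightarrow>
          (\<exists>N>0. \<forall>n\<ge>N. \<forall>m. \<forall>f\<in>holder_class \<beta> F L.
             \<forall>(M :: 'w measure) X eps X' eps' S.
               covariate_shift_model P Q lambda0 sigma0 M n m X eps X' eps' \<and>
               (\<forall>\<omega>\<in>space M. nn_ordering n (\<lambda>i. X i \<omega>) (S \<omega>)) \<longrightarrow>
               with_prob_at_least M (1 - 3 * real n powr (1 - \<tau>))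
                 (\<lambda>\<omega>. excess_risk Q
                        (one_sample_local_nn \<beta> \<kappa>P (l n) n (\<lambda>i. X i \<omega>)
                           (label f (\<lambda>i. X i \<omega>) (\<lambda>i. eps i \<omega>)) (S \<omega>)) f
                      \<le> ennreal (C3 * (ln (real n) / real n) powr rT)))))
     \<and>
     (\<forall>c0 c1 c2 \<tau>. 0 < c0 \<and> 0 < c1 \<and> c1 \<le> c2 \<and> 1 < \<tau> \<longrightarrow>
       (\<exists>N\<ge>2 * CARD('d). \<exists>M0\<ge>2 * CARD('d). \<exists>C4>0. \<forall>n\<ge>N. \<forall>m\<ge>M0.
          c0 * ln (real (n + m)) \<le> real (min n m) \<longrightarrow>
          (\<forall>l\<in>{1..min n m}.
             c1 * ln (real (n + m)) \<le> real l \<and> real l \<le> c2 * ln (real (n + m)) \<longrightarrow>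
             (\<forall>f\<in>holder_class \<beta> F L. \<forall>(M :: 'w measure) X eps X' eps' S S'.
               covariate_shift_model P Q lambda0 sigma0 M n m X eps X' eps' \<and>
               (\<forall>\<omega>\<in>space M. nn_ordering n (\<lambda>i. X i \<omega>) (S \<omega>) \<and> nn_ordering m (\<lambda>j. X' j \<omega>) (S' \<omega>)) \<longrightarrow>
               with_prob_at_least M (1 - 3 * real n powr (1 - \<tau>) - 3 * real m powr (1 - \<tau>))
                 (\<lambda>\<omega>. excess_risk Q
                        (two_sample_local_nn \<beta> \<kappa>P \<kappa>Q l
                           n (\<lambda>i. X i \<omega>) (label f (\<lambda>i. X i \<omega>) (\<lambda>i. eps i \<omega>)) (S \<omega>)
                           m (\<lambda>j. X' j \<omega>) (label f (\<lambda>j. X' j \<omega>) (\<lambda>j. eps' j \<omega>)) (S' \<omega>)) f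
                      \<le> ennreal (C4 * inverse ((real n / ln (real n)) powr rT
                                              + (real m / ln (real m)) powr rM)))))))"
proof -
  note pos = assms(1-15) and P = assms(16) and Q = assms(17) and rT = assms(18) and rM = assms(19)
  have rT': "rT = min (rate_exp CARD('d) \<beta>) \<gamma>" and rM': "rM = min (\<rho> / (\<rho> + real CARD('d))) (rate_exp CARD('d) \<beta>)"
    by (simp_all add: rT rM rate_exp_def)
  show ?thesis
  proof (rule conjI; intro allI impI; elim conjE)
    fix c1 c2 \<tau> :: real
    assume c: "0 < c1" "c1 \<le> c2" "1 < \<tau>"
    obtain C3 N0 where C3: "0 < C3" and main: "\<And>n l f (M :: 'w measure) X eps \<nu> S.
     \<lbrakk>N0 \<le> n; l \<in> {1..n}; c1 * ln (real n) \<le> real l; real l \<le> c2 * ln (real n);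
     f \<in> holder_class \<beta> F L; noisy_sample M n X eps P lambda0 sigma0 \<nu>;
     \<forall>\<omega>\<in>space M. nn_ordering n (\<lambda>i. X i \<omega>) (S \<omega>)\<rbrakk> \<Longrightarrow>
     with_prob_at_least M (1 - 3 * real n powr (1 - \<tau>))
       (\<lambda>\<omega>. excess_risk Q
          (one_sample_local_nn \<beta> \<kappa>P l n (\<lambda>i. X i \<omega>) (label f (\<lambda>i. X i \<omega>) (\<lambda>i. eps i \<omega>)) (S \<omega>)) f
        \<le> ennreal (C3 * (ln (real n) / real n) powr rT))"
      using one_sample_rate[where 'w = 'w, OF pos(1-14) P Q rT' c] by blast
    show "\<exists>C3>0. \<forall>l :: nat \<Rightarrow> nat.
          (\<forall>n\<ge>1. l n \<in> {1..n}) \<and>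
          (\<forall>\<^sub>F n in sequentially. c1 * ln (real n) \<le> real (l n) \<and> real (l n) \<le> c2 * ln (real n)) \<longrightarrow>
          (\<exists>N>0. \<forall>n\<ge>N. \<forall>m. \<forall>f\<in>holder_class \<beta> F L.
             \<forall>(M :: 'w measure) X eps X' eps' S.
               covariate_shift_model P Q lambda0 sigma0 M n m X eps X' eps' \<and>
               (\<forall>\<omega>\<in>space M. nn_ordering n (\<lambda>i. X i \<omega>) (S \<omega>)) \<longrightarrow>
               with_prob_at_least M (1 - 3 * real n powr (1 - \<tau>))
                 (\<lambda>\<omega>. excess_risk Q
                        (one_sample_local_nn \<beta> \<kappa>P (l n) n (\<lambda>i. X i \<omega>)
                           (label f (\<lambda>i. X i \<omega>) (\<lambda>i. eps i \<omega>)) (S \<omega>)) f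
                      \<le> ennreal (C3 * (ln (real n) / real n) powr rT)))"
    proof (intro exI[of _ C3] conjI C3 allI impI; elim conjE)
      fix l :: "nat \<Rightarrow> nat"
      assume l: "\<forall>n\<ge>1. l n \<in> {1..n}"
        and "\<forall>\<^sub>F n in sequentially. c1 * ln (real n) \<le> real (l n) \<and> real (l n) \<le> c2 * ln (real n)"
      then obtain N1 where N1: "\<And>n. N1 \<le> n \<Longrightarrow> c1 * ln (real n) \<le> real (l n) \<and> real (l n) \<le> c2 * ln (real n)"
        unfolding eventually_sequentially by blast
      show "\<exists>N>0. \<forall>n\<ge>N. \<forall>m. \<forall>f\<in>holder_class \<beta> F L.
             \<forall>(M :: 'w measure) X eps X' eps' S.
               covariate_shift_model P Q lambda0 sigma0 M n m X eps X' eps' \<and>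
               (\<forall>\<omega>\<in>space M. nn_ordering n (\<lambda>i. X i \<omega>) (S \<omega>)) \<longrightarrow>
               with_prob_at_least M (1 - 3 * real n powr (1 - \<tau>))
                 (\<lambda>\<omega>. excess_risk Q
                        (one_sample_local_nn \<beta> \<kappa>P (l n) n (\<lambda>i. X i \<omega>)
                           (label f (\<lambda>i. X i \<omega>) (\<lambda>i. eps i \<omega>)) (S \<omega>)) f
                      \<le> ennreal (C3 * (ln (real n) / real n) powr rT))"
      \<comment> \<open>\<open>N1\<close> is where the logarithmic bounds on \<open>l\<close> begin
        to hold; it enters the threshold but not \<open>C3\<close>.\<close>
      proof (intro exI[of _ "max 1 (max N0 N1)"] conjI allI impI ballI; (elim conjE)?)
        fix n m and f :: "real ^ 'd \<Rightarrow> real" and M :: "'w measure" and X eps X' eps' S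
        assume n: "max 1 (max N0 N1) \<le> n" and f: "f \<in> holder_class \<beta> F L"
          and model: "covariate_shift_model P Q lambda0 sigma0 M n m X eps X' eps'"
          and S: "\<forall>\<omega>\<in>space M. nn_ordering n (\<lambda>i. X i \<omega>) (S \<omega>)"
        obtain \<nu> where "noisy_sample M n X eps P lambda0 sigma0 \<nu>"
          using model_samples[OF model pos(12,13)] by blast
        then show "with_prob_at_least M (1 - 3 * real n powr (1 - \<tau>))
                 (\<lambda>\<omega>. excess_risk Q
                        (one_sample_local_nn \<beta> \<kappa>P (l n) n (\<lambda>i. X i \<omega>)
                           (label f (\<lambda>i. X i \<omega>) (\<lambda>i. eps i \<omega>)) (S \<omega>)) f
                      \<le> ennreal (C3 * (ln (real n) / real n) powr rT))"
          using main[of n "l n" f M X eps \<nu> S] n l N1[of n] f S by simp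
      qed simp
    qed
  next
    fix c0 c1 c2 \<tau> :: real
    assume c: "0 < c0" "0 < c1" "c1 \<le> c2" "1 < \<tau>"
    obtain C4 N0 where C4: "0 < C4" and main: "\<And>n m l f (M :: 'w measure) X eps X' eps' \<nu> S S'.
     \<lbrakk>N0 \<le> n; N0 \<le> m; c0 * ln (real (n + m)) \<le> real (min n m); l \<in> {1..min n m};
     c1 * ln (real (n + m)) \<le> real l; real l \<le> c2 * ln (real (n + m));
     f \<in> holder_class \<beta> F L; noisy_sample M n X eps P lambda0 sigma0 \<nu>; noisy_sample M m X' eps' Q lambda0 sigma0 \<nu>;
     \<And>\<omega>. \<omega> \<in> space M \<Longrightarrow> nn_ordering n (\<lambda>i. X i \<omega>) (S \<omega>) \<and> nn_ordering m (\<lambda>j. X' j \<omega>) (S' \<omega>)\<rbrakk> \<Longrightarrow>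
     with_prob_at_least M (1 - 3 * real n powr (1 - \<tau>) - 3 * real m powr (1 - \<tau>))
       (\<lambda>\<omega>. excess_risk Q
          (two_sample_local_nn \<beta> \<kappa>P \<kappa>Q l
             n (\<lambda>i. X i \<omega>) (label f (\<lambda>i. X i \<omega>) (\<lambda>i. eps i \<omega>)) (S \<omega>)
             m (\<lambda>j. X' j \<omega>) (label f (\<lambda>j. X' j \<omega>) (\<lambda>j. eps' j \<omega>)) (S' \<omega>)) f
        \<le> ennreal (C4 * inverse ((real n / ln (real n)) powr rT + (real m / ln (real m)) powr rM)))"
    proof (rule two_sample_rate[where 'w = 'w, OF pos P Q rT' rM' c], goal_cases)
      case (1 C4 N0)
      show ?case by (rule 1(1)[OF 1(2,3)])
    qed
    let ?N = "max N0 (2 * CARD('d))"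
    show "\<exists>N\<ge>2 * CARD('d). \<exists>M0\<ge>2 * CARD('d). \<exists>C4>0. \<forall>n\<ge>N. \<forall>m\<ge>M0.
          c0 * ln (real (n + m)) \<le> real (min n m) \<longrightarrow>
          (\<forall>l\<in>{1..min n m}.
             c1 * ln (real (n + m)) \<le> real l \<and> real l \<le> c2 * ln (real (n + m)) \<longrightarrow>
             (\<forall>f\<in>holder_class \<beta> F L. \<forall>(M :: 'w measure) X eps X' eps' S S'.
               covariate_shift_model P Q lambda0 sigma0 M n m X eps X' eps' \<and>
               (\<forall>\<omega>\<in>space M. nn_ordering n (\<lambda>i. X i \<omega>) (S \<omega>) \<and> nn_ordering m (\<lambda>j. X' j \<omega>) (S' \<omega>)) \<longrightarrow>
               with_prob_at_least M (1 - 3 * real n powr (1 - \<tau>) - 3 * real m powr (1 - \<tau>))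
                 (\<lambda>\<omega>. excess_risk Q
                        (two_sample_local_nn \<beta> \<kappa>P \<kappa>Q l
                           n (\<lambda>i. X i \<omega>) (label f (\<lambda>i. X i \<omega>) (\<lambda>i. eps i \<omega>)) (S \<omega>)
                           m (\<lambda>j. X' j \<omega>) (label f (\<lambda>j. X' j \<omega>) (\<lambda>j. eps' j \<omega>)) (S' \<omega>)) f
                      \<le> ennreal (C4 * inverse ((real n / ln (real n)) powr rT
                                              + (real m / ln (real m)) powr rM)))))"
    proof (intro exI[of _ ?N] exI[of _ C4] conjI C4 allI impI ballI; (elim conjE)?)
      fix n m l and f :: "real ^ 'd \<Rightarrow> real" and M :: "'w measure" and X eps X' eps' S S'
      assume nm: "?N \<le> n" "?N \<le> m" "c0 * ln (real (n + m)) \<le> real (min n m)"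
        and l: "l \<in> {1..min n m}" "c1 * ln (real (n + m)) \<le> real l" "real l \<le> c2 * ln (real (n + m))"
        and f: "f \<in> holder_class \<beta> F L"
        and model: "covariate_shift_model P Q lambda0 sigma0 M n m X eps X' eps'"
        and S: "\<forall>\<omega>\<in>space M. nn_ordering n (\<lambda>i. X i \<omega>) (S \<omega>) \<and> nn_ordering m (\<lambda>j. X' j \<omega>) (S' \<omega>)"
      obtain \<nu> where sP: "noisy_sample M n X eps P lambda0 sigma0 \<nu>" and sQ: "noisy_sample M m X' eps' Q lambda0 sigma0 \<nu>"
        using model_samples[OF model pos(12,13)] by blast
      have N0: "N0 \<le> n" "N0 \<le> m" using nm by auto
      show "with_prob_at_least M (1 - 3 * real n powr (1 - \<tau>) - 3 * real m powr (1 - \<tau>))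
                 (\<lambda>\<omega>. excess_risk Q
                        (two_sample_local_nn \<beta> \<kappa>P \<kappa>Q l
                           n (\<lambda>i. X i \<omega>) (label f (\<lambda>i. X i \<omega>) (\<lambda>i. eps i \<omega>)) (S \<omega>)
                           m (\<lambda>j. X' j \<omega>) (label f (\<lambda>j. X' j \<omega>) (\<lambda>j. eps' j \<omega>)) (S' \<omega>)) f
                      \<le> ennreal (C4 * inverse ((real n / ln (real n)) powr rT
                                              + (real m / ln (real m)) powr rM)))"
        by (rule main[OF N0 nm(3) l f sP sQ]) (use S in blast)
    qed simp_all
  qed
qed

end
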